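(* Consider the defocusing equation $u_{tt}-\Delta u+u^7=0$ on $\mathbb{R}^{3+1}$. For any $M_1,M_2>0$ there exist $K\ge1$ and smooth compactly supported radial data $(f,g)$ with support in $B_K(0)\subset\mathbb{R}^3$ such that $$\|(f,g)\|_{\dot H^{\frac76}\times\dot H^{\frac16}(\mathbb{R}^3)}>M_1,$$ the evolution of these data exists on $0\le t\le \frac K2$ as a smooth function $u$, and $$\inf_{\frac1p+\frac1q=\frac12,\ p>2}\big\||\nabla_x|^{\alpha(q)}u\big\|_{L^p_tL^q_x([0,K/2]\times\mathbb{R}^3)}\ge 1,\qquad \alpha(q)=\tfrac2q+\tfrac16,$$ as well as $$\|f\|_{L^\infty_x(\{|x|\ge1\})}>M_2.$$
   Context: $\dot H^s$ denotes homogeneous Sobolev spaces and $|\nabla_x|^{\alpha}$ the Fourier multiplier with symbol $|\xi|^\alpha$. *)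

theory Defs
  imports "HOL-Analysis.Analysis" "HOL-Probability.Essential_Supremum"
begin

fun dd :: "'a::real_normed_vector set \<Rightarrow> 'a list \<Rightarrow> ('a \<Rightarrow> real) \<Rightarrow> 'a \<Rightarrow> real" where
  "dd S [] f = f"
| "dd S (v # vs) f = (\<lambda>x. frechet_derivative (dd S vs f) (at x within S) v)"

text \<open>C-infinity on S: all iterated derivatives exist (hence are continuous).\<close>
definition smooth_on :: "'a::real_normed_vector set \<Rightarrow> ('a \<Rightarrow> real) \<Rightarrow> bool" where
  "smooth_on S f \<longleftrightarrow> (\<forall>vs. \<forall>x\<in>S. dd S vs f differentiable (at x within S))"

definition radial :: "(real^3 \<Rightarrow> real) \<Rightarrow> bool" where
  "radial f \<longleftrightarrow> (\<forall>x y. norm x = norm y \<longrightarrow> f x = f y)"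

definition ft :: "(real^3 \<Rightarrow> complex) \<Rightarrow> real^3 \<Rightarrow> complex" where
  "ft h \<xi> = (\<integral>x. h x * cis (- 2 * pi * (x \<bullet> \<xi>)) \<partial>lborel)"

definition ift :: "(real^3 \<Rightarrow> complex) \<Rightarrow> real^3 \<Rightarrow> complex" where
  "ift h x = (\<integral>\<xi>. h \<xi> * cis (2 * pi * (x \<bullet> \<xi>)) \<partial>lborel)"

definition fracD :: "real \<Rightarrow> (real^3 \<Rightarrow> real) \<Rightarrow> real^3 \<Rightarrow> complex" where
  "fracD \<alpha> h = ift (\<lambda>\<xi>. complex_of_real (norm \<xi> powr \<alpha>) * ft (\<lambda>x. complex_of_real (h x)) \<xi>)"

text \<open>Powers on [0,\<infinity>] with positive real exponent.\<close>
definition ennpowr :: "ennreal \<Rightarrow> real \<Rightarrow> ennreal" where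
  "ennpowr x r = (if x = \<infinity> then \<infinity> else ennreal (enn2real x powr r))"

definition hdot_norm :: "real \<Rightarrow> (real^3 \<Rightarrow> real) \<Rightarrow> ennreal" where
  "hdot_norm s h = ennpowr (\<integral>\<^sup>+ \<xi>. ennreal (norm \<xi> powr (2 * s) * (cmod (ft (\<lambda>x. complex_of_real (h x)) \<xi>))\<^sup>2) \<partial>lborel) (1/2)"

definition data_norm :: "(real^3 \<Rightarrow> real) \<Rightarrow> (real^3 \<Rightarrow> real) \<Rightarrow> ennreal" where
  "data_norm f g = ennpowr ((hdot_norm (7/6) f)\<^sup>2 + (hdot_norm (1/6) g)\<^sup>2) (1/2)"

definition strichartz :: "real \<Rightarrow> real \<Rightarrow> real \<Rightarrow> real \<Rightarrow> (real \<Rightarrow> real^3 \<Rightarrow> real) \<Rightarrow> ennreal" where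
  "strichartz p q \<alpha> T u = ennpowr
     (\<integral>\<^sup>+ t. indicator {0..T} t *
        ennpowr (\<integral>\<^sup>+ x. ennreal (cmod (fracD \<alpha> (u t) x) powr q) \<partial>lborel) (p / q) \<partial>lborel) (1 / p)"

definition nlw_solution :: "real \<Rightarrow> (real^3 \<Rightarrow> real) \<Rightarrow> (real^3 \<Rightarrow> real) \<Rightarrow> (real \<Rightarrow> real^3 \<Rightarrow> real) \<Rightarrow> bool" where
  "nlw_solution T f g u \<longleftrightarrow>
     (let S = {0..T} \<times> (UNIV :: (real^3) set); U = (\<lambda>(t, x). u t x) in
       smooth_on S U \<and>
       (\<forall>t x. 0 \<le> t \<and> t \<le> T \<longrightarrow>
          dd S [(1, 0), (1, 0)] U (t, x)
          - (\<Sum>i\<in>UNIV. dd S [(0, axis i 1), (0, axis i 1)] U (t, x))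
          + (u t x) ^ 7 = 0) \<and>
       (\<forall>x. u 0 x = f x \<and> dd S [(1, 0)] U (0, x) = g x))"

end

theory Submission
  imports Defs "HOL-Probability.Characteristic_Functions" "HOL-Probability.Sinc_Integral"
begin

text \<open>
  The solution is a thin outgoing shell. Take \<open>K = 4\<close> and write
  \<open>r u = F (r - t) + w (r + t, r - t)\<close>, where \<open>F\<close> is a bump of fixed large height \<open>A\<close> and tiny
  width \<open>\<epsilon>\<close> centred at \<open>7/2\<close>. Up to time \<open>K/2 = 2\<close> nothing reaches the origin, so the equation
  reduces to the one-dimensional \<open>4 \<partial>\<^sub>p \<partial>\<^sub>q w = r\<^sup>-\<^sup>6 (F + w)\<^sup>7\<close> with zero Cauchy data, and since
  \<open>F\<close> lives on a set of width \<open>\<epsilon>\<close> the right-hand side is integrably small: \<open>w\<close> is found by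
  contraction and is uniformly small. Smoothness follows because inverting \<open>\<partial>\<^sub>p \<partial>\<^sub>q\<close> gains one derivative.

  For the lower bounds let \<open>\<Delta>\<^sub>h u (x) = 2 u (x) - u (x + h) - u (x - h)\<close> with \<open>\<bar>h\<bar> = 8 \<epsilon>\<close>. On a part of the
  shell of volume of order \<open>\<epsilon>\<close> one has \<open>\<Delta>\<^sub>h u \<ge> 1\<close>, because \<open>x + h\<close> and \<open>x - h\<close> lie off the shell.
  Superposing second differences of Gaussians gives a kernel \<open>k\<close> with \<open>\<Delta>\<^sub>h u = k * \<bar>\<nabla>\<bar>\<^sup>\<alpha> u\<close> and
  \<open>L\<^sup>1\<close> norm of order \<open>\<bar>h\<bar>\<^sup>\<alpha>\<close>, so that \<open>\<integral> \<bar>\<bar>\<nabla>\<bar>\<^sup>\<alpha> u\<bar>\<^sup>q\<close> is at least of order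
  \<open>\<epsilon> (c \<epsilon>\<^sup>-\<^sup>\<alpha>)\<^sup>q\<close>; as \<open>\<alpha> q = 2 + q/6\<close>, this exceeds \<open>1\<close> for all \<open>q > 2\<close> once \<open>\<epsilon>\<close> is small.
  Plancherel applied to \<open>\<Delta>\<^sub>h f\<close> shows likewise that the Sobolev norm of the data is large.
\<close>

subsection \<open>Smooth functions\<close>

text \<open>The height \<open>A\<close> is fixed by \<open>M2\<close> alone and \<epsilon> is shrunk
  afterwards, so a wave that stays nearly free still has a \<open>7/6\<close>-norm at least of order
  \<epsilon>^(-2/3). The exponents 2/q + 1/6 fill (1/6, 7/6) and pass 1, as does 7/6 itself. This
  forces second differences: a first difference vanishes only to first order at zero frequency, and
  its superposition of Gaussians converges at large scales only for \<alpha> < 1, whereas second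
  differences allow every \<alpha> < 2. The infimum demands one \<epsilon> for all q. Hence the
  kernel constants are bounded uniformly in \<alpha>, and the surplus q/6 in \<alpha> q pays for the
  q-th power of those constants. The equation asks for derivatives relative to a closed time slab
  and for smoothness at the origin; both are met by building a function of t and |x|^2 that is
  smooth on the whole plane, with the radius regularised near 0, where the solution
  vanishes.\<close>

primrec Ck :: "nat \<Rightarrow> ('a::real_normed_vector \<Rightarrow> real) \<Rightarrow> bool" where
  "Ck 0 f \<longleftrightarrow> continuous_on UNIV f"
| "Ck (Suc n) f \<longleftrightarrow> (\<forall>x. f differentiable (at x)) \<and> (\<forall>v. Ck n (\<lambda>x. frechet_derivative f (at x) v))"

text \<open>Uniqueness of the derivative lets any candidate stand in for
  \<open>frechet_derivative\<close>. Since \<open>Ck\<close> differentiates along one fixed vector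
  at a time, as \<open>dd\<close> does, every iterate stays real-valued and no space of linear maps
  enters the inductions.\<close>

lemma Ck_SucI:
  assumes "\<And>x. (f has_derivative f' x) (at x)" "\<And>v. Ck n (\<lambda>x. f' x v)"
  shows "Ck (Suc n) f"
proof -
  have "f' x = frechet_derivative f (at x)" for x
    using assms(1) by (rule frechet_derivative_at)
  then have "Ck n (\<lambda>x. frechet_derivative f (at x) v)" for v
    using assms(2)[of v] by simp
  moreover have "\<forall>x. f differentiable (at x)"
    using assms(1) by (auto simp: differentiable_def)
  ultimately show ?thesis by simp
qed

lemma Ck_SucE:
  assumes "Ck (Suc n) f"
  obtains f' where "\<And>x. (f has_derivative f' x) (at x)" "\<And>v. Ck n (\<lambda>x. f' x v)"
proof (rule that)
  show "(f has_derivative frechet_derivative f (at x)) (at x)" for x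
    using assms by (simp add: frechet_derivative_works[symmetric])
  show "Ck n (\<lambda>x. frechet_derivative f (at x) v)" for v
    using assms by simp
qed

lemma Ck_continuous: "Ck n f \<Longrightarrow> continuous_on UNIV f"
  by (cases n) (auto intro!: differentiable_imp_continuous_on simp: differentiable_on_def)

lemma Ck_Suc_imp: "Ck (Suc n) f \<Longrightarrow> Ck n f"
proof (induction n arbitrary: f)
  case 0
  then show ?case using Ck_continuous[OF 0] by simp
next
  case (Suc n)
  from Suc.prems show ?case
    by (subst Ck.simps, subst (asm) Ck.simps) (auto intro: Suc.IH)
qed

lemma Ck_const: "Ck n (\<lambda>x. c)"
  by (induction n arbitrary: c) (auto intro!: Ck_SucI[where f' = "\<lambda>x v. 0"] simp del: Ck.simps(2))

lemma Ck_linear: "bounded_linear f \<Longrightarrow> Ck n f"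
  by (cases n) (auto intro!: Ck_SucI[where f' = "\<lambda>x. f"] bounded_linear.has_derivative Ck_const
      linear_continuous_on bounded_linear_imp_has_derivative simp del: Ck.simps(2))

lemma Ck_add: "Ck n f \<Longrightarrow> Ck n g \<Longrightarrow> Ck n (\<lambda>x. f x + g x)"
proof (induction n arbitrary: f g)
  case 0
  then show ?case by (auto intro: continuous_on_add)
next
  case (Suc n)
  obtain f' where f: "\<And>x. (f has_derivative f' x) (at x)" "\<And>v. Ck n (\<lambda>x. f' x v)"
    using Suc.prems(1) by (rule Ck_SucE) (rule that)
  obtain g' where g: "\<And>x. (g has_derivative g' x) (at x)" "\<And>v. Ck n (\<lambda>x. g' x v)"
    using Suc.prems(2) by (rule Ck_SucE) (rule that)
  show ?case
    by (rule Ck_SucI[where f' = "\<lambda>x v. f' x v + g' x v"])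
      (rule has_derivative_add[OF f(1) g(1)], intro Suc.IH f g)
qed

lemma Ck_mult: "Ck n f \<Longrightarrow> Ck n g \<Longrightarrow> Ck n (\<lambda>x. f x * g x)"
proof (induction n arbitrary: f g)
  case 0
  then show ?case by (auto intro: continuous_on_mult)
next
  case (Suc n)
  obtain f' where f: "\<And>x. (f has_derivative f' x) (at x)" "\<And>v. Ck n (\<lambda>x. f' x v)"
    using Suc.prems(1) by (rule Ck_SucE) (rule that)
  obtain g' where g: "\<And>x. (g has_derivative g' x) (at x)" "\<And>v. Ck n (\<lambda>x. g' x v)"
    using Suc.prems(2) by (rule Ck_SucE) (rule that)
  show ?case
    by (rule Ck_SucI[where f' = "\<lambda>x v. f x * g' x v + f' x v * g x"])
      (rule has_derivative_mult[OF f(1) g(1)], intro Ck_add Suc.IH f g Ck_Suc_imp[OF Suc.prems(1)] Ck_Suc_imp[OF Suc.prems(2)])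
qed

lemma Ck_cmult: "Ck n f \<Longrightarrow> Ck n (\<lambda>x. c * f x)"
  by (intro Ck_mult Ck_const)

lemma Ck_minus: "Ck n f \<Longrightarrow> Ck n (\<lambda>x. - f x)"
  using Ck_cmult[of n f "-1"] by simp

lemma Ck_diff: "Ck n f \<Longrightarrow> Ck n g \<Longrightarrow> Ck n (\<lambda>x. f x - g x)"
  using Ck_add[of n f "\<lambda>x. - g x"] Ck_minus[of n g] by simp

lemma Ck_sum: "(\<And>i. i \<in> I \<Longrightarrow> Ck n (f i)) \<Longrightarrow> Ck n (\<lambda>x. \<Sum>i\<in>I. f i x)"
  by (induction I rule: infinite_finite_induct) (simp_all add: Ck_const Ck_add del: Ck.simps)

lemma Ck_power: "Ck n f \<Longrightarrow> Ck n (\<lambda>x. f x ^ k)"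
  by (induction k) (simp_all add: Ck_const Ck_mult del: Ck.simps)

text \<open>By the chain rule the derivative along \<open>v\<close> is a finite sum of component
  derivatives times derivatives of \<open>f\<close> along basis vectors. This is why \<Phi> is
  assumed smooth componentwise.\<close>

lemma Ck_compose:
  fixes f :: "'b::euclidean_space \<Rightarrow> real" and \<Phi> :: "'a::real_normed_vector \<Rightarrow> 'b"
  assumes "Ck n f" "\<And>b. b \<in> Basis \<Longrightarrow> Ck n (\<lambda>x. \<Phi> x \<bullet> b)"
  shows "Ck n (\<lambda>x. f (\<Phi> x))"
  using assms
proof (induction n arbitrary: f \<Phi>)
  case 0
  have "continuous_on UNIV \<Phi>"
    using 0 by (subst continuous_on_componentwise) auto
  then show ?case using 0(1) by (auto intro: continuous_on_compose2)
next
  case (Suc n)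
  obtain f' where f: "\<And>x. (f has_derivative f' x) (at x)" "\<And>v. Ck n (\<lambda>x. f' x v)"
    using Suc.prems(1) by (rule Ck_SucE) (rule that)
  define g' where "g' b x = frechet_derivative (\<lambda>x. \<Phi> x \<bullet> b) (at x)" for b x
  have g: "((\<lambda>x. \<Phi> x \<bullet> b) has_derivative g' b x) (at x)" "Ck n (\<lambda>x. g' b x v)"
    if "b \<in> Basis" for b x v
    using Suc.prems(2)[OF that] by (simp_all add: g'_def frechet_derivative_works[symmetric])
  define \<Phi>' where "\<Phi>' x v = (\<Sum>b\<in>Basis. g' b x v *\<^sub>R b)" for x v
  have "(\<Phi> has_derivative \<Phi>' x) (at x)" for x
    by (subst has_derivative_componentwise_within) (auto simp: \<Phi>'_def g)
  then have "((\<lambda>x. f (\<Phi> x)) has_derivative (\<lambda>v. f' (\<Phi> x) (\<Phi>' x v))) (at x)" for x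
    using f(1) by (rule has_derivative_compose)
  moreover have "f' (\<Phi> x) (\<Phi>' x v) = (\<Sum>b\<in>Basis. g' b x v * f' (\<Phi> x) b)" for x v
  proof -
    interpret bounded_linear "f' (\<Phi> x)" using f(1) by (rule has_derivative_bounded_linear)
    show ?thesis unfolding \<Phi>'_def sum by (intro sum.cong refl) (simp add: scaleR)
  qed
  moreover have "Ck n (\<lambda>x. f' (\<Phi> x) b)" for b
    by (rule Suc.IH[OF f(2)]) (rule Ck_Suc_imp[OF Suc.prems(2)])
  ultimately show ?case
    by (intro Ck_SucI) (assumption, simp only:, intro Ck_sum Ck_mult g)
qed

lemma Ck_compose_real: "Ck n f \<Longrightarrow> Ck n g \<Longrightarrow> Ck n (\<lambda>x. f (g x :: real))"
  by (rule Ck_compose) (simp_all del: Ck.simps)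

lemma Ck_compose_pair:
  fixes f :: "real \<times> real \<Rightarrow> real"
  shows "Ck n f \<Longrightarrow> Ck n g \<Longrightarrow> Ck n h \<Longrightarrow> Ck n (\<lambda>x. f (g x, h x))"
  by (rule Ck_compose) (auto simp: Basis_prod_def simp del: Ck.simps)

lemma Ck_inverse: "Ck n f \<Longrightarrow> (\<And>x. f x \<noteq> 0) \<Longrightarrow> Ck n (\<lambda>x. inverse (f x))"
proof (induction n arbitrary: f)
  case 0
  then show ?case by (auto intro: continuous_on_inverse)
next
  case (Suc n)
  obtain f' where f: "\<And>x. (f has_derivative f' x) (at x)" "\<And>v. Ck n (\<lambda>x. f' x v)"
    using Suc.prems(1) by (rule Ck_SucE) (rule that)
  show ?case
    by (rule Ck_SucI[where f' = "\<lambda>x v. - (inverse (f x) * f' x v * inverse (f x))"])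
      (rule Deriv.has_derivative_inverse[OF Suc.prems(2) f(1)],
       intro Ck_minus Ck_mult f Suc.IH Suc.prems Ck_Suc_imp[OF Suc.prems(1)])
qed

lemma Ck_sqrt: "Ck n f \<Longrightarrow> (\<And>x. f x > 0) \<Longrightarrow> Ck n (\<lambda>x. sqrt (f x))"
proof (induction n arbitrary: f)
  case 0
  then show ?case by (auto intro: continuous_on_real_sqrt)
next
  case (Suc n)
  obtain f' where f: "\<And>x. (f has_derivative f' x) (at x)" "\<And>v. Ck n (\<lambda>x. f' x v)"
    using Suc.prems(1) by (rule Ck_SucE) (rule that)
  have "f x > 0" for x by (rule Suc.prems)
  then have pos: "f x \<noteq> 0" "sqrt (f x) \<noteq> 0" for x
    by (metis less_irrefl) (metis \<open>f x > 0\<close> less_irrefl real_sqrt_eq_zero_cancel_iff)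
  show ?case
  proof (rule Ck_SucI[where f' = "\<lambda>x v. f' x v * (1/2 * inverse (sqrt (f x)))"])
    show "((\<lambda>x. sqrt (f x)) has_derivative (\<lambda>v. f' x v * (1/2 * inverse (sqrt (f x))))) (at x)" for x
      by (rule has_derivative_eq_rhs, rule has_derivative_real_sqrt[OF \<open>f x > 0\<close> f(1)])
        (simp add: field_simps)
    show "Ck n (\<lambda>x. f' x v * (1/2 * inverse (sqrt (f x))))" for v
      by (intro Ck_mult Ck_cmult Ck_inverse f Suc.IH pos Suc.prems Ck_Suc_imp[OF Suc.prems(1)])
  qed
qed

definition Cinf :: "('a::real_normed_vector \<Rightarrow> real) \<Rightarrow> bool" where
  "Cinf f \<longleftrightarrow> (\<forall>n. Ck n f)"

lemma CinfI: "(\<And>n. Ck n f) \<Longrightarrow> Cinf f" and CinfD: "Cinf f \<Longrightarrow> Ck n f"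
  by (auto simp: Cinf_def)

lemma Cinf_has_derivative: "Cinf f \<Longrightarrow> (f has_derivative frechet_derivative f (at x)) (at x)"
  using CinfD[of f 1] by (simp add: frechet_derivative_works)

lemma Cinf_derivative: "Cinf f \<Longrightarrow> Cinf (\<lambda>x. frechet_derivative f (at x) v)"
  using CinfD[of f "Suc _"] by (intro CinfI) simp

lemma Cinf_dd: "Cinf f \<Longrightarrow> Cinf (dd UNIV vs f)"
  by (induction vs) (auto intro: Cinf_derivative)

text \<open>A derivative relative to \<open>S\<close> may fail to be unique, and
  \<open>frechet_derivative\<close> is then an arbitrary choice. Assumption \<open>S\<close> allows
  arbitrarily small steps inside \<open>S\<close> along each basis vector, which forces uniqueness;
  so iterated derivatives within \<open>S\<close> are those of the global extension.\<close>

lemma dd_within: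
  fixes f :: "'a::euclidean_space \<Rightarrow> real"
  assumes "Cinf f"
    and S: "\<And>x i e. x \<in> S \<Longrightarrow> i\<in>Basis \<Longrightarrow> e>0 \<Longrightarrow> \<exists>d. 0 < \<bar>d\<bar> \<and> \<bar>d\<bar> < e \<and> (x + d *\<^sub>R i) \<in> S"
  shows "\<forall>x\<in>S. dd S vs f x = dd UNIV vs f x"
    and "x \<in> S \<Longrightarrow> (dd S vs f has_derivative frechet_derivative (dd UNIV vs f) (at x)) (at x within S)"
proof -
  have *: "(g has_derivative frechet_derivative h (at x)) (at x within S)"
    if "\<forall>x\<in>S. g x = h x" "Cinf h" "x \<in> S" for x and g h :: "'a \<Rightarrow> real"
    using has_derivative_at_withinI[OF Cinf_has_derivative[OF that(2)]] that(1,3)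
    by (metis has_derivative_transform)
  have uniq: "frechet_derivative g (at x within S) = frechet_derivative h (at x)"
    if "\<forall>x\<in>S. g x = h x" "Cinf h" "x \<in> S" for x and g h :: "'a \<Rightarrow> real"
    using *[OF that] that(3) S[OF that(3)]
    by (metis differentiable_def frechet_derivative_unique_within frechet_derivative_works)
  show eq: "\<forall>x\<in>S. dd S vs f x = dd UNIV vs f x"
  proof (induction vs)
    case (Cons v vs)
    show ?case
      using uniq[OF Cons Cinf_dd[OF assms(1)]] by simp
  qed simp
  show "x \<in> S \<Longrightarrow> (dd S vs f has_derivative frechet_derivative (dd UNIV vs f) (at x)) (at x within S)"
    using *[OF eq Cinf_dd[OF assms(1)]] by blast
qed

lemma smooth_onI:
  fixes f :: "'a::euclidean_space \<Rightarrow> real"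
  assumes "Cinf f"
    and S: "\<And>x i e. x \<in> S \<Longrightarrow> i\<in>Basis \<Longrightarrow> e>0 \<Longrightarrow> \<exists>d. 0 < \<bar>d\<bar> \<and> \<bar>d\<bar> < e \<and> (x + d *\<^sub>R i) \<in> S"
  shows "smooth_on S f"
  unfolding smooth_on_def differentiable_def using dd_within(2)[OF assms] by blast

lemma smooth_on_UNIV:
  fixes f :: "'a::euclidean_space \<Rightarrow> real"
  assumes "Cinf f" shows "smooth_on UNIV f"
proof (rule smooth_onI[OF assms])
  fix x i :: 'a and e :: real
  assume "e > 0"
  then show "\<exists>d. 0 < \<bar>d\<bar> \<and> \<bar>d\<bar> < e \<and> x + d *\<^sub>R i \<in> UNIV"
    by (intro exI[of _ "e / 2"]) auto
qed

subsection \<open>Functions of two real variables\<close>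

text \<open>Two partial derivatives yield a total derivative once one of them is continuous; here it
  is the one in \<open>q\<close>.\<close>

lemma has_derivative_pair:
  fixes f :: "real \<times> real \<Rightarrow> real"
  assumes A: "\<And>p q. ((\<lambda>p. f (p,q)) has_field_derivative A (p,q)) (at p)"
    and B: "\<And>p q. ((\<lambda>q. f (p,q)) has_field_derivative B (p,q)) (at q)"
    and cont: "continuous_on UNIV B"
  shows "(f has_derivative (\<lambda>v. A z * fst v + B z * snd v)) (at z)"
proof -
  obtain p q where z: "z = (p,q)" by (cases z)
  have "((\<lambda>(x, y). f (x,y)) has_derivative (\<lambda>(tx, ty). A (p,q) * tx + blinfun_mult_right (B (p,q)) ty))
     (at (p, q) within UNIV \<times> UNIV)"
  proof (rule has_derivative_partialsI[where fy = "\<lambda>x y. blinfun_mult_right (B (x,y))" and f = "\<lambda>x y. f (x,y)"])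
    show "((\<lambda>x. f (x, q)) has_derivative (*) (A (p, q))) (at p within UNIV)"
      using A by (simp add: has_field_derivative_def)
    show "((\<lambda>y. f (x,y)) has_derivative blinfun_apply (blinfun_mult_right (B (x,y)))) (at y within UNIV)" for x y
      using B by (simp add: has_field_derivative_def)
    have "isCont B (p,q)" using cont by (simp add: continuous_on_eq_continuous_at)
    then have "isCont (\<lambda>z. blinfun_mult_right (B z)) (p,q)"
      by (intro bounded_linear.isCont[OF bounded_linear_blinfun_mult_right])
    then show "continuous (at (p, q) within UNIV \<times> UNIV) (\<lambda>(x, y). blinfun_mult_right (B (x, y)))"
      by (simp add: case_prod_unfold)
  qed auto
  then show ?thesis unfolding z by (simp add: case_prod_unfold)
qed

lemma Ck_SucI_pair:
  fixes f :: "real \<times> real \<Rightarrow> real"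
  assumes A: "\<And>p q. ((\<lambda>p. f (p,q)) has_field_derivative A (p,q)) (at p)"
    and B: "\<And>p q. ((\<lambda>q. f (p,q)) has_field_derivative B (p,q)) (at q)"
    and "Ck n A" "Ck n B"
  shows "Ck (Suc n) f"
proof (rule Ck_SucI)
  show "(f has_derivative (\<lambda>v. A z * fst v + B z * snd v)) (at z)" for z
    by (rule has_derivative_pair[OF A B]) (rule Ck_continuous[OF assms(4)])
  show "Ck n (\<lambda>z. A z * fst v + B z * snd v)" for v
    using assms(3,4) by (intro Ck_add Ck_mult Ck_const)
qed

lemma Ck_fst: "Ck n (fst :: real \<times> real \<Rightarrow> real)" and Ck_snd: "Ck n (snd :: real \<times> real \<Rightarrow> real)"
  by (auto intro: Ck_linear bounded_linear_fst bounded_linear_snd)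

lemma Ck_partials:
  fixes f :: "real \<times> real \<Rightarrow> real"
  assumes "Ck (Suc n) f"
  obtains A B where "\<And>p q. ((\<lambda>p. f (p,q)) has_field_derivative A (p,q)) (at p)"
    "\<And>p q. ((\<lambda>q. f (p,q)) has_field_derivative B (p,q)) (at q)" "Ck n A" "Ck n B"
proof -
  obtain f' where f: "\<And>x. (f has_derivative f' x) (at x)" "\<And>v. Ck n (\<lambda>x. f' x v)"
    using assms by (rule Ck_SucE) (rule that)
  have "((\<lambda>p. f (p,q)) has_field_derivative f' (p,q) (1,0)) (at p)" for p q
  proof -
    interpret bounded_linear "f' (p,q)" using f(1) by (rule has_derivative_bounded_linear)
    have "((\<lambda>p. f (p,q)) has_derivative (\<lambda>v. f' (p,q) (v,0))) (at p)"
      by (rule has_derivative_compose[OF _ f(1)]) (auto intro!: derivative_eq_intros)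
    moreover have "(\<lambda>v. f' (p,q) (v,0)) = (*) (f' (p,q) (1,0))"
    proof
      show "f' (p,q) (v,0) = f' (p,q) (1,0) * v" for v
        using scaleR[of v "(1,0)"] by (simp add: mult.commute)
    qed
    ultimately show ?thesis by (simp only: has_field_derivative_def)
  qed
  moreover have "((\<lambda>q. f (p,q)) has_field_derivative f' (p,q) (0,1)) (at q)" for p q
  proof -
    interpret bounded_linear "f' (p,q)" using f(1) by (rule has_derivative_bounded_linear)
    have "((\<lambda>q. f (p,q)) has_derivative (\<lambda>v. f' (p,q) (0,v))) (at q)"
      by (rule has_derivative_compose[OF _ f(1)]) (auto intro!: derivative_eq_intros)
    moreover have "(\<lambda>v. f' (p,q) (0,v)) = (*) (f' (p,q) (0,1))"
    proof
      show "f' (p,q) (0,v) = f' (p,q) (0,1) * v" for v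
        using scaleR[of v "(0,1)"] by (simp add: mult.commute)
    qed
    ultimately show ?thesis by (simp only: has_field_derivative_def)
  qed
  ultimately show ?thesis
    by (rule that[of "\<lambda>z. f' z (1,0)" "\<lambda>z. f' z (0,1)"]) (rule f(2))+
qed

text \<open>The primitive in the second variable. Integrating over the fixed interval \<open>{0..1}\<close> avoids case
  distinctions on the orientation.\<close>

definition prim :: "(real \<times> real \<Rightarrow> real) \<Rightarrow> real \<times> real \<Rightarrow> real" where
  "prim N z = snd z * integral {0..1} (\<lambda>\<theta>. N (fst z, \<theta> * snd z))"

lemma prim_continuous:
  assumes "continuous_on UNIV N"
  shows "continuous_on UNIV (prim N)"
proof -
  have "continuous_on (UNIV \<times> cbox 0 1) (\<lambda>(z, \<theta>). N (fst z, \<theta> * snd z))"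
    unfolding case_prod_unfold
    by (rule continuous_on_compose2[OF assms]) (auto intro!: continuous_intros)
  then have "continuous_on UNIV (\<lambda>z. integral (cbox 0 1) (\<lambda>\<theta>. N (fst z, \<theta> * snd z)))"
    by (rule integral_continuous_on_param)
  then show ?thesis
    unfolding prim_def by (auto intro!: continuous_intros)
qed

lemma prim_snd:
  assumes "continuous_on UNIV N"
  shows "((\<lambda>q. prim N (p,q)) has_field_derivative N (p,q)) (at q)"
proof -
  have "continuous_on UNIV (\<lambda>q. N (p,q))"
    by (rule continuous_on_compose2[OF assms]) (auto intro!: continuous_intros)
  then have "isCont (\<lambda>q. N (p,q)) x" for x by (simp add: continuous_on_eq_continuous_at)
  \<comment> \<open>\<open>G\<close> is an antiderivative on the whole line, so the substitution
    below works for either sign of \<open>q\<close>.\<close>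
  then obtain G where G: "\<And>x. (G has_vector_derivative N (p,x)) (at x)"
    using einterval_antiderivative[of "-\<infinity>" \<infinity> "\<lambda>q. N (p,q)"] by auto
  have "prim N (p,q) = G q - G 0" for q
  proof -
    have "((\<lambda>\<theta>. q * N (p, \<theta> * q)) has_integral (G (1 * q) - G (0 * q))) {0..1}"
    proof (rule fundamental_theorem_of_calculus)
      fix \<theta> :: real
      have "(G has_field_derivative N (p, \<theta> * q)) (at (\<theta> * q))"
        using G by (simp add: has_real_derivative_iff_has_vector_derivative)
      then have "((\<lambda>\<theta>. G (\<theta> * q)) has_field_derivative (N (p, \<theta> * q) * q)) (at \<theta> within {0..1})"
        by (rule DERIV_chain2[where g = "\<lambda>\<theta>. \<theta> * q"]) (auto intro!: derivative_eq_intros)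
      then show "((\<lambda>\<theta>. G (\<theta> * q)) has_vector_derivative q * N (p, \<theta> * q)) (at \<theta> within {0..1})"
        by (simp add: has_real_derivative_iff_has_vector_derivative mult.commute)
    qed simp
    then have "integral {0..1} (\<lambda>\<theta>. q * N (p, \<theta> * q)) = G q - G 0"
      by (simp only: integral_unique mult_1 mult_zero_left)
    then show ?thesis unfolding prim_def by (simp only: integral_mult_right fst_conv snd_conv)
  qed
  then show ?thesis using G[of q]
    by (auto intro!: derivative_eq_intros simp: has_real_derivative_iff_has_vector_derivative[symmetric])
qed

lemma prim_fst:
  assumes cont: "continuous_on UNIV N" "continuous_on UNIV N'"
    and "\<And>p q. ((\<lambda>p. N (p,q)) has_field_derivative N' (p,q)) (at p)"
  shows "((\<lambda>p. prim N (p,q)) has_field_derivative prim N' (p,q)) (at p)"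
proof -
  have "((\<lambda>p. integral (cbox 0 1) (\<lambda>\<theta>. N (p, \<theta> * q))) has_field_derivative
      integral (cbox 0 1) (\<lambda>\<theta>. N' (p, \<theta> * q))) (at p within UNIV)"
  proof (rule leibniz_rule_field_derivative)
    show "((\<lambda>x. N (x, t * q)) has_real_derivative N' (x, t * q)) (at x)" for x t by (rule assms)
    show "(\<lambda>\<theta>. N (x, \<theta> * q)) integrable_on cbox 0 1" for x
      by (rule integrable_continuous, rule continuous_on_compose2[OF cont(1)]) (auto intro!: continuous_intros)
    show "continuous_on (UNIV \<times> cbox 0 1) (\<lambda>(x, t). N' (x, t * q))"
      unfolding case_prod_unfold
      by (rule continuous_on_compose2[OF cont(2)]) (auto intro!: continuous_intros)
  qed auto
  then show ?thesis unfolding prim_def by (auto intro!: derivative_eq_intros)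
qed

text \<open>The \<open>q\<close>-derivative is \<open>N\<close> itself and the
  \<open>p\<close>-derivative is the primitive of the \<open>p\<close>-derivative of
  \<open>N\<close>. Nothing is gained in \<open>p\<close>, so the order stays \<open>n\<close>; the
  gain appears only after integrating in both variables.\<close>

lemma Ck_prim: "Ck n N \<Longrightarrow> Ck n (prim N)"
proof (induction n arbitrary: N)
  case 0
  then show ?case using prim_continuous by auto
next
  case (Suc n)
  obtain A B where A: "\<And>p q. ((\<lambda>p. N (p,q)) has_field_derivative A (p,q)) (at p)" "Ck n A"
    using Suc.prems by (rule Ck_partials) (rule that)
  show ?case
    by (rule Ck_SucI_pair[OF prim_fst prim_snd Suc.IH])
      (use A in \<open>auto intro: Ck_continuous[OF Suc.prems] Ck_continuous[OF A(2)] Ck_Suc_imp[OF Suc.prems] simp del: Ck.simps\<close>)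
qed

subsection \<open>Cutoffs\<close>

text \<open>The factor \<open>(1 / x) ^ k\<close> makes the family closed under differentiation, so
  smoothness of \<open>exp (- (1 / x))\<close> extended by zero is a single induction with
  \<open>k\<close> arbitrary.\<close>

definition flat :: "nat \<Rightarrow> real \<Rightarrow> real" where
  "flat k x = (if x > 0 then (1 / x) ^ k * exp (- (1 / x)) else 0)"

lemma flat_tendsto: "(flat k \<longlongrightarrow> 0) (at_right 0)"
proof -
  have "((\<lambda>x::real. (1/x) ^ k * exp (- (1/x))) \<longlongrightarrow> 0) (at_right 0)"
  proof -
    have "((\<lambda>y::real. y ^ k * exp (- y)) \<longlongrightarrow> 0) at_top"
      using tendsto_power_div_exp_0[of k] by (simp add: exp_minus field_simps)
    from filterlim_compose[OF this filterlim_inverse_at_top_right]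
    show ?thesis by (simp add: field_simps)
  qed
  then show ?thesis
    by (rule Lim_transform_eventually) (auto simp: flat_def eventually_at_right_less elim: eventually_mono
      intro: eventually_mono[OF eventually_at_right_less])
qed

lemma flat_DERIV: "(flat k has_field_derivative (flat (k+2) x - k * flat (k+1) x)) (at x)"
proof -
  consider "x > 0" | "x < 0" | "x = 0" by linarith
  then show ?thesis
  proof cases
    case 1
    have "((\<lambda>x. (1 / x) ^ k * exp (- (1 / x))) has_field_derivative (flat (k+2) x - k * flat (k+1) x)) (at x)"
    proof -
      define y where "y = 1 / x"
      have "((\<lambda>x. 1 / x) has_field_derivative - (y\<^sup>2)) (at x)"
        using 1 by (auto intro!: derivative_eq_intros simp: y_def power2_eq_square)
      from DERIV_mult[OF DERIV_power[OF this, of k] DERIV_fun_exp[OF DERIV_minus[OF this]]]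
      have "((\<lambda>x. (1 / x) ^ k * exp (- (1 / x))) has_field_derivative
          (of_nat k * (- y\<^sup>2 * y ^ (k - 1)) * exp (- y) + exp (- y) * y\<^sup>2 * y ^ k)) (at x)"
        by (simp add: y_def)
      moreover have "of_nat k * (- y\<^sup>2 * y ^ (k - 1)) * exp (- y) + exp (- y) * y\<^sup>2 * y ^ k
          = flat (k+2) x - k * flat (k+1) x"
        using 1 by (cases k) (simp_all add: flat_def y_def[symmetric] power2_eq_square algebra_simps)
      ultimately show ?thesis by simp
    qed
    then show ?thesis
      by (rule has_field_derivative_transform_within_open[where S = "{0<..}"]) (use 1 in \<open>auto simp: flat_def\<close>)
  next
    case 2
    have "((\<lambda>x. 0) has_field_derivative (flat (k+2) x - k * flat (k+1) x)) (at x)"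
      using 2 by (simp add: flat_def)
    then show ?thesis
      by (rule has_field_derivative_transform_within_open[where S = "{..<0}"]) (use 2 in \<open>auto simp: flat_def\<close>)
  next
    case 3
    \<comment> \<open>For positive \<open>y\<close> the difference quotient is
      \<open>flat (Suc k) y\<close>, whose right limit is known; for negative \<open>y\<close> it is
      zero.\<close>
    have "((\<lambda>y. flat k y / y) \<longlongrightarrow> 0) (at 0)"
    proof -
      have "((\<lambda>y. flat k y / y) \<longlongrightarrow> 0) (at_right 0)"
        by (rule Lim_transform_eventually[OF flat_tendsto[of "Suc k"]])
          (auto simp: flat_def field_simps intro: eventually_mono[OF eventually_at_right_less])
      moreover have "((\<lambda>y. flat k y / y) \<longlongrightarrow> 0) (at_left 0)"
        by (rule Lim_transform_eventually[OF tendsto_const])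
          (auto simp: flat_def eventually_at_filter)
      ultimately show ?thesis by (simp add: filterlim_at_split)
    qed
    then show ?thesis using 3 by (simp add: has_field_derivative_iff flat_def)
  qed
qed

lemma Ck_flat: "Ck n (flat k)"
proof (induction n arbitrary: k)
  case 0
  then show ?case
    using flat_DERIV[of k] by (auto intro!: continuous_at_imp_continuous_on DERIV_isCont)
next
  case (Suc n)
  show ?case
    by (rule Ck_SucI[OF flat_DERIV[unfolded has_field_derivative_def]]) (intro Ck_mult Ck_diff Ck_cmult Ck_const Suc)
qed

definition step :: "real \<Rightarrow> real" where
  "step x = flat 0 x * inverse (flat 0 x + flat 0 (1 - x))"

lemma flat_nonneg: "flat k x \<ge> 0" and flat_pos: "x > 0 \<Longrightarrow> flat k x > 0"
  and flat_zero: "x \<le> 0 \<Longrightarrow> flat k x = 0"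
  by (auto simp: flat_def)

lemma step_denominator: "flat 0 x + flat 0 (1 - x) > 0"
  using flat_pos[of x 0] flat_pos[of "1-x" 0] flat_nonneg[of 0 x] flat_nonneg[of 0 "1-x"]
  by (cases "x > 0") (auto intro: add_pos_nonneg add_nonneg_pos)

lemma Ck_id: "Ck n (\<lambda>x::real. x)"
  by (rule Ck_linear) (rule bounded_linear_ident)

lemma Ck_step: "Ck n step"
proof -
  have "flat 0 x + flat 0 (1 - x) \<noteq> 0" for x using step_denominator[of x] by linarith
  then show ?thesis unfolding step_def[abs_def]
    by (intro Ck_mult Ck_inverse Ck_add Ck_compose_real[OF Ck_flat] Ck_id Ck_diff Ck_const) auto
qed

lemma step_0: "x \<le> 0 \<Longrightarrow> step x = 0" and step_1: "x \<ge> 1 \<Longrightarrow> step x = 1"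
  using step_denominator[of x] by (auto simp: step_def flat_zero)

lemma step_range: "0 \<le> step x" "step x \<le> 1"
  using step_denominator[of x] flat_nonneg[of 0 x] flat_nonneg[of 0 "1-x"]
  by (auto simp: step_def field_simps)

text \<open>A smooth stand-in for \<open>r\<close> that agrees with it from 1 on and never drops
  below 1/2, so that inverses and square roots cause no trouble. It serves both for the radius in
  the coefficient of the equation and for |x|^2 in the passage to the radius.\<close>

definition sigma :: "real \<Rightarrow> real" where
  "sigma r = step (2 * r - 1) * (r - 1/2) + 1/2"

lemma Ck_sigma: "Ck n sigma"
  unfolding sigma_def[abs_def] by (intro Ck_mult Ck_add Ck_compose_real[OF Ck_step] Ck_id Ck_diff Ck_const Ck_cmult)

lemma sigma_eq: "r \<ge> 1 \<Longrightarrow> sigma r = r"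
  by (simp add: sigma_def step_1)

lemma sigma_ge: "sigma r \<ge> 1/2"
  using step_range[of "2*r-1"] step_0[of "2*r-1"] by (cases "r \<ge> 1/2") (auto simp: sigma_def)

lemma sigma_le: "r \<le> 1 \<Longrightarrow> sigma r \<le> 1"
proof (cases "r \<ge> 1/2")
  case True
  assume "r \<le> 1"
  with True have "step (2*r-1) * (r-1/2) \<le> 1 * (1/2)"
    using step_range[of "2*r-1"] by (intro mult_mono) auto
  then show ?thesis by (simp add: sigma_def)
next
  case False
  then show ?thesis by (simp add: sigma_def step_0)
qed

text \<open>The factor \<open>exp 2\<close> normalises the value at 0 to 1.\<close>

definition bump :: "real \<Rightarrow> real" where
  "bump z = exp 2 * (flat 0 (1 + z) * flat 0 (1 - z))"

lemma Ck_bump: "Ck n bump"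
  unfolding bump_def[abs_def]
  by (intro Ck_mult Ck_add Ck_compose_real[OF Ck_flat] Ck_id Ck_diff Ck_const Ck_cmult)

lemma bump_zero: "\<bar>z\<bar> \<ge> 1 \<Longrightarrow> bump z = 0"
  by (auto simp: bump_def flat_zero abs_if split: if_splits)

lemma bump_nonneg: "bump z \<ge> 0"
  by (simp add: bump_def flat_nonneg)

lemma bump_eq: "\<bar>z\<bar> < 1 \<Longrightarrow> bump z = exp (2 - 2 / (1 - z^2))"
proof -
  assume "\<bar>z\<bar> < 1"
  then have z: "1 + z > 0" "1 - z > 0" by auto
  then have "1 / (1+z) + 1/(1-z) = 2 / (1 - z^2)"
    by (simp add: field_simps power2_eq_square)
  then show ?thesis using z
    by (simp add: bump_def flat_def algebra_simps flip: exp_add)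
qed

lemma bump_le_1: "bump z \<le> 1"
proof (cases "\<bar>z\<bar> < 1")
  case True
  then have "0 < 1 - z^2" by (simp add: abs_square_less_1)
  then have "2 / (1 - z^2) \<ge> 2" by (simp add: field_simps)
  then show ?thesis using bump_eq[OF True] by simp
qed (simp add: bump_zero)

lemma bump_ge: "\<bar>z\<bar> \<le> 1/4 \<Longrightarrow> bump z \<ge> 4/5"
proof -
  assume z: "\<bar>z\<bar> \<le> 1/4"
  then have "z^2 \<le> (1/4)^2" by (simp add: abs_le_square_iff[symmetric])
  then have "z^2 \<le> 1/16" by (simp add: power2_eq_square)
  then have "2 / (1 - z^2) \<le> 2 / (15/16)" by (intro divide_left_mono) auto
  then have "2 - 2 / (1 - z^2) \<ge> - 2/15" by simp
  \<comment> \<open>With exponent at least -2/15 this gives 13/15, which is above 4/5.\<close>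
  moreover have "1 + (2 - 2 / (1 - z^2)) \<le> exp (2 - 2 / (1 - z^2))" by (rule exp_ge_add_one_self)
  ultimately show ?thesis using bump_eq[of z] z by simp
qed

section \<open>Lebesgue integrals of products over coordinates\<close>

lemma
  fixes g :: "'a::euclidean_space \<Rightarrow> real \<Rightarrow> complex"
  assumes g: "\<And>b. b \<in> Basis \<Longrightarrow> integrable lborel (g b)"
  shows integrable_prod_Basis: "integrable lborel (\<lambda>x. \<Prod>b\<in>Basis. g b (x \<bullet> b))"
    and integral_prod_Basis: "(\<integral>x. (\<Prod>b\<in>Basis. g b (x \<bullet> b)) \<partial>lborel) = (\<Prod>b\<in>Basis. \<integral>x. g b x \<partial>lborel)"
proof -
  interpret product_sigma_finite "\<lambda>b::'a. lborel :: real measure" ..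
  have [measurable]: "g b \<in> borel_measurable borel" if "b \<in> Basis" for b
    using g[OF that] by auto
  have [measurable]: "(\<lambda>x. \<Prod>b\<in>Basis. g b (x \<bullet> b)) \<in> borel_measurable (borel :: 'a measure)"
    by measurable
  have *: "(\<Prod>b\<in>Basis. g b ((\<Sum>b\<in>Basis. f b *\<^sub>R b) \<bullet> b)) = (\<Prod>b\<in>Basis. g b (f b))" for f
    by (intro prod.cong refl) (simp add: inner_sum_left inner_Basis if_distrib sum.delta cong: if_cong)
  have i: "integrable (\<Pi>\<^sub>M b\<in>Basis. lborel) (\<lambda>f. \<Prod>b\<in>Basis. g b (f b))"
    by (rule product_integrable_prod) (auto intro: g)
  show "integrable lborel (\<lambda>x. \<Prod>b\<in>Basis. g b (x \<bullet> b))"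
    by (subst lborel_eq, subst integrable_distr_eq) (use i in \<open>auto simp: *\<close>)
  show "(\<integral>x. (\<Prod>b\<in>Basis. g b (x \<bullet> b)) \<partial>lborel) = (\<Prod>b\<in>Basis. \<integral>x. g b x \<partial>lborel)"
    by (subst lborel_eq, subst integral_distr) (auto simp: * intro!: product_integral_prod g)
qed

subsection \<open>Gaussians\<close>

lemma borel_measurable_cis [measurable]: "f \<in> borel_measurable M \<Longrightarrow> (\<lambda>x. cis (f x)) \<in> borel_measurable M"
  unfolding cis_conv_exp by measurable

text \<open>Rescaling by \<open>c = sqrt (s / (2 * pi))\<close> turns the integrand into the
  standard normal density times a character, and the integral into the characteristic function of
  the normal distribution.\<close>

lemma gauss1_ft:
  fixes s \<xi> :: real
  assumes s: "s > 0"
  shows "integrable lborel (\<lambda>x. complex_of_real (exp (- pi * x\<^sup>2 / s) / sqrt s) * cis (2 * pi * (x * \<xi>)))"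
    and "(\<integral>x. complex_of_real (exp (- pi * x\<^sup>2 / s) / sqrt s) * cis (2 * pi * (x * \<xi>)) \<partial>lborel)
      = exp (- pi * s * \<xi>\<^sup>2)"
proof -
  define c where "c = sqrt (s / (2 * pi))"
  define t where "t = 2 * pi * c * \<xi>"
  have c: "c > 0" "c\<^sup>2 = s / (2 * pi)" using s by (auto simp: c_def)
  have c2: "c / sqrt s = 1 / sqrt (2 * pi)" using s by (simp add: c_def real_sqrt_divide)
  let ?f = "\<lambda>x. complex_of_real (exp (- pi * x\<^sup>2 / s) / sqrt s) * cis (2 * pi * (x * \<xi>))"
  have f: "c *\<^sub>R ?f (0 + c * x) = std_normal_density x *\<^sub>R cis (t * x)" for x
  proof -
    have "- pi * (c * x)\<^sup>2 / s = - x\<^sup>2 / 2"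
      using s c by (simp add: power_mult_distrib)
    then have "c * (exp (- pi * (0 + c * x)\<^sup>2 / s) / sqrt s) = exp (- x\<^sup>2 / 2) * (c / sqrt s)"
      by simp
    also have "\<dots> = std_normal_density x"
      unfolding c2 by (simp add: std_normal_density_def)
    finally have "c *\<^sub>R ?f (0 + c * x) = std_normal_density x *\<^sub>R cis (2 * pi * ((0 + c * x) * \<xi>))"
      by (simp only: scaleR_conv_of_real mult.assoc[symmetric] of_real_mult[symmetric])
    then show ?thesis by (simp add: t_def mult_ac)
  qed
  have "integrable lborel (\<lambda>x. std_normal_density x *\<^sub>R cis (t * x))"
    by (rule Bochner_Integration.integrable_bound[of _ std_normal_density])
      (auto intro!: integrable_normal_density)
  then have "integrable lborel (\<lambda>x. c *\<^sub>R ?f (0 + c * x))" unfolding f .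
  from integrable_scaleR_right[OF this, of "1 / c"]
  have "integrable lborel (\<lambda>x. ?f (0 + c * x))" using c(1) by (simp only: scaleR_scaleR) simp
  then show "integrable lborel ?f"
    using c by (subst (asm) lborel_integrable_real_affine_iff) auto
  have "(\<integral>x. ?f x \<partial>lborel) = \<bar>c\<bar> *\<^sub>R (\<integral>x. ?f (0 + c * x) \<partial>lborel)"
    using c by (intro lborel_integral_real_affine) auto
  also have "\<dots> = (\<integral>x. c *\<^sub>R ?f (0 + c * x) \<partial>lborel)"
    using c by (subst integral_scaleR_right) simp
  also have "\<dots> = (\<integral>x. std_normal_density x *\<^sub>R cis (t * x) \<partial>lborel)"
    unfolding f ..
  also have "\<dots> = char std_normal_distribution t"
    unfolding char_def by (subst integral_density) (auto simp: cis_conv_exp mult.commute)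
  also have "\<dots> = exp (- t\<^sup>2 / 2)" by (simp add: char_std_normal_distribution)
  also have "- t\<^sup>2 / 2 = - pi * s * \<xi>\<^sup>2" using c by (simp add: t_def power_mult_distrib power2_eq_square[of pi] field_simps)
  finally show "(\<integral>x. ?f x \<partial>lborel) = exp (- pi * s * \<xi>\<^sup>2)" by simp
qed

text \<open>The heat kernel of unit mass, parametrised so that its transform is
  \<open>exp (- pi * s * (norm \<xi>)\<^sup>2)\<close> with no further constants.\<close>

definition gauss :: "real \<Rightarrow> real^3 \<Rightarrow> real" where
  "gauss s x = exp (- pi * (norm x)\<^sup>2 / s) / sqrt s ^ 3"

lemma card_Basis3: "card (Basis :: (real^3) set) = 3"
  using DIM_cart[where ?'a = real and ?'b = 3] by simp

lemma norm_Basis_sum: "(norm (x::'a::euclidean_space))\<^sup>2 = (\<Sum>b\<in>Basis. (x \<bullet> b)\<^sup>2)"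
  unfolding power2_norm_eq_inner by (subst euclidean_inner) (simp add: power2_eq_square)

lemma gauss_prod: "gauss s x = (\<Prod>b\<in>Basis. exp (- pi * (x \<bullet> b)\<^sup>2 / s) / sqrt s)"
  by (simp add: gauss_def prod_dividef card_Basis3 norm_Basis_sum exp_sum[symmetric] sum_distrib_left
      sum_negf sum_divide_distrib)

lemma cis_inner_prod: "cis (2 * pi * ((x::'a::euclidean_space) \<bullet> y)) = (\<Prod>b\<in>Basis. cis (2 * pi * (x \<bullet> b * (y \<bullet> b))))"
proof -
  have "cis (sum f A) = (\<Prod>b\<in>A. cis (f b))" if "finite A" for f and A :: "'a set"
    using that by (induction) (auto simp: cis_mult[symmetric])
  then show ?thesis by (simp add: euclidean_inner[of x y] sum_distrib_left)
qed

lemma borel_measurable_gauss [measurable]: "gauss s \<in> borel_measurable borel"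
  unfolding gauss_def[abs_def] by measurable

lemma gauss_nonneg: "s > 0 \<Longrightarrow> gauss s x \<ge> 0" by (simp add: gauss_def)

lemma
  assumes s: "s > 0"
  shows gauss_ft_integrable: "integrable lborel (\<lambda>x. complex_of_real (gauss s x) * cis (2 * pi * (x \<bullet> \<xi>)))"
    and gauss_ft: "(\<integral>x. complex_of_real (gauss s x) * cis (2 * pi * (x \<bullet> \<xi>)) \<partial>lborel) = exp (- pi * s * (norm \<xi>)\<^sup>2)"
proof -
  let ?g = "\<lambda>(b::real^3) x. complex_of_real (exp (- pi * x\<^sup>2 / s) / sqrt s) * cis (2 * pi * (x * (\<xi> \<bullet> b)))"
  have g: "integrable lborel (?g b)" for b
    by (rule gauss1_ft[OF s])
  have eq: "complex_of_real (gauss s x) * cis (2 * pi * (x \<bullet> \<xi>)) = (\<Prod>b\<in>Basis. ?g b (x \<bullet> b))" for x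
    unfolding gauss_prod cis_inner_prod of_real_prod prod.distrib[symmetric] by simp
  show "integrable lborel (\<lambda>x. complex_of_real (gauss s x) * cis (2 * pi * (x \<bullet> \<xi>)))"
    unfolding eq by (rule integrable_prod_Basis[OF g])
  show "(\<integral>x. complex_of_real (gauss s x) * cis (2 * pi * (x \<bullet> \<xi>)) \<partial>lborel) = exp (- pi * s * (norm \<xi>)\<^sup>2)"
    unfolding eq integral_prod_Basis[OF g] gauss1_ft(2)[OF s]
    by (simp add: norm_Basis_sum sum_distrib_left exp_sum[symmetric] sum_negf flip: of_real_prod)
qed

lemma
  assumes s: "s > 0"
  shows gauss_integrable: "integrable lborel (gauss s)"
    and gauss_integral: "(\<integral>x. gauss s x \<partial>lborel) = 1"
proof -
  have "integrable lborel (\<lambda>x. complex_of_real (gauss s x))"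
    using gauss_ft_integrable[OF s, of 0] by simp
  then show "integrable lborel (gauss s)"
    using integrable_norm gauss_nonneg[OF s] by fastforce
  show "(\<integral>x. gauss s x \<partial>lborel) = 1"
    using gauss_ft[OF s, of 0] by simp
qed

text \<open>Self-duality of Gaussians: this makes the transform of the exponential a corollary of
  \<open>gauss_ft\<close> at \<open>1 / s\<close>.\<close>

lemma gauss_inverse: "s > 0 \<Longrightarrow> exp (- pi * s * (norm x)\<^sup>2) = gauss (1/s) x / sqrt s ^ 3"
  by (simp add: gauss_def real_sqrt_divide power_divide mult.assoc)

lemma
  assumes s: "s > 0"
  shows exp_ft_integrable: "integrable lborel (\<lambda>x. complex_of_real (exp (- pi * s * (norm x)\<^sup>2)) * cis (2 * pi * (x \<bullet> \<xi>)))"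
    and exp_ft: "(\<integral>x. complex_of_real (exp (- pi * s * (norm x)\<^sup>2)) * cis (2 * pi * (x \<bullet> \<xi>)) \<partial>lborel) = gauss s \<xi>"
proof -
  have eq: "complex_of_real (exp (- pi * s * (norm x)\<^sup>2)) * cis (2 * pi * (x \<bullet> \<xi>)) =
     (1 / sqrt s ^ 3) *\<^sub>R (complex_of_real (gauss (1/s) x) * cis (2 * pi * (x \<bullet> \<xi>)))" for x
    unfolding gauss_inverse[OF s] by (simp add: scaleR_conv_of_real)
  have s': "1 / s > 0" using s by simp
  show "integrable lborel (\<lambda>x. complex_of_real (exp (- pi * s * (norm x)\<^sup>2)) * cis (2 * pi * (x \<bullet> \<xi>)))"
    unfolding eq by (intro integrable_scaleR_right gauss_ft_integrable s')
  show "(\<integral>x. complex_of_real (exp (- pi * s * (norm x)\<^sup>2)) * cis (2 * pi * (x \<bullet> \<xi>)) \<partial>lborel) = gauss s \<xi>"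
    unfolding eq integral_scaleR_right gauss_ft[OF s'] by (simp add: gauss_def scaleR_conv_of_real)
qed

subsection \<open>Fourier inversion\<close>

lemma (in pair_sigma_finite) integrable_mult_kernel:
  fixes a b :: "_ \<Rightarrow> complex"
  assumes a: "integrable M1 a" and b: "integrable M2 b"
    and [measurable]: "case_prod k \<in> borel_measurable (M1 \<Otimes>\<^sub>M M2)" and k: "\<And>x y. norm (k x y) \<le> 1"
  shows "integrable (M1 \<Otimes>\<^sub>M M2) (\<lambda>(x, y). a x * (b y * k x y))"
proof -
  have [measurable]: "a \<in> borel_measurable M1" "b \<in> borel_measurable M2" using a b by auto
  have "integrable (M1 \<Otimes>\<^sub>M M2) (\<lambda>(x, y). a x * b y)"
  proof (rule Fubini_integrable)
    show "(\<lambda>(x, y). a x * b y) \<in> borel_measurable (M1 \<Otimes>\<^sub>M M2)" by measurable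
    show "integrable M1 (\<lambda>x. \<integral>y. norm (case (x, y) of (x, y) \<Rightarrow> a x * b y) \<partial>M2)"
      using a by (simp add: norm_mult)
    show "AE x in M1. integrable M2 (\<lambda>y. case (x, y) of (x, y) \<Rightarrow> a x * b y)"
      using b by simp
  qed
  then show ?thesis
  proof (rule Bochner_Integration.integrable_bound)
    have "norm (a x * (b y * k x y)) \<le> norm (a x * b y)" for x y
      using mult_left_mono[OF k[of x y], of "norm (a x * b y)"] by (simp add: norm_mult mult.assoc)
    then show "AE z in M1 \<Otimes>\<^sub>M M2. norm (case z of (x, y) \<Rightarrow> a x * (b y * k x y)) \<le> norm (case z of (x, y) \<Rightarrow> a x * b y)"
      by (intro AE_I2) auto
  qed measurable
qed

text \<open>The multiplication formula of Fourier analysis for an abstract bounded kernel.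
  Inversion, Plancherel and the identity for the fractional derivative all exchange their integrals
  through it.\<close>

lemma (in pair_sigma_finite) Fubini_kernel:
  fixes a b :: "_ \<Rightarrow> complex"
  assumes a: "integrable M1 a" and b: "integrable M2 b"
    and k: "case_prod k \<in> borel_measurable (M1 \<Otimes>\<^sub>M M2)" "\<And>x y. norm (k x y) \<le> 1"
  shows "(\<integral>x. a x * (\<integral>y. b y * k x y \<partial>M2) \<partial>M1) = (\<integral>y. b y * (\<integral>x. a x * k x y \<partial>M1) \<partial>M2)"
proof -
  have "(\<integral>y. (\<integral>x. a x * (b y * k x y) \<partial>M1) \<partial>M2) = (\<integral>x. (\<integral>y. a x * (b y * k x y) \<partial>M2) \<partial>M1)"
    using integrable_mult_kernel[OF a b k] by (rule Fubini_integral)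
  moreover have "(\<lambda>x. a x * (b y * k x y)) = (\<lambda>x. b y * (a x * k x y))" for y
    by (simp add: mult_ac)
  ultimately show ?thesis by simp
qed

lemma ft_gauss_regularization:
  fixes h :: "real^3 \<Rightarrow> complex"
  assumes h: "integrable lborel h" and s: "s > 0"
  shows "(\<integral>\<xi>. complex_of_real (exp (- pi * s * (norm \<xi>)\<^sup>2)) * cis (2 * pi * (x \<bullet> \<xi>)) * ft h \<xi> \<partial>lborel)
     = (\<integral>y. h y * complex_of_real (gauss s (x - y)) \<partial>lborel)"
proof -
  have "(\<integral>\<xi>. complex_of_real (exp (- pi * s * (norm \<xi>)\<^sup>2)) * cis (2 * pi * (x \<bullet> \<xi>)) * ft h \<xi> \<partial>lborel)
    = (\<integral>y. h y * (\<integral>\<xi>. complex_of_real (exp (- pi * s * (norm \<xi>)\<^sup>2)) * cis (2 * pi * (x \<bullet> \<xi>)) * cis (- 2 * pi * (y \<bullet> \<xi>)) \<partial>lborel) \<partial>lborel)"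
    unfolding ft_def
    by (rule lborel_pair.Fubini_kernel)
      (use exp_ft_integrable[OF s, of x] h in \<open>auto simp: inner_commute\<close>)
  also have "(\<lambda>y \<xi>. complex_of_real (exp (- pi * s * (norm \<xi>)\<^sup>2)) * cis (2 * pi * (x \<bullet> \<xi>)) * cis (- 2 * pi * (y \<bullet> \<xi>))) =
     (\<lambda>y \<xi>. complex_of_real (exp (- pi * s * (norm \<xi>)\<^sup>2)) * cis (2 * pi * (\<xi> \<bullet> (x - y))))"
    by (intro ext) (simp add: mult.assoc cis_mult inner_diff_right inner_commute right_diff_distrib)
  finally show ?thesis unfolding exp_ft[OF s] .
qed

lemma integral_lborel_affine:
  fixes f :: "'a::euclidean_space \<Rightarrow> 'b :: {banach, second_countable_topology}"
  assumes c: "c \<noteq> 0" and [measurable]: "f \<in> borel_measurable borel"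
  shows "(\<integral>x. f x \<partial>lborel) = \<bar>c\<bar> ^ DIM('a) *\<^sub>R (\<integral>x. f (t + c *\<^sub>R x) \<partial>lborel)"
  by (subst lborel_affine[OF c, of t], subst integral_density, simp_all, subst integral_distr, simp_all)

lemma gauss_scale: "c > 0 \<Longrightarrow> \<bar>c\<bar> ^ 3 * gauss (c\<^sup>2) (c *\<^sub>R z) = gauss 1 z"
  by (simp add: gauss_def power_mult_distrib)

text \<open>Gaussian summation: damping the inverse transform by a wide Gaussian equals averaging
  \<open>h\<close> against a Gaussian of width \<open>c n\<close>. As \<open>c n\<close> tends to 0
  the damped integrals tend to \<open>ift (ft h) x\<close>, dominated by |ft h|, and the averages to
  \<open>h x\<close>, dominated by \<open>B * gauss 1 z\<close>.\<close>

lemma ft_inversion: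
  fixes h :: "real^3 \<Rightarrow> complex"
  assumes h: "integrable lborel h" and cont: "continuous_on UNIV h" and B: "\<And>x. norm (h x) \<le> B"
    and ft: "integrable lborel (ft h)"
  shows "ift (ft h) x = h x"
proof -
  define c where "c n = 1 / sqrt (real (Suc n))" for n
  have c: "c n > 0" "(c n)\<^sup>2 = 1 / Suc n" for n by (auto simp: c_def power_divide)
  have c0: "c \<longlonglongrightarrow> 0"
  proof -
    have "(\<lambda>n. sqrt (inverse (real (Suc n)))) \<longlonglongrightarrow> sqrt 0"
      by (intro tendsto_real_sqrt LIMSEQ_inverse_real_of_nat)
    then show ?thesis by (simp add: c_def[abs_def] real_sqrt_inverse inverse_eq_divide real_sqrt_divide)
  qed
  have [measurable]: "h \<in> borel_measurable borel" "ft h \<in> borel_measurable borel"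
    using h ft by auto
  let ?S = "\<lambda>n. \<integral>\<xi>. complex_of_real (exp (- pi * (c n)\<^sup>2 * (norm \<xi>)\<^sup>2)) * cis (2 * pi * (x \<bullet> \<xi>)) * ft h \<xi> \<partial>lborel"
  have "?S \<longlonglongrightarrow> (\<integral>\<xi>. complex_of_real (exp (- pi * 0\<^sup>2 * (norm \<xi>)\<^sup>2)) * cis (2 * pi * (x \<bullet> \<xi>)) * ft h \<xi> \<partial>lborel)"
  proof (rule integral_dominated_convergence[where w = "\<lambda>\<xi>. norm (ft h \<xi>)"])
    show "integrable lborel (\<lambda>\<xi>. norm (ft h \<xi>))" using ft by simp
    show "AE \<xi> in lborel. (\<lambda>n. complex_of_real (exp (- pi * (c n)\<^sup>2 * (norm \<xi>)\<^sup>2)) * cis (2 * pi * (x \<bullet> \<xi>)) * ft h \<xi>)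
        \<longlonglongrightarrow> complex_of_real (exp (- pi * 0\<^sup>2 * (norm \<xi>)\<^sup>2)) * cis (2 * pi * (x \<bullet> \<xi>)) * ft h \<xi>"
      by (intro AE_I2 tendsto_intros c0)
    show "AE \<xi> in lborel. norm (complex_of_real (exp (- pi * (c n)\<^sup>2 * (norm \<xi>)\<^sup>2)) * cis (2 * pi * (x \<bullet> \<xi>)) * ft h \<xi>) \<le> norm (ft h \<xi>)" for n
      by (intro AE_I2) (auto simp: norm_mult intro!: mult_left_le_one_le)
  qed measurable
  then have 1: "?S \<longlonglongrightarrow> ift (ft h) x" by (simp add: ift_def mult.commute)
  have "?S n = (\<integral>z. h (x + c n *\<^sub>R z) * complex_of_real (gauss 1 z) \<partial>lborel)" for n
  proof -
    have "?S n = (\<integral>y. h y * complex_of_real (gauss ((c n)\<^sup>2) (x - y)) \<partial>lborel)"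
      using c by (intro ft_gauss_regularization h) auto
    also have "\<dots> = \<bar>c n\<bar> ^ DIM(real^3) *\<^sub>R (\<integral>z. h (x + c n *\<^sub>R z) * complex_of_real (gauss ((c n)\<^sup>2) (x - (x + c n *\<^sub>R z))) \<partial>lborel)"
      using c(1)[of n] by (intro integral_lborel_affine) auto
    also have "\<dots> = (\<integral>z. \<bar>c n\<bar> ^ 3 *\<^sub>R (h (x + c n *\<^sub>R z) * complex_of_real (gauss ((c n)\<^sup>2) (x - (x + c n *\<^sub>R z)))) \<partial>lborel)"
      by (subst integral_scaleR_right) (simp add: card_Basis3)
    also have "(\<lambda>z. \<bar>c n\<bar> ^ 3 *\<^sub>R (h (x + c n *\<^sub>R z) * complex_of_real (gauss ((c n)\<^sup>2) (x - (x + c n *\<^sub>R z))))) =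
       (\<lambda>z. h (x + c n *\<^sub>R z) * complex_of_real (gauss 1 z))"
      unfolding gauss_scale[OF c(1)[of n], symmetric]
      by (intro ext) (simp add: scaleR_conv_of_real gauss_def)
    finally show ?thesis .
  qed
  moreover have "(\<lambda>n. (\<integral>z. h (x + c n *\<^sub>R z) * complex_of_real (gauss 1 z) \<partial>lborel)) \<longlonglongrightarrow>
     (\<integral>z. h (x + 0 *\<^sub>R z) * complex_of_real (gauss 1 z) \<partial>lborel)"
  proof (rule integral_dominated_convergence[where w = "\<lambda>z. B * gauss 1 z"])
    show "integrable lborel (\<lambda>z. B * gauss 1 z)" by (simp add: gauss_integrable)
    have "isCont h y" for y using cont by (simp add: continuous_on_eq_continuous_at)
    then show "AE z in lborel. (\<lambda>n. h (x + c n *\<^sub>R z) * complex_of_real (gauss 1 z))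
        \<longlonglongrightarrow> h (x + 0 *\<^sub>R z) * complex_of_real (gauss 1 z)"
      by (intro AE_I2 tendsto_intros c0 isCont_tendsto_compose[of _ h])
    show "AE z in lborel. norm (h (x + c n *\<^sub>R z) * complex_of_real (gauss 1 z)) \<le> B * gauss 1 z" for n
      by (intro AE_I2) (auto simp: norm_mult gauss_nonneg intro!: mult_right_mono B)
  qed measurable
  ultimately have 2: "?S \<longlonglongrightarrow> h x"
    using gauss_integral[of 1] by simp
  show ?thesis using 1 2 by (rule LIMSEQ_unique)
qed

subsection \<open>Decay of the Fourier transform\<close>

lemma integrable_mult_cis:
  fixes f :: "'a \<Rightarrow> complex"
  assumes "integrable M f" "g \<in> borel_measurable M"
  shows "integrable M (\<lambda>x. f x * cis (g x))"
  by (rule Bochner_Integration.integrable_bound[OF assms(1)]) (use assms in \<open>auto simp: norm_mult\<close>)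

lemma integrable_translate:
  fixes f :: "'a::euclidean_space \<Rightarrow> 'b :: {banach, second_countable_topology}"
  assumes "integrable lborel f"
  shows "integrable lborel (\<lambda>x. f (v + x))"
proof -
  have [measurable]: "f \<in> borel_measurable borel" using assms by auto
  have "integrable (distr lborel borel ((+) v)) f"
    using assms by (simp add: lborel_distr_plus)
  then show ?thesis by (subst (asm) integrable_distr_eq) auto
qed

lemma integral_translate:
  fixes f :: "'a::euclidean_space \<Rightarrow> 'b :: {banach, second_countable_topology}"
  assumes [measurable]: "f \<in> borel_measurable borel"
  shows "(\<integral>x. f (v + x) \<partial>lborel) = (\<integral>x. f x \<partial>lborel)"
  using integral_lborel_affine[of 1 f v] by simp

lemma ft_translate:
  assumes [measurable]: "f \<in> borel_measurable borel"
  shows "ft (\<lambda>x. f (v + x)) \<xi> = cis (2 * pi * (v \<bullet> \<xi>)) * ft f \<xi>"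
proof -
  have "ft (\<lambda>x. f (v + x)) \<xi> = (\<integral>x. cis (2 * pi * (v \<bullet> \<xi>)) * (f (v + x) * cis (- 2 * pi * ((v + x) \<bullet> \<xi>))) \<partial>lborel)"
    unfolding ft_def
    by (intro Bochner_Integration.integral_cong refl)
      (simp add: cis_mult inner_add_left algebra_simps)
  also have "\<dots> = cis (2 * pi * (v \<bullet> \<xi>)) * (\<integral>x. f (v + x) * cis (- 2 * pi * ((v + x) \<bullet> \<xi>)) \<partial>lborel)"
    by simp
  also have "(\<integral>x. f (v + x) * cis (- 2 * pi * ((v + x) \<bullet> \<xi>)) \<partial>lborel) = ft f \<xi>"
    unfolding ft_def by (rule integral_translate) measurable
  finally show ?thesis .
qed

lemma ft_diff: "integrable lborel f \<Longrightarrow> integrable lborel g \<Longrightarrow> ft (\<lambda>x. f x - g x) \<xi> = ft f \<xi> - ft g \<xi>"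
  unfolding ft_def left_diff_distrib
  by (rule Bochner_Integration.integral_diff) (auto intro!: integrable_mult_cis)

lemma ft_cmult: "ft (\<lambda>x. c * f x) \<xi> = c * ft f \<xi>"
  unfolding ft_def by (simp add: mult.assoc)

lemma norm_ft_le: "integrable lborel f \<Longrightarrow> norm (ft f \<xi>) \<le> (\<integral>x. norm (f x) \<partial>lborel)"
  unfolding ft_def by (rule order_trans[OF integral_norm_bound]) (simp add: norm_mult)

lemma borel_measurable_ft:
  assumes [measurable]: "h \<in> borel_measurable borel"
  shows "ft h \<in> borel_measurable borel"
  unfolding ft_def by measurable

definition Cc :: "(real^3 \<Rightarrow> real) \<Rightarrow> bool" where
  "Cc f \<longleftrightarrow> Cinf f \<and> (\<exists>R. \<forall>x. norm x > R \<longrightarrow> f x = 0)"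

lemma Cinf_continuous: "Cinf f \<Longrightarrow> continuous_on UNIV f"
  using CinfD Ck_continuous by blast

lemma integrable_compact_support:
  fixes f :: "real^3 \<Rightarrow> real"
  assumes cont: "continuous_on UNIV f" and R: "\<And>x. norm x > R \<Longrightarrow> f x = 0"
  shows "integrable lborel f"
proof -
  have [measurable]: "f \<in> borel_measurable borel" using cont by (rule borel_measurable_continuous_onI)
  have "compact (f ` cball 0 R)"
    by (intro compact_continuous_image continuous_on_subset[OF cont]) auto
  then obtain B where B: "\<And>x. x \<in> cball 0 R \<Longrightarrow> norm (f x) \<le> B"
    using compact_imp_bounded bounded_iff by (metis imageI)
  have "emeasure lborel (cball (0::real^3) R) < \<infinity>"
    by (rule emeasure_bounded_finite) simp
  then have "integrable lborel (\<lambda>x. B * indicator (cball (0::real^3) R) x)"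
    by (intro integrable_mult_right) (simp add: integrable_indicator_iff)
  then show ?thesis
  proof (rule Bochner_Integration.integrable_bound)
    show "AE x in lborel. norm (f x) \<le> norm (B * indicator (cball 0 R) x)"
      using B R by (intro AE_I2) (force simp: indicator_def intro: order_trans[OF _ abs_ge_self])
  qed simp
qed

lemma Cc_integrable: "Cc f \<Longrightarrow> integrable lborel (\<lambda>x. complex_of_real (f x))"
  unfolding Cc_def by (intro integrable_of_real) (metis integrable_compact_support Cinf_continuous)

lemma Cc_derivative:
  assumes "Cc f" shows "Cc (\<lambda>x. frechet_derivative f (at x) v)"
proof -
  obtain R where R: "\<And>x. norm x > R \<Longrightarrow> f x = 0" and f: "Cinf f"
    using assms by (auto simp: Cc_def)
  have "frechet_derivative f (at x) v = 0" if "norm x > R" for x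
  proof -
    have "((\<lambda>x. 0) has_derivative frechet_derivative f (at x)) (at x)"
      by (rule has_derivative_transform_within_open[OF Cinf_has_derivative[OF f], where s = "- cball 0 R"])
        (use that R in auto)
    then show ?thesis
      using has_derivative_unique[OF has_derivative_const] by metis
  qed
  then show ?thesis using Cinf_derivative[OF f] by (auto simp: Cc_def)
qed

text \<open>Difference quotients take the place of integration by parts. A translation multiplies
  the transform by a character, so the quotients have explicit transforms whose limit is the
  derivative of an exponential at 0; the mean value theorem and compact support supply the
  dominating function.\<close>

lemma ft_derivative:
  assumes "Cc f"
  shows "ft (\<lambda>x. complex_of_real (frechet_derivative f (at x) v)) \<xi>
    = \<i> * (2 * pi * (v \<bullet> \<xi>)) * ft (\<lambda>x. complex_of_real (f x)) \<xi>"
proof -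
  define f' where "f' x = frechet_derivative f (at x)" for x
  obtain R where R: "\<And>x. norm x > R \<Longrightarrow> f x = 0" and f: "Cinf f"
    using assms by (auto simp: Cc_def)
  define c where "c n = inverse (real (Suc n))" for n
  have c: "0 < c n" "c n \<le> 1" for n by (auto simp: c_def field_simps)
  have c0: "c \<longlonglongrightarrow> 0" unfolding c_def[abs_def] by (rule LIMSEQ_inverse_real_of_nat)
  have f_line: "((\<lambda>t. f (x + t *\<^sub>R v)) has_field_derivative f' (x + t *\<^sub>R v) v) (at t)" for x t
  proof -
    have "((\<lambda>t. f (x + t *\<^sub>R v)) has_derivative (\<lambda>s. f' (x + t *\<^sub>R v) (s *\<^sub>R v))) (at t)"
      by (rule has_derivative_compose[OF _ Cinf_has_derivative[OF f, folded f'_def]])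
        (auto intro!: derivative_eq_intros)
    moreover have "(\<lambda>s. f' (x + t *\<^sub>R v) (s *\<^sub>R v)) = (*) (f' (x + t *\<^sub>R v) v)"
      using linear_scale[OF has_derivative_linear[OF Cinf_has_derivative[OF f, folded f'_def]]]
      by (auto simp: mult.commute)
    ultimately show ?thesis by (simp only: has_field_derivative_def)
  qed
  have cont: "continuous_on UNIV f" "continuous_on UNIV (\<lambda>x. f' x v)"
    using Cinf_continuous[OF f] Cinf_continuous[OF Cinf_derivative[OF f]] by (auto simp: f'_def)
  have [measurable]: "f \<in> borel_measurable borel" "(\<lambda>x. f' x v) \<in> borel_measurable borel"
    using cont by (auto intro: borel_measurable_continuous_onI)
  \<comment> \<open>\<open>d n\<close> vanishes beyond \<open>R + norm v\<close>, and the mean value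
    point lies at most another \<open>norm v\<close> further out.\<close>
  define R' where "R' = R + 2 * norm v"
  have "compact ((\<lambda>x. f' x v) ` cball 0 R')"
    by (intro compact_continuous_image continuous_on_subset[OF cont(2)]) auto
  then obtain B where B: "\<And>x. x \<in> cball 0 R' \<Longrightarrow> norm (f' x v) \<le> B"
    using compact_imp_bounded bounded_iff by (metis imageI)
  define d where "d n x = (f (c n *\<^sub>R v + x) - f x) / c n" for n x
  have d_bound: "norm (d n x) \<le> B * indicator (cball 0 (R + norm v)) x" for n x
  proof (cases "norm x \<le> R + norm v")
    case True
    obtain z where z: "0 < z" "z < c n" "f (x + c n *\<^sub>R v) - f (x + 0 *\<^sub>R v) = (c n - 0) * f' (x + z *\<^sub>R v) v"
      using MVT2[OF c(1)[of n], of "\<lambda>t. f (x + t *\<^sub>R v)" "\<lambda>t. f' (x + t *\<^sub>R v) v"] f_line by blast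
    have "norm (z *\<^sub>R v) \<le> 1 * norm v"
      unfolding norm_scaleR using z c(2)[of n] by (intro mult_right_mono) auto
    then have "norm (x + z *\<^sub>R v) \<le> R'"
      using True norm_triangle_ineq[of x "z *\<^sub>R v"] by (simp add: R'_def)
    moreover have "d n x = f' (x + z *\<^sub>R v) v"
      using z(3) c(1)[of n] by (simp add: d_def add.commute)
    ultimately show ?thesis using True B by simp
  next
    case False
    have "norm (c n *\<^sub>R v) \<le> 1 * norm v"
      unfolding norm_scaleR using c[of n] by (intro mult_right_mono) auto
    then have "norm (c n *\<^sub>R v + x) > R"
      using False norm_diff_ineq[of x "c n *\<^sub>R v"] by (simp add: add.commute)
    moreover have "norm x > R" using False norm_ge_zero[of v] by linarith
    ultimately show ?thesis using False by (simp add: d_def R)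
  qed
  have "(\<lambda>n. ft (\<lambda>x. complex_of_real (d n x)) \<xi>) \<longlonglongrightarrow> ft (\<lambda>x. complex_of_real (f' x v)) \<xi>"
    unfolding ft_def
  proof (rule integral_dominated_convergence[where w = "\<lambda>x. B * indicator (cball 0 (R + norm v)) x"])
    have "emeasure lborel (cball (0::real^3) (R + norm v)) < \<infinity>"
      by (rule emeasure_bounded_finite) simp
    then show "integrable lborel (\<lambda>x. B * indicator (cball (0::real^3) (R + norm v)) x)"
      by (intro integrable_mult_right) (simp add: integrable_indicator_iff)
    show "AE x in lborel. norm (complex_of_real (d n x) * cis (- 2 * pi * (x \<bullet> \<xi>))) \<le> B * indicator (cball 0 (R + norm v)) x" for n
      using d_bound by (intro AE_I2) (simp add: norm_mult)
    have "(\<lambda>n. d n x) \<longlonglongrightarrow> f' x v" for x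
    proof -
      have "((\<lambda>t. (f (x + t *\<^sub>R v) - f x) / t) \<longlongrightarrow> f' x v) (at 0)"
        using f_line[of x 0] by (simp add: has_field_derivative_iff)
      moreover have "filterlim c (at 0) sequentially"
        using c0 c(1) by (intro filterlim_atI) (auto intro!: always_eventually simp: less_imp_neq[symmetric])
      ultimately show ?thesis
        unfolding d_def by (subst add.commute) (rule filterlim_compose)
    qed
    then show "AE x in lborel. (\<lambda>n. complex_of_real (d n x) * cis (- 2 * pi * (x \<bullet> \<xi>)))
        \<longlonglongrightarrow> complex_of_real (f' x v) * cis (- 2 * pi * (x \<bullet> \<xi>))"
      by (intro AE_I2 tendsto_intros)
  qed (auto simp: d_def)
  moreover have "ft (\<lambda>x. complex_of_real (d n x)) \<xi>
      = (cis (2 * pi * (c n * (v \<bullet> \<xi>))) - 1) / c n * ft (\<lambda>x. complex_of_real (f x)) \<xi>" for n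
  proof -
    have i: "integrable lborel (\<lambda>x. complex_of_real (f x))" by (rule Cc_integrable[OF assms])
    have "ft (\<lambda>x. complex_of_real (d n x)) \<xi> = ft (\<lambda>x. (1 / c n) * (complex_of_real (f (c n *\<^sub>R v + x)) - complex_of_real (f x))) \<xi>"
      by (simp add: d_def)
    also have "\<dots> = (1 / c n) * (cis (2 * pi * (c n *\<^sub>R v \<bullet> \<xi>)) * ft (\<lambda>x. complex_of_real (f x)) \<xi> - ft (\<lambda>x. complex_of_real (f x)) \<xi>)"
      unfolding ft_cmult by (subst ft_diff, rule integrable_translate[OF i], rule i, subst ft_translate) auto
    finally show ?thesis by (simp add: algebra_simps diff_divide_distrib)
  qed
  moreover have "(\<lambda>n. (cis (2 * pi * (c n * (v \<bullet> \<xi>))) - 1) / c n * ft (\<lambda>x. complex_of_real (f x)) \<xi>)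
      \<longlonglongrightarrow> \<i> * (2 * pi * (v \<bullet> \<xi>)) * ft (\<lambda>x. complex_of_real (f x)) \<xi>"
  proof (intro tendsto_mult_right)
    define a where "a = \<i> * (2 * pi * (v \<bullet> \<xi>))"
    have "((\<lambda>z. exp (a * z)) has_field_derivative a) (at 0)"
      by (auto intro!: derivative_eq_intros)
    then have "((\<lambda>z. (exp (a * z) - 1) / z) \<longlongrightarrow> a) (at 0)"
      by (simp add: has_field_derivative_iff)
    moreover have "filterlim (\<lambda>n. complex_of_real (c n)) (at 0) sequentially"
    proof (rule filterlim_atI)
      show "(\<lambda>n. complex_of_real (c n)) \<longlonglongrightarrow> 0"
        using tendsto_of_real[OF c0, where 'a = complex] by simp
      have "complex_of_real (c n) \<noteq> 0" for n using c(1)[of n] by simp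
      then show "\<forall>\<^sub>F n in sequentially. complex_of_real (c n) \<noteq> 0" by simp
    qed
    ultimately have "(\<lambda>n. (exp (a * complex_of_real (c n)) - 1) / complex_of_real (c n)) \<longlonglongrightarrow> a"
      by (rule filterlim_compose)
    moreover have "exp (a * complex_of_real (c n)) = cis (2 * pi * (c n * (v \<bullet> \<xi>)))" for n
      by (simp add: a_def cis_conv_exp mult_ac)
    ultimately show "(\<lambda>n. (cis (2 * pi * (c n * (v \<bullet> \<xi>))) - 1) / complex_of_real (c n)) \<longlonglongrightarrow> \<i> * (2 * pi * (v \<bullet> \<xi>))"
      by (simp add: a_def)
  qed
  ultimately show ?thesis
    unfolding f'_def by (simp add: LIMSEQ_unique)
qed

text \<open>The operator 1 - (d/db)^2 / (4 pi^2) preserves \<open>Cc\<close> and has the symbol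
  \<open>1 + (\<xi> \<bullet> b)\<^sup>2\<close>; it is applied once for each
  \<open>b\<close>.\<close>

lemma Cc_ft_multiplier:
  assumes "Cc f" "finite B"
  shows "\<exists>g. Cc g \<and> (\<forall>\<xi>. ft (\<lambda>x. complex_of_real (g x)) \<xi>
     = complex_of_real (\<Prod>b\<in>B. 1 + (\<xi> \<bullet> b)\<^sup>2) * ft (\<lambda>x. complex_of_real (f x)) \<xi>)"
  using assms(2)
proof (induction)
  case empty
  then show ?case using assms(1) by auto
next
  case (insert b B)
  then obtain g where g: "Cc g" "\<And>\<xi>. ft (\<lambda>x. complex_of_real (g x)) \<xi>
     = complex_of_real (\<Prod>b\<in>B. 1 + (\<xi> \<bullet> b)\<^sup>2) * ft (\<lambda>x. complex_of_real (f x)) \<xi>"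
    by auto
  define g' where "g' x = frechet_derivative g (at x) b" for x
  define g'' where "g'' x = frechet_derivative g' (at x) b" for x
  have g': "Cc g'" "Cc g''"
    using Cc_derivative[OF g(1)] Cc_derivative[of g'] by (auto simp: g'_def[abs_def] g''_def[abs_def])
  define k where "k x = g x - 1 / (4 * pi\<^sup>2) * g'' x" for x
  have "Cc k"
  proof -
    obtain R R' where R: "\<And>x. norm x > R \<Longrightarrow> g x = 0" "\<And>x. norm x > R' \<Longrightarrow> g'' x = 0"
      using g g' by (auto simp: Cc_def)
    have "Cinf g" "Cinf g''" using g(1) g'(2) by (auto simp: Cc_def)
    then have "Cinf k" unfolding k_def[abs_def] Cinf_def
      by (intro allI Ck_diff Ck_cmult) auto
    moreover have "\<forall>x. norm x > max R R' \<longrightarrow> k x = 0" using R by (simp add: k_def)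
    ultimately show ?thesis unfolding Cc_def by blast
  qed
  moreover have "ft (\<lambda>x. complex_of_real (k x)) \<xi>
     = complex_of_real (\<Prod>b\<in>insert b B. 1 + (\<xi> \<bullet> b)\<^sup>2) * ft (\<lambda>x. complex_of_real (f x)) \<xi>" for \<xi>
  proof -
    have "ft (\<lambda>x. complex_of_real (k x)) \<xi> =
        ft (\<lambda>x. complex_of_real (g x) - complex_of_real (1 / (4 * pi\<^sup>2)) * complex_of_real (g'' x)) \<xi>"
      by (simp add: k_def)
    also have "\<dots> = ft (\<lambda>x. complex_of_real (g x)) \<xi> - complex_of_real (1 / (4 * pi\<^sup>2)) * ft (\<lambda>x. complex_of_real (g'' x)) \<xi>"
      unfolding ft_cmult[symmetric]
      by (rule ft_diff) (intro Cc_integrable[OF g(1)] integrable_mult_right Cc_integrable[OF g'(2)])+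
    also have "ft (\<lambda>x. complex_of_real (g'' x)) \<xi> = (\<i> * (2 * pi * (b \<bullet> \<xi>)))\<^sup>2 * ft (\<lambda>x. complex_of_real (g x)) \<xi>"
      unfolding g''_def ft_derivative[OF g'(1)] unfolding g'_def ft_derivative[OF g(1)]
      by (simp only: power2_eq_square mult.assoc)
    also have "(\<i> * (2 * pi * (b \<bullet> \<xi>)))\<^sup>2 = - complex_of_real (4 * pi\<^sup>2 * (\<xi> \<bullet> b)\<^sup>2)"
      by (simp add: power_mult_distrib inner_commute)
    also have "ft (\<lambda>x. complex_of_real (g x)) \<xi> - complex_of_real (1 / (4 * pi\<^sup>2)) *
        (- complex_of_real (4 * pi\<^sup>2 * (\<xi> \<bullet> b)\<^sup>2) * ft (\<lambda>x. complex_of_real (g x)) \<xi>)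
       = ft (\<lambda>x. complex_of_real (g x)) \<xi> + complex_of_real (1 / (4 * pi\<^sup>2) * (4 * pi\<^sup>2 * (\<xi> \<bullet> b)\<^sup>2)) * ft (\<lambda>x. complex_of_real (g x)) \<xi>"
      unfolding of_real_mult[of "1 / (4 * pi\<^sup>2)"] by (simp only: mult_minus_left mult_minus_right diff_minus_eq_add mult.assoc)
    also have "1 / (4 * pi\<^sup>2) * (4 * pi\<^sup>2 * (\<xi> \<bullet> b)\<^sup>2) = (\<xi> \<bullet> b)\<^sup>2"
      by simp
    also have "ft (\<lambda>x. complex_of_real (g x)) \<xi> + complex_of_real ((\<xi> \<bullet> b)\<^sup>2) * ft (\<lambda>x. complex_of_real (g x)) \<xi>
       = complex_of_real (1 + (\<xi> \<bullet> b)\<^sup>2) * ft (\<lambda>x. complex_of_real (g x)) \<xi>"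
      by (simp add: distrib_right)
    finally show ?thesis using insert.hyps by (simp add: g(2) mult.assoc)
  qed
  ultimately show ?case by blast
qed

text \<open>The multiplier is applied twice: one power of the product leaves an integrable majorant,
  the other absorbs |xi|^\<alpha> for \<alpha> up to 2.\<close>

lemma Cc_ft_decay:
  assumes "Cc f"
  obtains C where "\<And>\<xi>. (\<Prod>b\<in>Basis. 1 + (\<xi> \<bullet> b)\<^sup>2)\<^sup>2 * norm (ft (\<lambda>x. complex_of_real (f x)) \<xi>) \<le> C"
proof -
  obtain g where g: "Cc g" "\<And>\<xi>. ft (\<lambda>x. complex_of_real (g x)) \<xi>
     = complex_of_real (\<Prod>b\<in>Basis. 1 + (\<xi> \<bullet> b)\<^sup>2) * ft (\<lambda>x. complex_of_real (f x)) \<xi>"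
    using Cc_ft_multiplier[OF assms finite_Basis] by blast
  obtain k where k: "Cc k" "\<And>\<xi>. ft (\<lambda>x. complex_of_real (k x)) \<xi>
     = complex_of_real (\<Prod>b\<in>Basis. 1 + (\<xi> \<bullet> b)\<^sup>2) * ft (\<lambda>x. complex_of_real (g x)) \<xi>"
    using Cc_ft_multiplier[OF g(1) finite_Basis] by blast
  have "(\<Prod>b\<in>Basis. 1 + (\<xi> \<bullet> b)\<^sup>2)\<^sup>2 * norm (ft (\<lambda>x. complex_of_real (f x)) \<xi>)
      = norm (ft (\<lambda>x. complex_of_real (k x)) \<xi>)" for \<xi>
    unfolding k g norm_mult norm_of_real by (simp add: power2_eq_square mult.assoc)
  then show ?thesis
    using norm_ft_le[OF Cc_integrable[OF k(1)]] by (intro that) simp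
qed

text \<open>With squared coordinates for \<open>a\<close> this compares the product weight with 1 +
  |xi|^2, and hence with the powers of |xi| up to the second.\<close>

lemma prod_one_plus_ge:
  fixes a :: "'a \<Rightarrow> real"
  assumes "finite B" "\<And>b. b \<in> B \<Longrightarrow> a b \<ge> 0"
  shows "1 + sum a B \<le> (\<Prod>b\<in>B. 1 + a b)"
  using assms
proof (induction)
  case (insert b B)
  have "1 + sum a (insert b B) \<le> (1 + a b) * (1 + sum a B)"
    using insert by (simp add: algebra_simps sum_nonneg)
  also have "\<dots> \<le> (1 + a b) * (\<Prod>b\<in>B. 1 + a b)"
    using insert by (intro mult_left_mono) auto
  finally show ?case using insert by simp
qed simp

lemma Cc_ft_integrable:
  assumes "Cc f"
  shows "integrable lborel (ft (\<lambda>x. complex_of_real (f x)))"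
    and "0 \<le> \<alpha> \<Longrightarrow> \<alpha> \<le> 2 \<Longrightarrow> integrable lborel (\<lambda>\<xi>. complex_of_real (norm \<xi> powr \<alpha>) * ft (\<lambda>x. complex_of_real (f x)) \<xi>)"
proof -
  let ?F = "ft (\<lambda>x. complex_of_real (f x))"
  let ?P = "\<lambda>\<xi>::real^3. \<Prod>b\<in>Basis. 1 + (\<xi> \<bullet> b)\<^sup>2"
  obtain C where C: "\<And>\<xi>. (?P \<xi>)\<^sup>2 * norm (?F \<xi>) \<le> C"
    by (rule Cc_ft_decay[OF assms]) (rule that)
  have "integrable lborel (\<lambda>x::real. complex_of_real (inverse (1 + x\<^sup>2)))"
    using integrable_inverse_1_plus_square by (intro integrable_of_real) (simp add: set_integrable_def einterval_def)
  then have "integrable lborel (\<lambda>\<xi>::real^3. \<Prod>b\<in>Basis. complex_of_real (inverse (1 + (\<xi> \<bullet> b)\<^sup>2)))"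
    by (intro integrable_prod_Basis)
  then have I: "integrable lborel (\<lambda>\<xi>::real^3. complex_of_real C * (\<Prod>b\<in>Basis. complex_of_real (inverse (1 + (\<xi> \<bullet> b)\<^sup>2))))"
    by (rule integrable_mult_right)
  have P: "1 + (norm \<xi>)\<^sup>2 \<le> ?P \<xi>" for \<xi>
    unfolding norm_Basis_sum by (rule prod_one_plus_ge) auto
  have eq: "(\<Prod>b\<in>Basis. complex_of_real (inverse (1 + (\<xi> \<bullet> b)\<^sup>2))) = complex_of_real (1 / ?P \<xi>)" for \<xi> :: "real^3"
    by (simp add: inverse_eq_divide prod_dividef)
  have *: "m * norm (?F \<xi>) \<le> norm (complex_of_real C * (\<Prod>b\<in>Basis. complex_of_real (inverse (1 + (\<xi> \<bullet> b)\<^sup>2))))"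
    if "m \<le> 1 + (norm \<xi>)\<^sup>2" for \<xi> m
  proof -
    have pos: "?P \<xi> > 0" using P[of \<xi>] by (smt (verit) zero_le_power2)
    have "m * norm (?F \<xi>) \<le> ?P \<xi> * norm (?F \<xi>)"
      using that P[of \<xi>] by (intro mult_right_mono) auto
    also have "\<dots> = (?P \<xi>)\<^sup>2 * norm (?F \<xi>) / ?P \<xi>"
      using pos by (simp add: power2_eq_square)
    also have "\<dots> \<le> C / ?P \<xi>"
      using pos C by (intro divide_right_mono) auto
    also have "\<dots> \<le> \<bar>C\<bar> / ?P \<xi>" using pos by (intro divide_right_mono) auto
    also have "\<dots> = norm (complex_of_real C * (\<Prod>b\<in>Basis. complex_of_real (inverse (1 + (\<xi> \<bullet> b)\<^sup>2))))"
      unfolding eq norm_mult norm_of_real using pos by simp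
    finally show ?thesis .
  qed
  have [measurable]: "f \<in> borel_measurable borel"
    using assms Cinf_continuous by (auto simp: Cc_def intro: borel_measurable_continuous_onI)
  have [measurable]: "?F \<in> borel_measurable borel"
    by (rule borel_measurable_ft) measurable
  show "integrable lborel ?F"
    by (rule Bochner_Integration.integrable_bound[OF I]) (use *[of 1] in \<open>auto intro!: AE_I2\<close>)
  assume \<alpha>: "0 \<le> \<alpha>" "\<alpha> \<le> 2"
  have "norm \<xi> powr \<alpha> \<le> 1 + (norm \<xi>)\<^sup>2" for \<xi> :: "real^3"
  proof (cases "norm \<xi> \<le> 1")
    case True
    then have "norm \<xi> powr \<alpha> \<le> 1 powr \<alpha>" using \<alpha> by (intro powr_mono2) auto
    then show ?thesis by (simp add: add_increasing2)
  next
    case False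
    then have "norm \<xi> powr \<alpha> \<le> norm \<xi> powr 2" using \<alpha> by (intro powr_mono) auto
    also have "\<dots> = (norm \<xi>)\<^sup>2" using False by simp
    finally show ?thesis by simp
  qed
  from *[OF this] have "norm (complex_of_real (norm \<xi> powr \<alpha>) * ?F \<xi>)
      \<le> norm (complex_of_real C * (\<Prod>b\<in>Basis. complex_of_real (inverse (1 + (\<xi> \<bullet> b)\<^sup>2))))" for \<xi>
    by (simp only: norm_mult norm_of_real abs_of_nonneg powr_ge_zero)
  then show "integrable lborel (\<lambda>\<xi>. complex_of_real (norm \<xi> powr \<alpha>) * ?F \<xi>)"
    by (intro Bochner_Integration.integrable_bound[OF I] AE_I2) measurable
qed

subsection \<open>Second differences\<close>

definition sdiff :: "'a::real_vector \<Rightarrow> ('a \<Rightarrow> real) \<Rightarrow> 'a \<Rightarrow> real" where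
  "sdiff h f x = 2 * f x - f (h + x) - f (- h + x)"

lemma Ck_translate:
  fixes f :: "'a::euclidean_space \<Rightarrow> real"
  assumes "Ck n f" shows "Ck n (\<lambda>x. f (v + x))"
  by (rule Ck_compose[OF assms], unfold inner_add_left)
    (intro Ck_add Ck_const Ck_linear bounded_linear_inner_left)

lemma Cc_sdiff:
  assumes "Cc f" shows "Cc (sdiff h f)"
proof -
  obtain R where R: "\<And>x. norm x > R \<Longrightarrow> f x = 0" and f: "\<And>n. Ck n f"
    using assms by (auto simp: Cc_def Cinf_def)
  have "Cinf (sdiff h f)"
    unfolding sdiff_def[abs_def] Cinf_def
    by (intro allI Ck_diff Ck_cmult Ck_translate f)
  moreover have "sdiff h f x = 0" if "norm x > R + norm h" for x
  proof -
    have "norm x > R" using that norm_ge_zero[of h] by linarith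
    moreover have "norm (h + x) > R" "norm (- h + x) > R"
      using that norm_diff_ineq[of x h] norm_diff_ineq[of x "- h"] by (auto simp: add.commute)
    ultimately show ?thesis by (simp add: sdiff_def R)
  qed
  ultimately show ?thesis unfolding Cc_def by blast
qed

lemma Cc_measurable: "Cc f \<Longrightarrow> f \<in> borel_measurable borel"
  using Cinf_continuous by (auto simp: Cc_def intro: borel_measurable_continuous_onI)

text \<open>The two translations contribute conjugate characters, so the symbol is real. It equals
  \<open>4 * (sin (pi * (h \<bullet> \<xi>)))\<^sup>2\<close> and vanishes to second order at the
  origin.\<close>

lemma ft_sdiff:
  assumes "Cc f"
  shows "ft (\<lambda>x. complex_of_real (sdiff h f x)) \<xi>
    = complex_of_real (2 - 2 * cos (2 * pi * (h \<bullet> \<xi>))) * ft (\<lambda>x. complex_of_real (f x)) \<xi>"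
proof -
  let ?f = "\<lambda>x. complex_of_real (f x)"
  have i: "integrable lborel ?f" by (rule Cc_integrable[OF assms])
  have [measurable]: "f \<in> borel_measurable borel" by (rule Cc_measurable[OF assms])
  have "ft (\<lambda>x. complex_of_real (sdiff h f x)) \<xi> = ft (\<lambda>x. (2 * ?f x - ?f (h + x)) - ?f (- h + x)) \<xi>"
    by (simp add: sdiff_def)
  also have "\<dots> = ft (\<lambda>x. 2 * ?f x - ?f (h + x)) \<xi> - ft (\<lambda>x. ?f (- h + x)) \<xi>"
    by (rule ft_diff) (intro Bochner_Integration.integrable_diff integrable_mult_right integrable_translate i)+
  also have "ft (\<lambda>x. 2 * ?f x - ?f (h + x)) \<xi> = ft (\<lambda>x. 2 * ?f x) \<xi> - ft (\<lambda>x. ?f (h + x)) \<xi>"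
    by (rule ft_diff) (intro integrable_mult_right integrable_translate i)+
  also have "ft (\<lambda>x. ?f (h + x)) \<xi> = cis (2 * pi * (h \<bullet> \<xi>)) * ft ?f \<xi>"
    by (rule ft_translate) measurable
  also have "ft (\<lambda>x. ?f (- h + x)) \<xi> = cis (2 * pi * (- h \<bullet> \<xi>)) * ft ?f \<xi>"
    by (rule ft_translate) measurable
  also have "ft (\<lambda>x. 2 * ?f x) \<xi> = 2 * ft ?f \<xi>" by (rule ft_cmult)
  also have "2 * ft ?f \<xi> - cis (2 * pi * (h \<bullet> \<xi>)) * ft ?f \<xi> - cis (2 * pi * (- h \<bullet> \<xi>)) * ft ?f \<xi>
     = (2 - cis (2 * pi * (h \<bullet> \<xi>)) - cis (2 * pi * (- h \<bullet> \<xi>))) * ft ?f \<xi>"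
    by (simp add: algebra_simps)
  also have "2 - cis (2 * pi * (h \<bullet> \<xi>)) - cis (2 * pi * (- h \<bullet> \<xi>)) = complex_of_real (2 - 2 * cos (2 * pi * (h \<bullet> \<xi>)))"
    by (rule complex_eqI) auto
  finally show ?thesis .
qed

lemma Cc_bounded:
  assumes "Cc f" obtains B where "\<And>x. \<bar>f x\<bar> \<le> B"
proof -
  obtain R where R: "\<And>x. norm x > R \<Longrightarrow> f x = 0" and f: "continuous_on UNIV f"
    using assms Cinf_continuous by (auto simp: Cc_def)
  have "compact (f ` cball 0 R)"
    by (intro compact_continuous_image continuous_on_subset[OF f]) auto
  then obtain B where B: "\<And>x. x \<in> cball 0 R \<Longrightarrow> norm (f x) \<le> B"
    using compact_imp_bounded bounded_iff by (metis imageI)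
  have "\<bar>f x\<bar> \<le> \<bar>B\<bar>" for x
    using B[of x] R[of x] by (cases "norm x \<le> R") auto
  then show ?thesis by (rule that)
qed

lemma Cc_inversion:
  assumes "Cc f"
  shows "ift (ft (\<lambda>x. complex_of_real (f x))) x = complex_of_real (f x)"
proof -
  obtain B where B: "\<And>x. \<bar>f x\<bar> \<le> B" by (rule Cc_bounded[OF assms]) (rule that)
  have "continuous_on UNIV f" using assms Cinf_continuous by (auto simp: Cc_def)
  then show ?thesis
    by (intro ft_inversion[where B = B] Cc_integrable Cc_ft_integrable assms continuous_on_of_real)
      (auto simp: B)
qed

subsection \<open>The Sobolev norm of the data\<close>

text \<open>Pair \<open>g\<close> with its own inversion formula and exchange the integrals: as
  \<open>g\<close> is real, the opposite sign in the exponent conjugates the transform, leaving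
  |G|^2. Boundedness of \<open>g\<close> and of \<open>G\<close> makes both squares integrable,
  which carries the identity over to integrals in \<open>ennreal\<close>.\<close>

lemma Cc_Plancherel:
  assumes "Cc g"
  shows "(\<integral>\<^sup>+\<xi>. ennreal ((cmod (ft (\<lambda>x. complex_of_real (g x)) \<xi>))\<^sup>2) \<partial>lborel) = (\<integral>\<^sup>+x. ennreal ((g x)\<^sup>2) \<partial>lborel)"
proof -
  let ?g = "\<lambda>x. complex_of_real (g x)"
  let ?G = "ft ?g"
  obtain B where B: "\<And>x. \<bar>g x\<bar> \<le> B" by (rule Cc_bounded[OF assms]) (rule that)
  have [measurable]: "g \<in> borel_measurable borel" by (rule Cc_measurable[OF assms])
  have i: "integrable lborel ?g" by (rule Cc_integrable[OF assms])
  have iG: "integrable lborel ?G" by (rule Cc_ft_integrable[OF assms])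
  have [measurable]: "?G \<in> borel_measurable borel" using iG by auto
  have "(\<integral>x. ?g x * (\<integral>\<xi>. ?G \<xi> * cis (2 * pi * (x \<bullet> \<xi>)) \<partial>lborel) \<partial>lborel)
      = (\<integral>\<xi>. ?G \<xi> * (\<integral>x. ?g x * cis (2 * pi * (x \<bullet> \<xi>)) \<partial>lborel) \<partial>lborel)"
    by (rule lborel_pair.Fubini_kernel[OF i iG]) auto
  moreover have "(\<integral>\<xi>. ?G \<xi> * cis (2 * pi * (x \<bullet> \<xi>)) \<partial>lborel) = ?g x" for x
    using Cc_inversion[OF assms, of x] by (simp add: ift_def)
  moreover have "(\<integral>x. ?g x * cis (2 * pi * (x \<bullet> \<xi>)) \<partial>lborel) = cnj (?G \<xi>)" for \<xi>
  proof -
    have "(\<integral>x. ?g x * cis (2 * pi * (x \<bullet> \<xi>)) \<partial>lborel) = (\<integral>x. cnj (?g x * cis (- 2 * pi * (x \<bullet> \<xi>))) \<partial>lborel)"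
      by (simp add: cis_cnj del: Bochner_Integration.integral_cnj)
    then show ?thesis unfolding ft_def by (simp only: Bochner_Integration.integral_cnj)
  qed
  ultimately have "complex_of_real (\<integral>x. (g x)\<^sup>2 \<partial>lborel) = (\<integral>\<xi>. ?G \<xi> * cnj (?G \<xi>) \<partial>lborel)"
    unfolding integral_complex_of_real[symmetric] by (simp add: power2_eq_square)
  also have "\<dots> = complex_of_real (\<integral>\<xi>. (cmod (?G \<xi>))\<^sup>2 \<partial>lborel)"
    unfolding integral_complex_of_real[symmetric] complex_norm_square ..
  finally have eq: "(\<integral>x. (g x)\<^sup>2 \<partial>lborel) = (\<integral>\<xi>. (cmod (?G \<xi>))\<^sup>2 \<partial>lborel)" by simp
  have "integrable lborel (\<lambda>x. B * ?g x)" using i by simp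
  moreover have "(g x)\<^sup>2 \<le> norm (B * ?g x)" for x
  proof -
    have "\<bar>g x\<bar> * \<bar>g x\<bar> \<le> \<bar>B\<bar> * \<bar>g x\<bar>"
      by (intro mult_right_mono order_trans[OF B abs_ge_self]) auto
    then show ?thesis by (simp add: norm_mult power2_eq_square)
  qed
  ultimately have 1: "integrable lborel (\<lambda>x. (g x)\<^sup>2)"
    by (rule_tac Bochner_Integration.integrable_bound[OF _ _ AE_I2]) auto
  define C where "C = (\<integral>x. norm (?g x) \<partial>lborel)"
  have "integrable lborel (\<lambda>\<xi>. C * ?G \<xi>)" using iG by simp
  moreover have "(cmod (?G \<xi>))\<^sup>2 \<le> norm (C * ?G \<xi>)" for \<xi>
  proof -
    have "cmod (?G \<xi>) * cmod (?G \<xi>) \<le> \<bar>C\<bar> * cmod (?G \<xi>)"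
      by (intro mult_right_mono order_trans[OF norm_ft_le[OF i, folded C_def] abs_ge_self]) auto
    then show ?thesis by (simp add: norm_mult power2_eq_square)
  qed
  ultimately have 2: "integrable lborel (\<lambda>\<xi>. (cmod (?G \<xi>))\<^sup>2)"
    by (rule_tac Bochner_Integration.integrable_bound[OF _ _ AE_I2]) auto
  show ?thesis
    using nn_integral_eq_integral[OF 1] nn_integral_eq_integral[OF 2] eq by simp
qed

text \<open>By Plancherel it suffices to bound the squared symbol
  \<open>16 * \<bar>sin t\<bar> ^ 4\<close>. Since |sin t| is at most 1, the exponent 4 may be
  lowered to 7/3 = 2 * 7/6, and then |sin t| is replaced by |t|.\<close>

lemma sdiff_le_hdot:
  assumes "Cc f"
  shows "(\<integral>\<^sup>+x. ennreal ((sdiff h f x)\<^sup>2) \<partial>lborel) \<le> ennreal (16 * (pi * norm h) powr (7/3)) *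
    (\<integral>\<^sup>+\<xi>. ennreal (norm \<xi> powr (2 * (7/6)) * (cmod (ft (\<lambda>x. complex_of_real (f x)) \<xi>))\<^sup>2) \<partial>lborel)"
proof -
  let ?F = "ft (\<lambda>x. complex_of_real (f x))"
  have [measurable]: "?F \<in> borel_measurable borel" using Cc_ft_integrable[OF assms] by auto
  have *: "(2 - 2 * cos (2 * pi * (h \<bullet> \<xi>)))\<^sup>2 \<le> 16 * (pi * norm h) powr (7/3) * norm \<xi> powr (7/3)" for \<xi>
  proof -
    define t where "t = pi * (h \<bullet> \<xi>)"
    have "2 - 2 * cos (2 * t) = 4 * (sin t)\<^sup>2"
      by (simp add: cos_double_sin)
    then have "(2 - 2 * cos (2 * t))\<^sup>2 = 16 * \<bar>sin t\<bar> ^ 4"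
      by (simp add: power_mult_distrib)
    also have "\<bar>sin t\<bar> ^ 4 \<le> \<bar>sin t\<bar> powr (7/3)"
    proof (cases "sin t = 0")
      case False
      have "\<bar>sin t\<bar> ^ 4 = \<bar>sin t\<bar> powr 4" using False by (subst powr_numeral) auto
      also have "\<dots> \<le> \<bar>sin t\<bar> powr (7/3)"
        using False by (intro powr_mono') (auto simp: abs_sin_le_one)
      finally show ?thesis .
    qed simp
    also have "\<dots> \<le> (pi * norm h * norm \<xi>) powr (7/3)"
    proof (rule powr_mono2)
      have "\<bar>sin t\<bar> \<le> \<bar>t\<bar>" by (rule abs_sin_x_le_abs_x)
      also have "\<dots> \<le> pi * norm h * norm \<xi>"
        using Cauchy_Schwarz_ineq2[of h \<xi>] by (simp add: t_def abs_mult mult.assoc)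
      finally show "\<bar>sin t\<bar> \<le> pi * norm h * norm \<xi>" .
    qed auto
    also have "\<dots> = (pi * norm h) powr (7/3) * norm \<xi> powr (7/3)"
      by (rule powr_mult)
    finally show ?thesis by (simp add: t_def mult.assoc)
  qed
  have "(\<integral>\<^sup>+x. ennreal ((sdiff h f x)\<^sup>2) \<partial>lborel)
    = (\<integral>\<^sup>+\<xi>. ennreal ((cmod (complex_of_real (2 - 2 * cos (2 * pi * (h \<bullet> \<xi>))) * ?F \<xi>))\<^sup>2) \<partial>lborel)"
    unfolding Cc_Plancherel[OF Cc_sdiff[OF assms], symmetric] ft_sdiff[OF assms] ..
  also have "\<dots> \<le> (\<integral>\<^sup>+\<xi>. ennreal (16 * (pi * norm h) powr (7/3)) *
      ennreal (norm \<xi> powr (2 * (7/6)) * (cmod (?F \<xi>))\<^sup>2) \<partial>lborel)"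
  proof (intro nn_integral_mono)
    fix \<xi>
    have "(cmod (complex_of_real (2 - 2 * cos (2 * pi * (h \<bullet> \<xi>))) * ?F \<xi>))\<^sup>2
      = (2 - 2 * cos (2 * pi * (h \<bullet> \<xi>)))\<^sup>2 * (cmod (?F \<xi>))\<^sup>2"
      unfolding norm_mult norm_of_real power_mult_distrib power2_abs ..
    also have "\<dots> \<le> (16 * (pi * norm h) powr (7/3) * norm \<xi> powr (7/3)) * (cmod (?F \<xi>))\<^sup>2"
      by (intro mult_right_mono *) auto
    finally show "ennreal ((cmod (complex_of_real (2 - 2 * cos (2 * pi * (h \<bullet> \<xi>))) * ?F \<xi>))\<^sup>2) \<le>
       ennreal (16 * (pi * norm h) powr (7/3)) * ennreal (norm \<xi> powr (2 * (7/6)) * (cmod (?F \<xi>))\<^sup>2)"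
      by (subst ennreal_mult[symmetric]) (auto simp: mult.assoc intro!: ennreal_leI)
  qed
  also have "\<dots> = ennreal (16 * (pi * norm h) powr (7/3)) *
    (\<integral>\<^sup>+\<xi>. ennreal (norm \<xi> powr (2 * (7/6)) * (cmod (?F \<xi>))\<^sup>2) \<partial>lborel)"
    by (rule nn_integral_cmult) measurable
  finally show ?thesis .
qed

subsection \<open>An integrable kernel inverting the fractional derivative up to a second difference\<close>

lemma
  assumes s: "s > 0"
  shows gauss_translate_integrable: "integrable lborel (\<lambda>y. gauss s (v + y))"
    and gauss_translate_integral: "(\<integral>y. gauss s (v + y) \<partial>lborel) = 1"
    and gauss_translate_ft: "(\<integral>y. complex_of_real (gauss s (v + y)) * cis (2 * pi * (y \<bullet> \<xi>)) \<partial>lborel)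
      = cis (- 2 * pi * (v \<bullet> \<xi>)) * exp (- pi * s * (norm \<xi>)\<^sup>2)"
proof -
  show "integrable lborel (\<lambda>y. gauss s (v + y))"
    by (intro integrable_translate gauss_integrable s)
  show "(\<integral>y. gauss s (v + y) \<partial>lborel) = 1"
    using integral_translate[of "gauss s" v] gauss_integral[OF s] by simp
  have "complex_of_real (gauss s (v + y)) * cis (2 * pi * (y \<bullet> \<xi>)) =
      cis (- 2 * pi * (v \<bullet> \<xi>)) * (complex_of_real (gauss s (v + y)) * cis (2 * pi * ((v + y) \<bullet> \<xi>)))" for y
    by (simp add: cis_mult inner_add_left algebra_simps)
  then have "(\<integral>y. complex_of_real (gauss s (v + y)) * cis (2 * pi * (y \<bullet> \<xi>)) \<partial>lborel)
      = cis (- 2 * pi * (v \<bullet> \<xi>)) * (\<integral>y. complex_of_real (gauss s (v + y)) * cis (2 * pi * ((v + y) \<bullet> \<xi>)) \<partial>lborel)"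
    by (simp only: integral_mult_right_zero)
  also have "(\<integral>y. complex_of_real (gauss s (v + y)) * cis (2 * pi * ((v + y) \<bullet> \<xi>)) \<partial>lborel)
      = (\<integral>y. complex_of_real (gauss s y) * cis (2 * pi * (y \<bullet> \<xi>)) \<partial>lborel)"
    by (rule integral_translate) measurable
  finally show "(\<integral>y. complex_of_real (gauss s (v + y)) * cis (2 * pi * (y \<bullet> \<xi>)) \<partial>lborel)
      = cis (- 2 * pi * (v \<bullet> \<xi>)) * exp (- pi * s * (norm \<xi>)\<^sup>2)"
    unfolding gauss_ft[OF s] .
qed

lemma sdiff_gauss_integrable: "s > 0 \<Longrightarrow> integrable lborel (sdiff h (gauss s))"
  unfolding sdiff_def[abs_def]
  by (intro Bochner_Integration.integrable_diff integrable_mult_right gauss_translate_integrable gauss_integrable)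

lemma sdiff_gauss_ft:
  assumes s: "s > 0"
  shows "(\<integral>y. complex_of_real (sdiff h (gauss s) y) * cis (2 * pi * (y \<bullet> \<xi>)) \<partial>lborel)
      = complex_of_real (exp (- pi * s * (norm \<xi>)\<^sup>2) * (2 - 2 * cos (2 * pi * (h \<bullet> \<xi>))))"
proof -
  let ?e = "\<lambda>v y. complex_of_real (gauss s (v + y)) * cis (2 * pi * (y \<bullet> \<xi>))"
  have i: "integrable lborel (?e v)" for v
    by (intro integrable_mult_cis integrable_of_real gauss_translate_integrable s) measurable
  have "(\<integral>y. complex_of_real (sdiff h (gauss s) y) * cis (2 * pi * (y \<bullet> \<xi>)) \<partial>lborel)
     = (\<integral>y. (2 * ?e 0 y - ?e h y) - ?e (- h) y \<partial>lborel)"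
    by (simp add: sdiff_def algebra_simps)
  also have "\<dots> = 2 * (\<integral>y. ?e 0 y \<partial>lborel) - (\<integral>y. ?e h y \<partial>lborel) - (\<integral>y. ?e (- h) y \<partial>lborel)"
    by (subst Bochner_Integration.integral_diff, intro Bochner_Integration.integrable_diff integrable_mult_right i, rule i,
        subst Bochner_Integration.integral_diff, intro integrable_mult_right i, rule i, subst integral_mult_right_zero, rule refl)
  also have "\<dots> = (2 * cis (- 2 * pi * (0 \<bullet> \<xi>)) - cis (- 2 * pi * (h \<bullet> \<xi>)) - cis (- 2 * pi * (- h \<bullet> \<xi>))) * exp (- pi * s * (norm \<xi>)\<^sup>2)"
    unfolding gauss_translate_ft[OF s] by (simp add: algebra_simps)
  also have "2 * cis (- 2 * pi * (0 \<bullet> \<xi>)) - cis (- 2 * pi * (h \<bullet> \<xi>)) - cis (- 2 * pi * (- h \<bullet> \<xi>)) = complex_of_real (2 - 2 * cos (2 * pi * (h \<bullet> \<xi>)))"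
    by (rule complex_eqI) auto
  finally show ?thesis by (simp add: mult.commute)
qed

text \<open>The second difference of a Gaussian has integral zero, and its positive part is at most
  \<open>2 \<pi> \<bar>h\<bar>\<^sup>2 / s\<close> times the Gaussian since \<open>cosh \<ge> 1\<close>.\<close>

lemma sdiff_gauss_L1:
  assumes s: "s > 0"
  shows "(\<integral>y. \<bar>sdiff h (gauss s) y\<bar> \<partial>lborel) \<le> min 4 (4 * pi * (norm h)\<^sup>2 / s)"
proof -
  let ?G = "gauss s" and ?M = "sdiff h (gauss s)"
  define \<kappa> where "\<kappa> = pi * (norm h)\<^sup>2 / s"
  have iM: "integrable lborel ?M" by (rule sdiff_gauss_integrable[OF s])
  have iG: "integrable lborel ?G" by (rule gauss_integrable[OF s])
  have M0: "(\<integral>y. ?M y \<partial>lborel) = 0"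
    using sdiff_gauss_ft[OF s, of h 0] by simp
  have le: "?M y \<le> 2 * \<kappa> * ?G y" for y
  proof -
    define a where "a = 2 * pi * (h \<bullet> y) / s"
    have "?G (h + y) = ?G y * exp (- \<kappa>) * exp (- a)" "?G (- h + y) = ?G y * exp (- \<kappa>) * exp a"
      using s unfolding gauss_def power2_norm_eq_inner
      by (auto simp: \<kappa>_def a_def power2_norm_eq_inner inner_simps inner_commute exp_add[symmetric] field_simps)
    then have "?G (h + y) + ?G (- h + y) = ?G y * (exp (- \<kappa>) * (2 * cosh a))"
      by (simp add: cosh_field_def algebra_simps)
    also have "\<dots> \<ge> ?G y * ((1 - \<kappa>) * 2)"
    proof (intro mult_left_mono gauss_nonneg s)
      have "(1 - \<kappa>) * 2 \<le> exp (- \<kappa>) * 2" using exp_ge_add_one_self[of "- \<kappa>"] by simp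
      also have "\<dots> \<le> exp (- \<kappa>) * (2 * cosh a)" using cosh_real_ge_1[of a] by simp
      finally show "(1 - \<kappa>) * 2 \<le> exp (- \<kappa>) * (2 * cosh a)" .
    qed
    finally show ?thesis by (simp add: sdiff_def algebra_simps)
  qed
  have "\<kappa> \<ge> 0" using s by (simp add: \<kappa>_def)
  then have kG: "\<kappa> * ?G y \<ge> 0" for y using gauss_nonneg[OF s] by simp
  \<comment> \<open>|M| is twice the positive part minus \<open>M\<close>, so the vanishing mean
    turns the one-sided bound into a bound on the full norm.\<close>
  have "(\<integral>y. \<bar>?M y\<bar> \<partial>lborel) \<le> (\<integral>y. 4 * \<kappa> * ?G y - ?M y \<partial>lborel)"
  proof (rule integral_mono)
    show "\<bar>?M y\<bar> \<le> 4 * \<kappa> * ?G y - ?M y" for y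
      using le[of y] kG[of y] by (auto simp: abs_if)
  qed (use iM iG in auto)
  also have "\<dots> = 4 * \<kappa>" using iM iG M0 gauss_integral[OF s] by simp
  finally have 1: "(\<integral>y. \<bar>?M y\<bar> \<partial>lborel) \<le> 4 * \<kappa>" .
  have "(\<integral>y. \<bar>?M y\<bar> \<partial>lborel) \<le> (\<integral>y. (2 * ?G y + ?G (h + y)) + ?G (- h + y) \<partial>lborel)"
  proof (rule integral_mono)
    show "\<bar>?M y\<bar> \<le> 2 * ?G y + ?G (h + y) + ?G (- h + y)" for y
      using gauss_nonneg[OF s, of y] gauss_nonneg[OF s, of "h + y"] gauss_nonneg[OF s, of "- h + y"]
      by (auto simp: sdiff_def abs_if)
    show "integrable lborel (\<lambda>y. \<bar>?M y\<bar>)" using iM by auto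
  qed (intro Bochner_Integration.integrable_add integrable_mult_right iG gauss_translate_integrable[OF s])
  also have "\<dots> = (\<integral>y. 2 * ?G y + ?G (h + y) \<partial>lborel) + (\<integral>y. ?G (- h + y) \<partial>lborel)"
    by (intro Bochner_Integration.integral_add Bochner_Integration.integrable_add integrable_mult_right iG gauss_translate_integrable[OF s])
  also have "(\<integral>y. 2 * ?G y + ?G (h + y) \<partial>lborel) = (\<integral>y. 2 * ?G y \<partial>lborel) + (\<integral>y. ?G (h + y) \<partial>lborel)"
    by (intro Bochner_Integration.integral_add integrable_mult_right iG gauss_translate_integrable[OF s])
  also have "(\<integral>y. 2 * ?G y \<partial>lborel) + (\<integral>y. ?G (h + y) \<partial>lborel) + (\<integral>y. ?G (- h + y) \<partial>lborel) = 4"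
    unfolding gauss_translate_integral[OF s] by (simp add: gauss_integral[OF s])
  finally show ?thesis using 1 by (simp add: \<kappa>_def)
qed

text \<open>Carries the closed formulas for gauge integrals of powers over to Lebesgue integrals;
  nonnegativity makes the two notions agree.\<close>

lemma has_bochner_integral_nonneg_HK:
  fixes f :: "real \<Rightarrow> real"
  assumes [measurable]: "f \<in> borel_measurable borel" "S \<in> sets borel" and "\<And>x. x \<in> S \<Longrightarrow> f x \<ge> 0"
    and "(f has_integral I) S"
  shows "has_bochner_integral lborel (\<lambda>x. indicator S x * f x) I"
proof (rule has_bochner_integral_nn_integral)
  have "((\<lambda>x. indicator S x * f x) has_integral I) UNIV"
  proof -
    have "(\<lambda>x. indicator S x * f x) = (\<lambda>x. if x \<in> S then f x else 0)" by (auto simp: indicator_def)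
    then show ?thesis using assms(4) by (simp add: has_integral_restrict_UNIV)
  qed
  then show "(\<integral>\<^sup>+x. ennreal (indicator S x * f x) \<partial>lborel) = ennreal I"
    by (rule nn_integral_has_integral_lborel[rotated 2]) (use assms in \<open>auto simp: indicator_def\<close>)
  show "AE x in lborel. 0 \<le> indicator S x * f x" using assms by (auto simp: indicator_def)
  show "0 \<le> I" using has_integral_nonneg[OF assms(4)] assms(3) by blast
qed measurable

text \<open>Majorant for the L1 norm of the layer of the kernel at scale \<open>s\<close>. The two
  bounds in the minimum cross at \<open>s\<close> comparable to \<open>H\<^sup>2\<close>; the first
  gives integrability at 0 for \<alpha> > 0, the second at infinity for \<alpha> < 2.\<close>

definition weight :: "real \<Rightarrow> real \<Rightarrow> real \<Rightarrow> real" where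
  "weight \<alpha> H s = indicator {0<..} s * s powr (\<alpha>/2 - 1) * min 4 (4 * pi * H\<^sup>2 / s)"

lemma
  assumes \<alpha>: "0 < \<alpha>" "\<alpha> < 2" and H: "H > 0"
  shows weight_integrable: "integrable lborel (weight \<alpha> H)"
    and weight_integral: "(\<integral>s. weight \<alpha> H s \<partial>lborel) \<le> (8 / \<alpha> + 8 * pi / (2 - \<alpha>)) * H powr \<alpha>"
proof -
  let ?a = "\<lambda>s. indicator {0..H\<^sup>2} s * s powr (\<alpha>/2 - 1)"
  let ?b = "\<lambda>s. indicator {H\<^sup>2..} s * s powr (\<alpha>/2 - 2)"
  have a: "has_bochner_integral lborel ?a ((H\<^sup>2) powr (\<alpha>/2 - 1 + 1) / (\<alpha>/2 - 1 + 1))"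
    by (rule has_bochner_integral_nonneg_HK[OF _ _ _ has_integral_powr_from_0]) (use \<alpha> in auto)
  have b: "has_bochner_integral lborel ?b (- ((H\<^sup>2) powr (\<alpha>/2 - 2 + 1)) / (\<alpha>/2 - 2 + 1))"
    by (rule has_bochner_integral_nonneg_HK[OF _ _ _ has_integral_powr_to_inf]) (use \<alpha> H in auto)
  let ?g = "\<lambda>s. 4 * ?a s + 4 * pi * H\<^sup>2 * ?b s"
  have g: "integrable lborel ?g"
    using a b by (auto simp: has_bochner_integral_iff)
  have le: "weight \<alpha> H s \<le> ?g s" and nonneg: "weight \<alpha> H s \<ge> 0" for s
  proof -
    show "weight \<alpha> H s \<ge> 0" by (auto simp: weight_def indicator_def)
    show "weight \<alpha> H s \<le> ?g s"
    proof (cases "0 < s")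
      case True
      have w: "weight \<alpha> H s = s powr (\<alpha>/2 - 1) * min 4 (4 * pi * H\<^sup>2 / s)"
        using True by (simp add: weight_def)
      have p: "s powr (\<alpha>/2 - 1) / s = s powr (\<alpha>/2 - 2)"
        using True powr_diff[of s "\<alpha>/2 - 1" 1] by simp
      show ?thesis
      proof (cases "s \<le> H\<^sup>2")
        case True
        have "weight \<alpha> H s \<le> s powr (\<alpha>/2 - 1) * 4"
          unfolding w by (intro mult_left_mono min.cobounded1) auto
        also have "\<dots> \<le> ?g s" using True \<open>0 < s\<close> by (simp add: indicator_def)
        finally show ?thesis .
      next
        case False
        have "weight \<alpha> H s \<le> s powr (\<alpha>/2 - 1) * (4 * pi * H\<^sup>2 / s)"
          unfolding w by (intro mult_left_mono min.cobounded2) auto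
        also have "\<dots> = 4 * pi * H\<^sup>2 * s powr (\<alpha>/2 - 2)" unfolding p[symmetric] by simp
        also have "\<dots> \<le> ?g s" using False \<open>0 < s\<close> by (simp add: indicator_def)
        finally show ?thesis .
      qed
    next
      case False
      then show ?thesis by (simp add: weight_def indicator_def)
    qed
  qed
  have [measurable]: "weight \<alpha> H \<in> borel_measurable borel" unfolding weight_def[abs_def] by measurable
  show i: "integrable lborel (weight \<alpha> H)"
    by (rule Bochner_Integration.integrable_bound[OF g])
      (use le nonneg in \<open>auto intro!: AE_I2 order_trans[OF le abs_ge_self]\<close>)
  have "(\<integral>s. weight \<alpha> H s \<partial>lborel) \<le> (\<integral>s. ?g s \<partial>lborel)"
    by (rule integral_mono[OF i g le])
  also have "\<dots> = 4 * ((H\<^sup>2) powr (\<alpha>/2 - 1 + 1) / (\<alpha>/2 - 1 + 1)) + 4 * pi * H\<^sup>2 * (- ((H\<^sup>2) powr (\<alpha>/2 - 2 + 1)) / (\<alpha>/2 - 2 + 1))"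
    using a b by (auto simp: has_bochner_integral_iff)
  also have "(H\<^sup>2) powr (\<alpha>/2 - 1 + 1) = H powr \<alpha>"
    using H by (simp add: powr_powr flip: powr_numeral)
  also have "(H\<^sup>2) powr (\<alpha>/2 - 2 + 1) = H powr \<alpha> / H\<^sup>2"
    using H by (simp add: powr_powr powr_diff algebra_simps flip: powr_numeral)
  also have "4 * (H powr \<alpha> / (\<alpha>/2 - 1 + 1)) + 4 * pi * H\<^sup>2 * (- (H powr \<alpha> / H\<^sup>2) / (\<alpha>/2 - 2 + 1))
      = (8 / \<alpha> + 8 * pi / (2 - \<alpha>)) * H powr \<alpha>"
    using H \<alpha> by (simp add: field_simps)
  finally show "(\<integral>s. weight \<alpha> H s \<partial>lborel) \<le> (8 / \<alpha> + 8 * pi / (2 - \<alpha>)) * H powr \<alpha>" .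
qed

text \<open>This is \<open>pi powr (- \<alpha>/2) * Gamma (\<alpha>/2)\<close>, the factor that
  appears when |xi|^(-\<alpha>) is written as a superposition of Gaussians.\<close>

definition riesz_const :: "real \<Rightarrow> real" where
  "riesz_const \<alpha> = (\<integral>s. indicator {0<..} s * s powr (\<alpha>/2 - 1) * exp (- pi * s) \<partial>lborel)"

text \<open>The interval (0, 1) alone contributes enough, since the power of \<open>s\<close> is at
  least 1 there. Integrability follows by comparison with \<open>weight \<alpha> 1\<close>. The
  bound is uniform in \<alpha>, as a single \<epsilon> for all q requires.\<close>

lemma riesz_const_ge:
  assumes \<alpha>: "0 < \<alpha>" "\<alpha> < 2"
  shows "riesz_const \<alpha> \<ge> exp (- pi)"
proof -
  let ?f = "\<lambda>s. indicator {0<..} s * s powr (\<alpha>/2 - 1) * exp (- pi * s)"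
  have i: "integrable lborel ?f"
  proof (rule Bochner_Integration.integrable_bound[OF weight_integrable[OF \<alpha>, of 1]])
    have "exp (- pi * s) \<le> min 4 (4 * pi * 1\<^sup>2 / s)" if "s > 0" for s
    proof -
      have "pi * s \<le> exp (pi * s)" using exp_ge_add_one_self[of "pi * s"] by linarith
      then have "exp (- pi * s) \<le> 1 / (pi * s)"
        using that by (simp add: exp_minus field_simps)
      also have "\<dots> \<le> 4 * pi / s"
      proof -
        have "1 \<le> pi * pi" using pi_ge_two mult_mono[of 1 pi 1 pi] by auto
        then show ?thesis using that by (simp add: field_simps)
      qed
      finally have "exp (- pi * s) \<le> 4 * pi * 1\<^sup>2 / s" by simp
      moreover have "exp (- pi * s) \<le> 4" using that by (rule_tac order_trans[of _ 1]) auto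
      ultimately show ?thesis by simp
    qed
    then have "s powr (\<alpha>/2 - 1) * exp (- pi * s) \<le> s powr (\<alpha>/2 - 1) * min 4 (4 * pi * 1\<^sup>2 / s)" if "s > 0" for s
      using that by (intro mult_left_mono) auto
    then have "norm (?f s) \<le> weight \<alpha> 1 s" for s
      by (cases "s > 0") (simp_all add: weight_def indicator_def abs_mult)
    then show "AE s in lborel. norm (?f s) \<le> norm (weight \<alpha> 1 s)"
      by (intro AE_I2) (simp only: real_norm_def order_trans[OF _ abs_ge_self])
  qed auto
  have "exp (- pi) = (\<integral>s. indicator {0<..<1::real} s * exp (- pi) \<partial>lborel)"
    by simp
  also have "\<dots> \<le> (\<integral>s. ?f s \<partial>lborel)"
  proof (rule integral_mono[OF _ i])
    show "indicator {0<..<1::real} s * exp (- pi) \<le> ?f s" for s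
    proof (cases "s \<in> {0<..<1}")
      case True
      have "1 * exp (- pi) \<le> s powr (\<alpha>/2 - 1) * exp (- pi * s)"
      proof (rule mult_mono)
        have "s powr 0 \<le> s powr (\<alpha>/2 - 1)" using True \<alpha> by (intro powr_mono') auto
        then show "1 \<le> s powr (\<alpha>/2 - 1)" using True by simp
      qed (use True in auto)
      then show ?thesis using True by simp
    qed simp
  qed auto
  finally show ?thesis unfolding riesz_const_def .
qed

lemma riesz_const_scale:
  assumes r: "r > 0"
  shows "(\<integral>s. indicator {0<..} s * s powr (\<alpha>/2 - 1) * exp (- pi * s * r\<^sup>2) \<partial>lborel) = riesz_const \<alpha> * r powr (- \<alpha>)"
proof -
  let ?f = "\<lambda>s. indicator {0<..} s * s powr (\<alpha>/2 - 1) * exp (- pi * s * r\<^sup>2)"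
  have "(\<integral>s. ?f s \<partial>lborel) = \<bar>1 / r\<^sup>2\<bar> *\<^sub>R (\<integral>s. ?f (0 + 1 / r\<^sup>2 * s) \<partial>lborel)"
    using r by (intro lborel_integral_real_affine) auto
  also have "(\<lambda>s. ?f (0 + 1 / r\<^sup>2 * s)) = (\<lambda>s. (r powr (2 - \<alpha>)) * (indicator {0<..} s * s powr (\<alpha>/2 - 1) * exp (- pi * s)))"
  proof
    fix s
    have "(1 / r\<^sup>2 * s) powr (\<alpha>/2 - 1) = r powr (2 - \<alpha>) * s powr (\<alpha>/2 - 1)" if "s > 0"
    proof -
      have "(1 / r\<^sup>2) powr (\<alpha>/2 - 1) = r powr (2 - \<alpha>)"
      proof -
        have "1 / r\<^sup>2 = r powr (- 2)" using r by (simp add: powr_minus_divide)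
        then show ?thesis by (simp add: powr_powr)
      qed
      then show ?thesis using that r by (simp only: powr_mult)
    qed
    then show "?f (0 + 1 / r\<^sup>2 * s) = (r powr (2 - \<alpha>)) * (indicator {0<..} s * s powr (\<alpha>/2 - 1) * exp (- pi * s))"
      using r by (cases "s > 0") (auto simp: indicator_def zero_less_divide_iff)
  qed
  also have "\<bar>1 / r\<^sup>2\<bar> *\<^sub>R (\<integral>s. (r powr (2 - \<alpha>)) * (indicator {0<..} s * s powr (\<alpha>/2 - 1) * exp (- pi * s)) \<partial>lborel)
     = 1 / r\<^sup>2 * r powr (2 - \<alpha>) * riesz_const \<alpha>"
    unfolding riesz_const_def integral_mult_right_zero by simp
  also have "1 / r\<^sup>2 * r powr (2 - \<alpha>) = r powr (- \<alpha>)"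
    using r by (simp add: powr_diff powr_minus_divide)
  finally show ?thesis by (simp add: mult.commute)
qed

text \<open>Superposing second differences of \<open>gauss s\<close> with density
  \<open>s powr (\<alpha>/2 - 1)\<close> multiplies the symbol of the second difference by a
  multiple of |xi|^(-\<alpha>). The Riesz kernel alone is not integrable; taking the difference
  inside the superposition makes the L1 norm finite, and \<open>weight\<close> shows it to be of
  order |h|^\<alpha>.\<close>

lemma kernel:
  fixes h :: "real^3"
  assumes \<alpha>: "0 < \<alpha>" "\<alpha> < 2" and h: "h \<noteq> 0"
  obtains k :: "real^3 \<Rightarrow> real" where "integrable lborel k"
    "(\<integral>y. \<bar>k y\<bar> \<partial>lborel) \<le> (8 / \<alpha> + 8 * pi / (2 - \<alpha>)) * norm h powr \<alpha>"
    "\<And>\<xi>. \<xi> \<noteq> 0 \<Longrightarrow> (\<integral>y. complex_of_real (k y) * cis (2 * pi * (y \<bullet> \<xi>)) \<partial>lborel)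
       = complex_of_real (riesz_const \<alpha> * norm \<xi> powr (- \<alpha>) * (2 - 2 * cos (2 * pi * (h \<bullet> \<xi>))))"
proof -
  define F where "F s y = indicator {0<..} s * s powr (\<alpha>/2 - 1) * sdiff h (gauss s) y" for s y
  have H: "norm h > 0" using h by simp
  note w = weight_integrable[OF \<alpha> H] weight_integral[OF \<alpha> H]
  have [measurable]: "case_prod F \<in> borel_measurable (borel \<Otimes>\<^sub>M borel)"
    unfolding F_def sdiff_def gauss_def by measurable
  have [measurable]: "(\<lambda>y. F s y) \<in> borel_measurable borel" for s
    unfolding F_def sdiff_def gauss_def by measurable
  have iF: "integrable lborel (F s)" for s
    by (cases "s > 0") (auto simp: F_def[abs_def] intro!: integrable_mult_right sdiff_gauss_integrable)
  have le: "(\<integral>y. \<bar>F s y\<bar> \<partial>lborel) \<le> weight \<alpha> (norm h) s" for s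
  proof (cases "s > 0")
    case True
    have "(\<integral>y. \<bar>F s y\<bar> \<partial>lborel) = s powr (\<alpha>/2 - 1) * (\<integral>y. \<bar>sdiff h (gauss s) y\<bar> \<partial>lborel)"
      using True by (simp add: F_def abs_mult)
    also have "\<dots> \<le> s powr (\<alpha>/2 - 1) * min 4 (4 * pi * (norm h)\<^sup>2 / s)"
      by (intro mult_left_mono sdiff_gauss_L1 True) auto
    finally show ?thesis using True by (simp add: weight_def)
  qed (simp add: F_def weight_def indicator_def)
  have i1: "integrable lborel (\<lambda>s. \<integral>y. \<bar>F s y\<bar> \<partial>lborel)"
    by (rule Bochner_Integration.integrable_bound[OF w(1)])
      (auto intro!: AE_I2 order_trans[OF le abs_ge_self] simp: abs_of_nonneg)
  have i: "integrable (lborel \<Otimes>\<^sub>M lborel) (case_prod F)"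
    by (rule lborel_pair.Fubini_integrable) (use i1 iF in auto)
  have iabs: "integrable (lborel \<Otimes>\<^sub>M lborel) (\<lambda>(s, y). \<bar>F s y\<bar>)"
    using integrable_abs[OF i] by (simp add: case_prod_unfold)
  define k where "k y = (\<integral>s. F s y \<partial>lborel)" for y
  have ik: "integrable lborel k"
    unfolding k_def by (rule lborel_pair.integrable_snd[OF i])
  have "(\<integral>y. \<bar>k y\<bar> \<partial>lborel) \<le> (\<integral>y. (\<integral>s. \<bar>F s y\<bar> \<partial>lborel) \<partial>lborel)"
  proof (rule integral_mono)
    show "integrable lborel (\<lambda>y. \<integral>s. \<bar>F s y\<bar> \<partial>lborel)"
      by (rule lborel_pair.integrable_snd[OF iabs])
    show "\<bar>k y\<bar> \<le> (\<integral>s. \<bar>F s y\<bar> \<partial>lborel)" for y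
      unfolding k_def by (rule integral_abs_bound)
  qed (use ik in auto)
  also have "\<dots> = (\<integral>s. (\<integral>y. \<bar>F s y\<bar> \<partial>lborel) \<partial>lborel)"
    by (rule lborel_pair.Fubini_integral[OF iabs])
  also have "\<dots> \<le> (\<integral>s. weight \<alpha> (norm h) s \<partial>lborel)"
    by (rule integral_mono[OF i1 w(1) le])
  also have "\<dots> \<le> (8 / \<alpha> + 8 * pi / (2 - \<alpha>)) * norm h powr \<alpha>" by (rule w(2))
  finally have k1: "(\<integral>y. \<bar>k y\<bar> \<partial>lborel) \<le> (8 / \<alpha> + 8 * pi / (2 - \<alpha>)) * norm h powr \<alpha>" .
  have "(\<integral>y. complex_of_real (k y) * cis (2 * pi * (y \<bullet> \<xi>)) \<partial>lborel)
       = complex_of_real (riesz_const \<alpha> * norm \<xi> powr (- \<alpha>) * (2 - 2 * cos (2 * pi * (h \<bullet> \<xi>))))" if "\<xi> \<noteq> 0" for \<xi>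
  proof -
    let ?c = "\<lambda>y::real^3. cis (2 * pi * (y \<bullet> \<xi>))"
    have "(\<integral>y. complex_of_real (k y) * ?c y \<partial>lborel)
       = (\<integral>y. (\<integral>s. complex_of_real (F s y) * ?c y \<partial>lborel) \<partial>lborel)"
      unfolding k_def integral_mult_left_zero integral_complex_of_real ..
    also have "\<dots> = (\<integral>s. (\<integral>y. complex_of_real (F s y) * ?c y \<partial>lborel) \<partial>lborel)"
    proof (rule lborel_pair.Fubini_integral)
      have "integrable (lborel \<Otimes>\<^sub>M lborel) (\<lambda>z. complex_of_real (case_prod F z) * cis (2 * pi * (snd z \<bullet> \<xi>)))"
        by (intro integrable_mult_cis integrable_of_real i) measurable
      then show "integrable (lborel \<Otimes>\<^sub>M lborel) (\<lambda>(s, y). complex_of_real (F s y) * ?c y)"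
        by (simp add: case_prod_unfold)
    qed
    also have "(\<lambda>s. (\<integral>y. complex_of_real (F s y) * ?c y \<partial>lborel)) =
       (\<lambda>s. complex_of_real ((2 - 2 * cos (2 * pi * (h \<bullet> \<xi>))) * (indicator {0<..} s * s powr (\<alpha>/2 - 1) * exp (- pi * s * (norm \<xi>)\<^sup>2))))"
    proof
      fix s
      show "(\<integral>y. complex_of_real (F s y) * ?c y \<partial>lborel) =
       complex_of_real ((2 - 2 * cos (2 * pi * (h \<bullet> \<xi>))) * (indicator {0<..} s * s powr (\<alpha>/2 - 1) * exp (- pi * s * (norm \<xi>)\<^sup>2)))"
      proof (cases "s > 0")
        case True
        have "(\<integral>y. complex_of_real (F s y) * ?c y \<partial>lborel)
          = (\<integral>y. complex_of_real (s powr (\<alpha>/2 - 1)) * (complex_of_real (sdiff h (gauss s) y) * ?c y) \<partial>lborel)"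
          using True by (simp add: F_def mult.assoc)
        also have "\<dots> = complex_of_real (s powr (\<alpha>/2 - 1)) * (\<integral>y. complex_of_real (sdiff h (gauss s) y) * ?c y \<partial>lborel)"
          by (rule integral_mult_right_zero)
        finally show ?thesis unfolding sdiff_gauss_ft[OF True] using True
          by (simp only: of_real_mult[symmetric]) (simp add: mult_ac)
      qed (simp add: F_def)
    qed
    also have "(\<integral>s. complex_of_real ((2 - 2 * cos (2 * pi * (h \<bullet> \<xi>))) * (indicator {0<..} s * s powr (\<alpha>/2 - 1) * exp (- pi * s * (norm \<xi>)\<^sup>2))) \<partial>lborel)
      = complex_of_real ((2 - 2 * cos (2 * pi * (h \<bullet> \<xi>))) * (riesz_const \<alpha> * norm \<xi> powr (- \<alpha>)))"
      unfolding integral_complex_of_real integral_mult_right_zero using that by (subst riesz_const_scale) auto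
    finally show ?thesis by (simp add: mult_ac)
  qed
  with ik k1 show ?thesis by (rule that)
qed

subsection \<open>Lower bound for fractional derivatives in Lebesgue spaces\<close>

text \<open>On the Fourier side |xi|^\<alpha> and |xi|^(-\<alpha>) cancel and leave the symbol of
  \<open>sdiff\<close>, so inversion finishes. The origin, which the hypothesis on \<open>k\<close>
  leaves out, is a null set.\<close>

lemma kernel_fracD:
  fixes f k :: "real^3 \<Rightarrow> real"
  assumes f: "Cc f" and \<alpha>: "0 < \<alpha>" "\<alpha> < 2" and k: "integrable lborel k"
    and kft: "\<And>\<xi>. \<xi> \<noteq> 0 \<Longrightarrow> (\<integral>y. complex_of_real (k y) * cis (2 * pi * (y \<bullet> \<xi>)) \<partial>lborel)
       = complex_of_real (riesz_const \<alpha> * norm \<xi> powr (- \<alpha>) * (2 - 2 * cos (2 * pi * (h \<bullet> \<xi>))))"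
  shows "(\<integral>y. complex_of_real (k y) * fracD \<alpha> f (x + y) \<partial>lborel) = complex_of_real (riesz_const \<alpha> * sdiff h f x)"
proof -
  let ?F = "ft (\<lambda>x. complex_of_real (f x))"
  let ?m = "\<lambda>\<xi>. complex_of_real (norm \<xi> powr \<alpha>) * ?F \<xi>"
  have im: "integrable lborel ?m" using Cc_ft_integrable(2)[OF f] \<alpha> by simp
  have imx: "integrable lborel (\<lambda>\<xi>. ?m \<xi> * cis (2 * pi * (x \<bullet> \<xi>)))"
    by (intro integrable_mult_cis im) measurable
  have "fracD \<alpha> f (x + y) = (\<integral>\<xi>. ?m \<xi> * cis (2 * pi * (x \<bullet> \<xi>)) * cis (2 * pi * (y \<bullet> \<xi>)) \<partial>lborel)" for y
    unfolding fracD_def ift_def by (simp add: mult.assoc cis_mult inner_add_left distrib_left)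
  then have "(\<integral>y. complex_of_real (k y) * fracD \<alpha> f (x + y) \<partial>lborel) =
     (\<integral>y. complex_of_real (k y) * (\<integral>\<xi>. ?m \<xi> * cis (2 * pi * (x \<bullet> \<xi>)) * cis (2 * pi * (y \<bullet> \<xi>)) \<partial>lborel) \<partial>lborel)"
    by simp
  also have "\<dots> = (\<integral>\<xi>. ?m \<xi> * cis (2 * pi * (x \<bullet> \<xi>)) * (\<integral>y. complex_of_real (k y) * cis (2 * pi * (y \<bullet> \<xi>)) \<partial>lborel) \<partial>lborel)"
    by (rule lborel_pair.Fubini_kernel[OF integrable_of_real[OF k] imx]) auto
  also have "\<dots> = (\<integral>\<xi>. complex_of_real (riesz_const \<alpha>) * (ft (\<lambda>x. complex_of_real (sdiff h f x)) \<xi> * cis (2 * pi * (x \<bullet> \<xi>))) \<partial>lborel)"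
  proof (rule integral_cong_AE)
    have "AE \<xi> in lborel. \<xi> \<noteq> (0 :: real^3)" by (rule AE_lborel_singleton)
    then show "AE \<xi> in lborel. ?m \<xi> * cis (2 * pi * (x \<bullet> \<xi>)) * (\<integral>y. complex_of_real (k y) * cis (2 * pi * (y \<bullet> \<xi>)) \<partial>lborel)
       = complex_of_real (riesz_const \<alpha>) * (ft (\<lambda>x. complex_of_real (sdiff h f x)) \<xi> * cis (2 * pi * (x \<bullet> \<xi>)))"
    proof eventually_elim
      case (elim \<xi>)
      have p: "norm \<xi> powr \<alpha> * norm \<xi> powr (- \<alpha>) = 1"
        using elim by (simp add: powr_minus)
      have "?m \<xi> * cis (2 * pi * (x \<bullet> \<xi>)) * complex_of_real (riesz_const \<alpha> * norm \<xi> powr (- \<alpha>) * (2 - 2 * cos (2 * pi * (h \<bullet> \<xi>))))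
        = complex_of_real (norm \<xi> powr \<alpha> * norm \<xi> powr (- \<alpha>)) *
         (complex_of_real (riesz_const \<alpha>) * (complex_of_real (2 - 2 * cos (2 * pi * (h \<bullet> \<xi>))) * ?F \<xi> * cis (2 * pi * (x \<bullet> \<xi>))))"
        unfolding of_real_mult by (simp only: mult_ac)
      then show ?case unfolding kft[OF elim] ft_sdiff[OF f] p by simp
    qed
    have [measurable]: "?F \<in> borel_measurable borel" "k \<in> borel_measurable borel"
      using Cc_ft_integrable[OF f] k by auto
    have [measurable]: "ft (\<lambda>x. complex_of_real (sdiff h f x)) \<in> borel_measurable borel"
      using Cc_ft_integrable[OF Cc_sdiff[OF f]] by auto
    show "(\<lambda>\<xi>. ?m \<xi> * cis (2 * pi * (x \<bullet> \<xi>)) * (\<integral>y. complex_of_real (k y) * cis (2 * pi * (y \<bullet> \<xi>)) \<partial>lborel)) \<in> borel_measurable lborel"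
      by measurable
    show "(\<lambda>\<xi>. complex_of_real (riesz_const \<alpha>) * (ft (\<lambda>x. complex_of_real (sdiff h f x)) \<xi> * cis (2 * pi * (x \<bullet> \<xi>)))) \<in> borel_measurable lborel"
      by measurable
  qed
  also have "\<dots> = complex_of_real (riesz_const \<alpha>) * ift (ft (\<lambda>x. complex_of_real (sdiff h f x))) x"
    unfolding ift_def by (rule integral_mult_right_zero)
  finally show ?thesis unfolding Cc_inversion[OF Cc_sdiff[OF f]] by simp
qed

lemma borel_measurable_fracD:
  assumes "Cc f" shows "fracD \<alpha> f \<in> borel_measurable borel"
proof -
  have [measurable]: "ft (\<lambda>x. complex_of_real (f x)) \<in> borel_measurable borel"
    using Cc_ft_integrable[OF assms] by auto
  show ?thesis unfolding fracD_def ift_def by measurable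
qed

text \<open>The tangent at \<open>l\<close> to the convex function \<open>a powr q\<close>, in the
  guise of Young's inequality.\<close>

lemma powr_tangent:
  fixes a l q :: real
  assumes "a \<ge> 0" "l > 0" "q > 1"
  shows "q * l powr (q - 1) * a \<le> a powr q + (q - 1) * l powr q"
proof -
  have "a * l powr (q - 1) \<le> a powr q / q + (l powr (q - 1)) powr (q / (q - 1)) / (q / (q - 1))"
    using assms by (intro Youngs_inequality) (auto simp: field_simps)
  also have "(l powr (q - 1)) powr (q / (q - 1)) = l powr q"
    using assms by (simp add: powr_powr)
  finally show ?thesis using assms by (simp add: field_simps)
qed

text \<open>A one-sided form of Young's convolution inequality. Let \<open>D\<close> be the modulus
  of the fractional derivative and \<open>B\<close> the bound on the L1 norm of \<open>k\<close>, so
  that \<open>l * B = riesz_const \<alpha>\<close>. On \<open>E\<close> the integral of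
  \<open>D\<close> against |k| is at least \<open>l * B\<close>; the tangent at \<open>l\<close>
  turns this into at least \<open>l powr q * B\<close> for \<open>D powr q\<close>. Integrating over
  \<open>E\<close> and exchanging integrals costs one factor \<open>B\<close>.\<close>

lemma fracD_lower_bound:
  fixes f :: "real^3 \<Rightarrow> real"
  assumes f: "Cc f" and \<alpha>: "0 < \<alpha>" "\<alpha> < 2" and h: "h \<noteq> 0" and E[measurable]: "E \<in> sets borel"
    and ge: "\<And>x. x \<in> E \<Longrightarrow> sdiff h f x \<ge> 1" and q: "q > 1"
  defines "l \<equiv> riesz_const \<alpha> / ((8 / \<alpha> + 8 * pi / (2 - \<alpha>)) * norm h powr \<alpha>)"
  shows "ennreal (l powr q) * emeasure lborel E \<le> (\<integral>\<^sup>+x. ennreal (cmod (fracD \<alpha> f x) powr q) \<partial>lborel)"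
proof -
  obtain k where k: "integrable lborel k"
    "(\<integral>y. \<bar>k y\<bar> \<partial>lborel) \<le> (8 / \<alpha> + 8 * pi / (2 - \<alpha>)) * norm h powr \<alpha>"
    "\<And>\<xi>. \<xi> \<noteq> 0 \<Longrightarrow> (\<integral>y. complex_of_real (k y) * cis (2 * pi * (y \<bullet> \<xi>)) \<partial>lborel)
       = complex_of_real (riesz_const \<alpha> * norm \<xi> powr (- \<alpha>) * (2 - 2 * cos (2 * pi * (h \<bullet> \<xi>))))"
    by (rule kernel[OF \<alpha> h]) (rule that)
  define B where "B = (8 / \<alpha> + 8 * pi / (2 - \<alpha>)) * norm h powr \<alpha>"
  have B: "B > 0" using \<alpha> h by (auto simp: B_def intro!: mult_pos_pos add_pos_pos divide_pos_pos)
  have riesz_const: "riesz_const \<alpha> > 0" using riesz_const_ge[OF \<alpha>] exp_gt_zero[of "- pi"] by linarith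
  have l: "l > 0" "l * B = riesz_const \<alpha>" using B riesz_const by (auto simp: l_def B_def)
  define D where "D x = cmod (fracD \<alpha> f x)" for x
  have D0: "D x \<ge> 0" for x by (simp add: D_def)
  have [measurable]: "D \<in> borel_measurable borel" "k \<in> borel_measurable borel"
    using borel_measurable_fracD[OF f] k(1) by (auto simp: D_def[abs_def])
  have kB: "(\<integral>\<^sup>+y. ennreal \<bar>k y\<bar> \<partial>lborel) \<le> ennreal B"
    using k(1,2) by (subst nn_integral_eq_integral) (auto simp: B_def intro!: ennreal_leI)
  have point: "ennreal (l powr q * B) \<le> (\<integral>\<^sup>+y. ennreal (\<bar>k y\<bar> * D (x + y) powr q) \<partial>lborel)" if "x \<in> E" for x
  proof -
    let ?J = "\<integral>\<^sup>+y. ennreal (\<bar>k y\<bar> * D (x + y) powr q) \<partial>lborel"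
    have "ennreal (riesz_const \<alpha>) \<le> ennreal (cmod (complex_of_real (riesz_const \<alpha> * sdiff h f x)))"
      using ge[OF that] riesz_const by (intro ennreal_leI) (simp add: norm_mult)
    also have "\<dots> = ennreal (cmod (\<integral>y. complex_of_real (k y) * fracD \<alpha> f (x + y) \<partial>lborel))"
      using kernel_fracD[OF f \<alpha> k(1,3)] by simp
    \<comment> \<open>If the product is not integrable, its Bochner integral is 0 and the bound is
      trivial.\<close>
    also have "\<dots> \<le> (\<integral>\<^sup>+y. ennreal (norm (complex_of_real (k y) * fracD \<alpha> f (x + y))) \<partial>lborel)"
      by (cases "integrable lborel (\<lambda>y. complex_of_real (k y) * fracD \<alpha> f (x + y))")
        (auto intro: integral_norm_bound_ennreal simp: not_integrable_integral_eq)
    also have "\<dots> = (\<integral>\<^sup>+y. ennreal (\<bar>k y\<bar> * D (x + y)) \<partial>lborel)"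
      by (simp add: norm_mult D_def)
    finally have 1: "ennreal (riesz_const \<alpha>) \<le> (\<integral>\<^sup>+y. ennreal (\<bar>k y\<bar> * D (x + y)) \<partial>lborel)" .
    have "ennreal (q * l powr (q - 1)) * ennreal (riesz_const \<alpha>) \<le> ennreal (q * l powr (q - 1)) * (\<integral>\<^sup>+y. ennreal (\<bar>k y\<bar> * D (x + y)) \<partial>lborel)"
      by (intro mult_left_mono 1) auto
    also have "\<dots> = (\<integral>\<^sup>+y. ennreal (\<bar>k y\<bar> * (q * l powr (q - 1) * D (x + y))) \<partial>lborel)"
      using q by (subst nn_integral_cmult[symmetric]) (auto simp: ennreal_mult[symmetric] D0 mult_ac)
    also have "\<dots> \<le> (\<integral>\<^sup>+y. ennreal (\<bar>k y\<bar> * D (x + y) powr q) + ennreal ((q - 1) * l powr q) * ennreal \<bar>k y\<bar> \<partial>lborel)"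
    proof (intro nn_integral_mono)
      fix y
      have "\<bar>k y\<bar> * (q * l powr (q - 1) * D (x + y)) \<le> \<bar>k y\<bar> * (D (x + y) powr q + (q - 1) * l powr q)"
        using powr_tangent[OF D0 l(1) q] by (intro mult_left_mono) auto
      then have "ennreal (\<bar>k y\<bar> * (q * l powr (q - 1) * D (x + y))) \<le>
         ennreal (\<bar>k y\<bar> * D (x + y) powr q + (q - 1) * l powr q * \<bar>k y\<bar>)"
        by (intro ennreal_leI) (simp add: algebra_simps)
      also have "\<dots> = ennreal (\<bar>k y\<bar> * D (x + y) powr q) + ennreal ((q - 1) * l powr q * \<bar>k y\<bar>)"
        using q by (intro ennreal_plus) auto
      also have "ennreal ((q - 1) * l powr q * \<bar>k y\<bar>) = ennreal ((q - 1) * l powr q) * ennreal \<bar>k y\<bar>"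
        using q by (intro ennreal_mult) auto
      finally show "ennreal (\<bar>k y\<bar> * (q * l powr (q - 1) * D (x + y))) \<le>
         ennreal (\<bar>k y\<bar> * D (x + y) powr q) + ennreal ((q - 1) * l powr q) * ennreal \<bar>k y\<bar>" .
    qed
    also have "\<dots> = ?J + ennreal ((q - 1) * l powr q) * (\<integral>\<^sup>+y. ennreal \<bar>k y\<bar> \<partial>lborel)"
      by (subst nn_integral_add) (auto simp: nn_integral_cmult)
    also have "\<dots> \<le> ?J + ennreal ((q - 1) * l powr q) * ennreal B"
      by (intro add_left_mono mult_left_mono kB) auto
    finally have le: "ennreal (q * l powr (q - 1)) * ennreal (riesz_const \<alpha>) \<le> ?J + ennreal ((q - 1) * l powr q) * ennreal B" .
    have "q * l powr (q - 1) * riesz_const \<alpha> = q * (l powr q * B)"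
      using l by (simp add: powr_diff field_simps)
    then have "q * l powr (q - 1) * riesz_const \<alpha> = l powr q * B + (q - 1) * l powr q * B"
      by (simp add: algebra_simps)
    then have "ennreal (l powr q * B) + ennreal ((q - 1) * l powr q * B) \<le> ?J + ennreal ((q - 1) * l powr q * B)"
      using le q B riesz_const by (simp add: ennreal_mult[symmetric] ennreal_plus[symmetric] del: ennreal_plus)
    then show ?thesis by (simp add: ennreal_add_left_cancel_le add.commute[of _ "ennreal ((q - 1) * l powr q * B)"])
  qed
  have "ennreal (l powr q * B) * emeasure lborel E = (\<integral>\<^sup>+x. ennreal (l powr q * B) * indicator E x \<partial>lborel)"
    by (simp add: nn_integral_cmult_indicator)
  also have "\<dots> \<le> (\<integral>\<^sup>+x. (\<integral>\<^sup>+y. ennreal (\<bar>k y\<bar> * D (x + y) powr q) \<partial>lborel) \<partial>lborel)"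
    by (intro nn_integral_mono) (auto simp: indicator_def point)
  also have "\<dots> = (\<integral>\<^sup>+y. (\<integral>\<^sup>+x. ennreal (\<bar>k y\<bar> * D (x + y) powr q) \<partial>lborel) \<partial>lborel)"
    by (rule lborel_pair.Fubini') measurable
  also have "\<dots> = (\<integral>\<^sup>+y. ennreal \<bar>k y\<bar> * (\<integral>\<^sup>+x. ennreal (D x powr q) \<partial>lborel) \<partial>lborel)"
  proof (intro nn_integral_cong)
    fix y
    have "(\<integral>\<^sup>+x. ennreal (D x powr q) \<partial>lborel) = (\<integral>\<^sup>+x. ennreal (D x powr q) \<partial>(distr lborel borel ((+) y)))"
      by (simp add: lborel_distr_plus)
    also have "\<dots> = (\<integral>\<^sup>+x. ennreal (D (x + y) powr q) \<partial>lborel)"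
      by (subst nn_integral_distr) (auto simp: add.commute)
    finally show "(\<integral>\<^sup>+x. ennreal (\<bar>k y\<bar> * D (x + y) powr q) \<partial>lborel) = ennreal \<bar>k y\<bar> * (\<integral>\<^sup>+x. ennreal (D x powr q) \<partial>lborel)"
      by (simp add: ennreal_mult nn_integral_cmult)
  qed
  also have "\<dots> = (\<integral>\<^sup>+x. ennreal (D x powr q) \<partial>lborel) * (\<integral>\<^sup>+y. ennreal \<bar>k y\<bar> \<partial>lborel)"
    by (subst nn_integral_multc) (auto simp: mult.commute)
  also have "\<dots> \<le> (\<integral>\<^sup>+x. ennreal (D x powr q) \<partial>lborel) * ennreal B"
    by (intro mult_left_mono kB) auto
  finally have "ennreal B * (ennreal (l powr q) * emeasure lborel E) \<le> ennreal B * (\<integral>\<^sup>+x. ennreal (D x powr q) \<partial>lborel)"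
    using B by (simp add: ennreal_mult mult_ac)
  then show ?thesis
    using B unfolding D_def by (subst (asm) ennreal_mult_le_mult_iff) auto
qed

subsection \<open>The one-dimensional wave operator in characteristic coordinates\<close>

definition primB :: "(real \<times> real \<Rightarrow> real) \<Rightarrow> real \<times> real \<Rightarrow> real" where
  "primB N z = prim (\<lambda>z. N (snd z, fst z)) (snd z, fst z)"

lemma continuous_on_swap: "continuous_on UNIV N \<Longrightarrow> continuous_on UNIV (\<lambda>z. N (snd z, fst z))"
  for N :: "real \<times> real \<Rightarrow> real"
  by (rule continuous_on_compose2[of UNIV N]) (auto intro!: continuous_intros)

lemma primB_continuous: "continuous_on UNIV N \<Longrightarrow> continuous_on UNIV (primB N)"
  unfolding primB_def by (intro continuous_on_swap prim_continuous)

lemma Ck_primB: "Ck n N \<Longrightarrow> Ck n (primB N)"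
  unfolding primB_def
  by (rule Ck_compose_pair[OF Ck_prim[OF Ck_compose_pair[OF _ Ck_snd Ck_fst]] Ck_snd Ck_fst])

lemma primB_fst:
  assumes "continuous_on UNIV N"
  shows "((\<lambda>p. primB N (p,q)) has_field_derivative N (p,q)) (at p)"
  using prim_snd[OF continuous_on_swap[OF assms], of q p] by (simp add: primB_def)

lemma primB_snd:
  assumes "continuous_on UNIV N" "continuous_on UNIV N'"
    and "\<And>p q. ((\<lambda>q. N (p,q)) has_field_derivative N' (p,q)) (at q)"
  shows "((\<lambda>q. primB N (p,q)) has_field_derivative primB N' (p,q)) (at q)"
  using prim_fst[OF continuous_on_swap[OF assms(1)] continuous_on_swap[OF assms(2)]] assms(3)
  by (simp add: primB_def)

text \<open>The solution of \<open>\<partial>\<^sub>p \<partial>\<^sub>q w = N\<close> with vanishing Cauchy data on the diagonal \<open>p = q\<close>.\<close>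

definition Duhamel :: "(real \<times> real \<Rightarrow> real) \<Rightarrow> real \<times> real \<Rightarrow> real" where
  "Duhamel N z = primB (prim N) z - primB (prim N) (snd z, snd z)
     - primB (\<lambda>z. prim N (fst z, fst z)) (fst z, 0) + primB (\<lambda>z. prim N (fst z, fst z)) (snd z, 0)"

lemma Duhamel_diag: "Duhamel N (q, q) = 0"
  by (simp add: Duhamel_def)

lemma prim_diag_continuous: "continuous_on UNIV N \<Longrightarrow> continuous_on UNIV (\<lambda>z. prim N (fst z, fst z))"
  by (rule continuous_on_compose2[OF prim_continuous]) (auto intro!: continuous_intros)

text \<open>This identifies \<open>Duhamel N (p,q)\<close> as the iterated integral of
  \<open>N (s,y)\<close> with \<open>y\<close> from \<open>s\<close> to \<open>q\<close> and
  \<open>s\<close> from \<open>q\<close> to \<open>p\<close>, a triangle with one side on the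
  diagonal. Assembling it from primitives based at 0 avoids differentiating integrals with variable
  limits.\<close>

lemma Duhamel_fst:
  assumes "continuous_on UNIV N"
  shows "((\<lambda>p. Duhamel N (p,q)) has_field_derivative (prim N (p,q) - prim N (p,p))) (at p)"
  using primB_fst[OF prim_continuous[OF assms], of q p] primB_fst[OF prim_diag_continuous[OF assms], of 0 p]
  unfolding Duhamel_def by (auto intro!: derivative_eq_intros)

lemma Duhamel_snd:
  assumes "continuous_on UNIV N"
  shows "((\<lambda>q. Duhamel N (p,q)) has_field_derivative (primB N (p,q) - primB N (q,q))) (at q)"
proof -
  note c = prim_continuous[OF assms]
  have snd: "((\<lambda>q. primB (prim N) (p,q)) has_field_derivative primB N (p,q)) (at q)" for p q
    by (rule primB_snd[OF c assms prim_snd[OF assms]])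
  have "(primB (prim N) has_derivative (\<lambda>v. prim N z * fst v + primB N z * snd v)) (at z)" for z
    by (rule has_derivative_pair[OF primB_fst[OF c] snd primB_continuous[OF assms]])
  \<comment> \<open>Along the diagonal both partial derivatives enter; the part
    \<open>prim N (q,q)\<close> is cancelled by the last term of the definition of
    \<open>Duhamel\<close>.\<close>
  then have "((\<lambda>q. primB (prim N) (q,q)) has_derivative (\<lambda>v. prim N (q,q) * fst (v,v) + primB N (q,q) * snd (v,v))) (at q)"
    by (rule has_derivative_compose[rotated]) (auto intro!: derivative_eq_intros)
  moreover have "(\<lambda>v. prim N (q,q) * fst (v,v) + primB N (q,q) * snd (v,v)) = (*) (prim N (q,q) + primB N (q,q))"
    by (auto simp: algebra_simps)
  ultimately have "((\<lambda>q. primB (prim N) (q,q)) has_field_derivative (prim N (q,q) + primB N (q,q))) (at q)"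
    by (simp only: has_field_derivative_def)
  then show ?thesis
    using snd[of p q] primB_fst[OF prim_diag_continuous[OF assms], of 0 q]
    unfolding Duhamel_def by (auto intro!: derivative_eq_intros)
qed

text \<open>Each first partial is a difference of single primitives and hence as smooth as
  \<open>N\<close>. This gain of one order drives the bootstrap for the fixed point.\<close>

lemma Ck_Duhamel:
  assumes "Ck n N" shows "Ck (Suc n) (Duhamel N)"
proof (rule Ck_SucI_pair)
  have cont: "continuous_on UNIV N" using assms by (rule Ck_continuous)
  show "((\<lambda>p. Duhamel N (p,q)) has_field_derivative (\<lambda>z. prim N z - prim N (fst z, fst z)) (p,q)) (at p)" for p q
    using Duhamel_fst[OF cont] by simp
  show "((\<lambda>q. Duhamel N (p,q)) has_field_derivative (\<lambda>z. primB N z - primB N (snd z, snd z)) (p,q)) (at q)" for p q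
    using Duhamel_snd[OF cont] by simp
  show "Ck n (\<lambda>z. prim N z - prim N (fst z, fst z))"
    by (intro Ck_diff Ck_compose_pair[OF _ Ck_fst Ck_fst] Ck_prim assms)
  show "Ck n (\<lambda>z. primB N z - primB N (snd z, snd z))"
    by (intro Ck_diff Ck_compose_pair[OF _ Ck_snd Ck_snd] Ck_primB assms)
qed

section \<open>Pointwise bounds for the Duhamel integral\<close>

lemma DERIV_compare:
  fixes G H :: "real \<Rightarrow> real"
  assumes G: "\<And>y. y \<in> {min a b..max a b} \<Longrightarrow> (G has_field_derivative g y) (at y)"
    and H: "\<And>y. y \<in> {min a b..max a b} \<Longrightarrow> (H has_field_derivative h y) (at y)"
    and le: "\<And>y. y \<in> {min a b..max a b} \<Longrightarrow> \<bar>g y\<bar> \<le> h y"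
  shows "\<bar>G a - G b\<bar> \<le> \<bar>H a - H b\<bar>"
proof -
  have *: "\<bar>G b - G a\<bar> \<le> H b - H a" if "a \<le> b" and
    GH: "\<And>y. y \<in> {a..b} \<Longrightarrow> (G has_field_derivative g y) (at y)"
      "\<And>y. y \<in> {a..b} \<Longrightarrow> (H has_field_derivative h y) (at y)"
      "\<And>y. y \<in> {a..b} \<Longrightarrow> \<bar>g y\<bar> \<le> h y" for a b
  proof -
    have "H a - G a \<le> H b - G b"
    proof (rule DERIV_nonneg_imp_nondecreasing[OF \<open>a \<le> b\<close>])
      fix y assume y: "a \<le> y" "y \<le> b"
      then have "((\<lambda>y. H y - G y) has_field_derivative (h y - g y)) (at y)" "h y - g y \<ge> 0"
        using GH[of y] by (auto intro!: derivative_eq_intros)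
      then show "\<exists>z. ((\<lambda>y. H y - G y) has_field_derivative z) (at y) \<and> z \<ge> 0" by blast
    qed
    moreover have "H a + G a \<le> H b + G b"
    proof (rule DERIV_nonneg_imp_nondecreasing[OF \<open>a \<le> b\<close>])
      fix y assume y: "a \<le> y" "y \<le> b"
      then have "((\<lambda>y. H y + G y) has_field_derivative (h y + g y)) (at y)" "h y + g y \<ge> 0"
        using GH[of y] by (auto intro!: derivative_eq_intros)
      then show "\<exists>z. ((\<lambda>y. H y + G y) has_field_derivative z) (at y) \<and> z \<ge> 0" by blast
    qed
    ultimately show ?thesis by linarith
  qed
  show ?thesis
    using *[of a b] *[of b a] assms by (cases "a \<le> b") (auto simp: min_def max_def)
qed

text \<open>The majorant \<open>h\<close> depends on the outgoing coordinate alone. Its primitive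
  \<open>H\<close> bounds the inner integral by \<open>M\<close>, and the outer integral contributes
  only the length |p - q|; for a thin shell \<open>M\<close> is small although \<open>h\<close> is
  large.\<close>

lemma Duhamel_diff_bound:
  assumes N: "continuous_on UNIV N" "continuous_on UNIV N'"
    and le: "\<And>s y. s \<in> {min p q..max p q} \<Longrightarrow> y \<in> {min p q..max p q} \<Longrightarrow> \<bar>N (s,y) - N' (s,y)\<bar> \<le> h y"
    and H: "\<And>y. (H has_field_derivative h y) (at y)"
    and M: "\<And>a b. a \<in> {min p q..max p q} \<Longrightarrow> b \<in> {min p q..max p q} \<Longrightarrow> \<bar>H a - H b\<bar> \<le> M"
  shows "\<bar>Duhamel N (p,q) - Duhamel N' (p,q)\<bar> \<le> M * \<bar>p - q\<bar>"
proof -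
  define f where "f s = Duhamel N (s,q) - Duhamel N' (s,q)" for s
  define f' where "f' s = (prim N (s,q) - prim N' (s,q)) - (prim N (s,s) - prim N' (s,s))" for s
  have "norm (f p - f q) \<le> M * norm (p - q)"
  proof (rule field_differentiable_bound[where S = "{min p q..max p q}" and f' = f'])
    fix s assume s: "s \<in> {min p q..max p q}"
    have "(f has_field_derivative f' s) (at s)"
      unfolding f_def f'_def using Duhamel_fst[OF N(1), of q s] Duhamel_fst[OF N(2), of q s]
      by (auto intro!: derivative_eq_intros)
    then show "(f has_field_derivative f' s) (at s within {min p q..max p q})"
      by (rule has_field_derivative_at_within)
    have "\<bar>f' s\<bar> \<le> \<bar>H q - H s\<bar>"
      unfolding f'_def
    proof (rule DERIV_compare[where G = "\<lambda>y. prim N (s,y) - prim N' (s,y)" and g = "\<lambda>y. N (s,y) - N' (s,y)" and h = h])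
      fix y assume "y \<in> {min q s..max q s}"
      then have y: "y \<in> {min p q..max p q}" using s by auto
      show "((\<lambda>y. prim N (s,y) - prim N' (s,y)) has_field_derivative (N (s,y) - N' (s,y))) (at y)"
        by (intro DERIV_diff prim_snd N)
      show "\<bar>N (s,y) - N' (s,y)\<bar> \<le> h y" by (rule le[OF s y])
    qed (rule H)
    also have "\<dots> \<le> M" using s by (intro M) auto
    finally show "norm (f' s) \<le> M" by simp
  qed auto
  then show ?thesis by (simp add: f_def Duhamel_diag)
qed

lemma Duhamel_0: "Duhamel (\<lambda>z. 0) z = 0"
  by (simp add: Duhamel_def primB_def prim_def)

lemma Duhamel_bound:
  assumes N: "continuous_on UNIV N"
    and le: "\<And>s y. s \<in> {min p q..max p q} \<Longrightarrow> y \<in> {min p q..max p q} \<Longrightarrow> \<bar>N (s,y)\<bar> \<le> h y"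
    and H: "\<And>y. (H has_field_derivative h y) (at y)"
    and M: "\<And>a b. a \<in> {min p q..max p q} \<Longrightarrow> b \<in> {min p q..max p q} \<Longrightarrow> \<bar>H a - H b\<bar> \<le> M"
  shows "\<bar>Duhamel N (p,q)\<bar> \<le> M * \<bar>p - q\<bar>"
  using Duhamel_diff_bound[OF N, of "\<lambda>z. 0" p q h H M] assms by (simp add: Duhamel_0)

subsection \<open>Existence of the correction to a thin outgoing shell\<close>

definition shell :: "real \<Rightarrow> real \<Rightarrow> real \<Rightarrow> real" where
  "shell A \<epsilon> y = A * bump ((y - 7/2) / \<epsilon>)"

text \<open>In the coordinates p = r + t and q = r - t the function V = r u satisfies 4 V_pq = V^7 /
  r^6, with r = (p + q) / 2. Using \<open>sigma\<close> makes the coefficient smooth and bounded on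
  the plane and changes nothing for r at least 1.\<close>

definition coeff :: "real \<times> real \<Rightarrow> real" where
  "coeff z = 1/4 * inverse (sigma ((fst z + snd z) / 2)) ^ 6"

definition source :: "real \<Rightarrow> real \<Rightarrow> (real \<times> real \<Rightarrow> real) \<Rightarrow> real \<times> real \<Rightarrow> real" where
  "source A \<epsilon> w z = coeff z * (shell A \<epsilon> (snd z) + w z) ^ 7"

text \<open>Equal to 1 on [-2, 10], which contains r + t and r - t for 1 < r < 7 and -1/2 < t < 5/2,
  and zero outside (-3, 11). Localising in both coordinates allows the contraction to run in bounded
  continuous functions on the whole plane.\<close>

definition cutoff :: "real \<Rightarrow> real" where
  "cutoff p = step (p + 3) * step (11 - p)"

lemma Ck_shell: "Ck n (shell A \<epsilon>)"
  unfolding shell_def[abs_def] divide_inverse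
  by (intro Ck_cmult Ck_compose_real[OF Ck_bump] Ck_mult Ck_diff Ck_id Ck_const)

lemma Ck_coeff: "Ck n coeff"
proof -
  have "sigma r \<noteq> 0" for r using sigma_ge[of r] by linarith
  then show ?thesis
    unfolding coeff_def[abs_def] divide_inverse
    by (intro Ck_cmult Ck_power Ck_inverse Ck_compose_real[OF Ck_sigma] Ck_mult Ck_add Ck_fst Ck_snd Ck_const)
qed

lemma Ck_source: "Ck n w \<Longrightarrow> Ck n (source A \<epsilon> w)"
  unfolding source_def[abs_def]
  by (intro Ck_mult Ck_power Ck_add Ck_coeff Ck_compose_real[OF Ck_shell] Ck_snd)

lemma Ck_cutoff: "Ck n cutoff"
  unfolding cutoff_def[abs_def]
  by (intro Ck_mult Ck_compose_real[OF Ck_step] Ck_add Ck_diff Ck_id Ck_const)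

lemma cutoff_range: "0 \<le> cutoff p" "cutoff p \<le> 1"
  using step_range[of "p + 3"] step_range[of "11 - p"] by (auto simp: cutoff_def intro: mult_le_one)

lemma cutoff_1: "-2 \<le> p \<Longrightarrow> p \<le> 10 \<Longrightarrow> cutoff p = 1"
  by (simp add: cutoff_def step_1)

lemma cutoff_0: "p \<le> -3 \<or> p \<ge> 11 \<Longrightarrow> cutoff p = 0"
  by (auto simp: cutoff_def step_0)

lemma shell_zero: "\<epsilon> > 0 \<Longrightarrow> \<bar>y - 7/2\<bar> \<ge> \<epsilon> \<Longrightarrow> shell A \<epsilon> y = 0"
  by (simp add: shell_def bump_zero abs_divide)

lemma shell_range: "A \<ge> 0 \<Longrightarrow> 0 \<le> shell A \<epsilon> y" "A \<ge> 0 \<Longrightarrow> shell A \<epsilon> y \<le> A"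
  using bump_nonneg bump_le_1[of "(y - 7/2) / \<epsilon>"] by (auto simp: shell_def mult_left_le)

lemma shell_ge: "A \<ge> 0 \<Longrightarrow> \<epsilon> > 0 \<Longrightarrow> \<bar>y - 7/2\<bar> \<le> \<epsilon> / 4 \<Longrightarrow> shell A \<epsilon> y \<ge> 4/5 * A"
  using mult_left_mono[OF bump_ge[of "(y - 7/2) / \<epsilon>"], of A] by (simp add: shell_def abs_divide field_simps)

lemma coeff_range: "0 \<le> coeff z" "coeff z \<le> 16"
proof -
  have s: "sigma ((fst z + snd z) / 2) \<ge> 1/2" by (rule sigma_ge)
  then have "inverse (sigma ((fst z + snd z) / 2)) \<le> inverse (1/2)"
    by (intro le_imp_inverse_le) auto
  then have "inverse (sigma ((fst z + snd z) / 2)) ^ 6 \<le> 2 ^ 6"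
    using s by (intro power_mono) auto
  then show "coeff z \<le> 16" by (simp add: coeff_def)
  show "0 \<le> coeff z" using s by (simp add: coeff_def)
qed

lemma power7_diff:
  fixes x y m :: real
  assumes "\<bar>x\<bar> \<le> m" "\<bar>y\<bar> \<le> m"
  shows "\<bar>x ^ 7 - y ^ 7\<bar> \<le> 7 * m ^ 6 * \<bar>x - y\<bar>"
proof -
  have "norm (x ^ 7 - y ^ 7) \<le> (7 * m ^ 6) * norm (x - y)"
  proof (rule field_differentiable_bound[where S = "{-m..m}" and f' = "\<lambda>x. 7 * x ^ 6" and f = "\<lambda>x. x ^ 7"])
    show "((\<lambda>x. x ^ 7) has_real_derivative 7 * z ^ 6) (at z within {-m..m})" for z
      using DERIV_power[OF DERIV_ident, where n = 7] by simp
    show "norm (7 * z ^ 6) \<le> 7 * m ^ 6" if "z \<in> {-m..m}" for z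
      using that power_mono[of "\<bar>z\<bar>" m 6] by (auto simp: power_abs abs_mult)
  qed (use assms in auto)
  then show ?thesis by simp
qed

text \<open>The integrable majorant \<open>2 / (1 + z\<^sup>2)\<close> of the indicator of \<open>[-1, 1]\<close>, with its explicit
  primitive, makes the smallness of the shell width visible.\<close>

definition majorant :: "real \<Rightarrow> real \<Rightarrow> real \<Rightarrow> real \<Rightarrow> real" where
  "majorant \<epsilon> C c y = C * (2 / (1 + ((y - 7/2) / \<epsilon>)\<^sup>2)) + c"

definition majorant_prim :: "real \<Rightarrow> real \<Rightarrow> real \<Rightarrow> real \<Rightarrow> real" where
  "majorant_prim \<epsilon> C c y = C * (2 * \<epsilon> * arctan ((y - 7/2) / \<epsilon>)) + c * y"

lemma majorant_prim_DERIV: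
  assumes "\<epsilon> > 0"
  shows "(majorant_prim \<epsilon> C c has_field_derivative majorant \<epsilon> C c y) (at y)"
proof -
  have "((\<lambda>y. (y - 7/2) / \<epsilon>) has_field_derivative 1 / \<epsilon>) (at y)"
    using assms by (auto intro!: derivative_eq_intros)
  from DERIV_chain2[OF DERIV_arctan this]
  have "((\<lambda>y. arctan ((y - 7/2) / \<epsilon>)) has_field_derivative
      inverse (1 + ((y - 7/2) / \<epsilon>)\<^sup>2) * (1 / \<epsilon>)) (at y)" .
  from DERIV_add[OF DERIV_cmult[OF DERIV_cmult[OF this, of "2 * \<epsilon>"], of C] DERIV_cmult[OF DERIV_ident, of c]]
  have "((\<lambda>y. C * (2 * \<epsilon> * arctan ((y - 7/2) / \<epsilon>)) + c * y) has_field_derivative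
      C * (2 * \<epsilon> * (inverse (1 + ((y - 7/2) / \<epsilon>)\<^sup>2) * (1 / \<epsilon>))) + c * 1) (at y)" .
  moreover have "C * (2 * \<epsilon> * (inverse (1 + ((y - 7/2) / \<epsilon>)\<^sup>2) * (1 / \<epsilon>))) + c * 1 = majorant \<epsilon> C c y"
  proof -
    have "2 * \<epsilon> * (v * (1 / \<epsilon>)) = 2 * v" for v using assms by simp
    then show ?thesis by (simp only: majorant_def divide_inverse mult_1_right)
  qed
  ultimately show ?thesis
    unfolding majorant_prim_def[abs_def] by (simp only:)
qed

text \<open>The arctangent varies by at most pi, below 4, so even a large \<open>C\<close> enters
  only through \<open>C * \<epsilon>\<close>.\<close>

lemma majorant_prim_bound:
  assumes "\<epsilon> > 0" "C \<ge> 0" "c \<ge> 0" "\<bar>a - b\<bar> \<le> 14"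
  shows "\<bar>majorant_prim \<epsilon> C c a - majorant_prim \<epsilon> C c b\<bar> \<le> 8 * C * \<epsilon> + 14 * c"
proof -
  let ?t = "\<lambda>y. arctan ((y - 7/2) / \<epsilon>)"
  have "\<bar>?t a - ?t b\<bar> \<le> pi"
    using arctan_lbound[of "(a - 7/2) / \<epsilon>"] arctan_ubound[of "(a - 7/2) / \<epsilon>"]
      arctan_lbound[of "(b - 7/2) / \<epsilon>"] arctan_ubound[of "(b - 7/2) / \<epsilon>"] by linarith
  then have 1: "\<bar>?t a - ?t b\<bar> \<le> 4" using pi_less_4 by linarith
  have "majorant_prim \<epsilon> C c a - majorant_prim \<epsilon> C c b = (2 * C * \<epsilon>) * (?t a - ?t b) + c * (a - b)"
    by (simp add: majorant_prim_def algebra_simps)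
  also have "\<bar>\<dots>\<bar> \<le> (2 * C * \<epsilon>) * \<bar>?t a - ?t b\<bar> + c * \<bar>a - b\<bar>"
    using assms by (intro order_trans[OF abs_triangle_ineq]) (auto simp: abs_mult)
  also have "\<dots> \<le> (2 * C * \<epsilon>) * 4 + c * 14"
    using assms 1 by (intro add_mono mult_left_mono) auto
  finally show ?thesis by simp
qed

lemma majorant_ge:
  assumes "\<epsilon> > 0" "C \<ge> 0" "c \<ge> 0"
  shows "c \<le> majorant \<epsilon> C c y" "\<bar>y - 7/2\<bar> \<le> \<epsilon> \<Longrightarrow> C \<le> majorant \<epsilon> C c y"
proof -
  have pos: "1 + ((y - 7/2) / \<epsilon>)\<^sup>2 > 0" by (intro add_pos_nonneg) auto
  then show "c \<le> majorant \<epsilon> C c y" using assms by (simp add: majorant_def)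
  assume "\<bar>y - 7/2\<bar> \<le> \<epsilon>"
  then have "\<bar>(y - 7/2) / \<epsilon>\<bar> \<le> 1" using assms by (simp add: abs_divide)
  then have "((y - 7/2) / \<epsilon>)\<^sup>2 \<le> 1" by (simp add: abs_square_le_1)
  then have "1 \<le> 2 / (1 + ((y - 7/2) / \<epsilon>)\<^sup>2)" using pos by (simp add: field_simps)
  then have "C * 1 \<le> C * (2 / (1 + ((y - 7/2) / \<epsilon>)\<^sup>2))" using assms by (intro mult_left_mono) auto
  then show "C \<le> majorant \<epsilon> C c y" using assms by (simp add: majorant_def)
qed

text \<open>Within the shell the field is at most \<open>A + 1\<close>; off the shell only
  \<open>w\<close> is left, at most 1/10. Together with \<open>coeff \<le> 16\<close> this gives the
  two constants of the majorant.\<close>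

lemma source_bound:
  assumes A: "A \<ge> 0" and \<epsilon>: "\<epsilon> > 0" and w: "\<bar>w z\<bar> \<le> 1/10"
  shows "\<bar>source A \<epsilon> w z\<bar> \<le> majorant \<epsilon> (16 * (A + 1) ^ 7) (16 * (1/10) ^ 7) (snd z)"
proof -
  have *: "\<bar>source A \<epsilon> w z\<bar> \<le> 16 * m ^ 7" if "\<bar>shell A \<epsilon> (snd z) + w z\<bar> \<le> m" for m
  proof -
    have "\<bar>source A \<epsilon> w z\<bar> = coeff z * \<bar>shell A \<epsilon> (snd z) + w z\<bar> ^ 7"
      using coeff_range[of z] by (simp add: source_def abs_mult power_abs)
    also have "\<dots> \<le> 16 * m ^ 7"
      using that coeff_range[of z] by (intro mult_mono power_mono) auto
    finally show ?thesis .
  qed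
  show ?thesis
  proof (cases "\<bar>snd z - 7/2\<bar> \<le> \<epsilon>")
    case True
    have "\<bar>source A \<epsilon> w z\<bar> \<le> 16 * (A + 1) ^ 7"
      using shell_range[OF A, of \<epsilon> "snd z"] w by (intro *) auto
    also have "\<dots> \<le> majorant \<epsilon> (16 * (A + 1) ^ 7) (16 * (1/10) ^ 7) (snd z)"
      by (rule majorant_ge(2)[OF \<epsilon> _ _ True]) (use A in auto)
    finally show ?thesis .
  next
    case False
    have "\<bar>source A \<epsilon> w z\<bar> \<le> 16 * (1/10) ^ 7"
      using shell_zero[OF \<epsilon>, of "snd z"] w False by (intro *) auto
    also have "\<dots> \<le> majorant \<epsilon> (16 * (A + 1) ^ 7) (16 * (1/10) ^ 7) (snd z)"
      by (rule majorant_ge(1)[OF \<epsilon>]) (use A in auto)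
    finally show ?thesis .
  qed
qed

text \<open>The factor 112 is the bound 16 on \<open>coeff\<close> times the 7 from differentiating
  the seventh power.\<close>

lemma source_diff_bound:
  assumes A: "A \<ge> 0" and \<epsilon>: "\<epsilon> > 0" and w: "\<bar>w z\<bar> \<le> 1/10" "\<bar>w' z\<bar> \<le> 1/10" and d: "\<bar>w z - w' z\<bar> \<le> d"
  shows "\<bar>source A \<epsilon> w z - source A \<epsilon> w' z\<bar> \<le> majorant \<epsilon> (d * (112 * (A + 1) ^ 6)) (d * (112 * (1/10) ^ 6)) (snd z)"
proof -
  have d0: "d \<ge> 0" using d by linarith
  have *: "\<bar>source A \<epsilon> w z - source A \<epsilon> w' z\<bar> \<le> d * (112 * m ^ 6)"
    if "\<bar>shell A \<epsilon> (snd z) + w z\<bar> \<le> m" "\<bar>shell A \<epsilon> (snd z) + w' z\<bar> \<le> m" for m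
  proof -
    have "\<bar>source A \<epsilon> w z - source A \<epsilon> w' z\<bar>
        = coeff z * \<bar>(shell A \<epsilon> (snd z) + w z) ^ 7 - (shell A \<epsilon> (snd z) + w' z) ^ 7\<bar>"
      using coeff_range[of z] by (simp add: source_def abs_mult flip: right_diff_distrib)
    also have "\<dots> \<le> 16 * (7 * m ^ 6 * \<bar>(shell A \<epsilon> (snd z) + w z) - (shell A \<epsilon> (snd z) + w' z)\<bar>)"
      using coeff_range[of z] by (intro mult_mono power7_diff that) auto
    also have "\<dots> = 112 * m ^ 6 * \<bar>w z - w' z\<bar>" by simp
    also have "\<dots> \<le> 112 * m ^ 6 * d" using d by (intro mult_left_mono) auto
    finally show ?thesis by (simp add: mult_ac)
  qed
  show ?thesis
  proof (cases "\<bar>snd z - 7/2\<bar> \<le> \<epsilon>")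
    case True
    have "\<bar>source A \<epsilon> w z - source A \<epsilon> w' z\<bar> \<le> d * (112 * (A + 1) ^ 6)"
      using shell_range[OF A, of \<epsilon> "snd z"] w by (intro *) auto
    also have "\<dots> \<le> majorant \<epsilon> (d * (112 * (A + 1) ^ 6)) (d * (112 * (1/10) ^ 6)) (snd z)"
      by (rule majorant_ge(2)[OF \<epsilon> _ _ True]) (use A d0 in auto)
    finally show ?thesis .
  next
    case False
    have "\<bar>source A \<epsilon> w z - source A \<epsilon> w' z\<bar> \<le> d * (112 * (1/10) ^ 6)"
      using shell_zero[OF \<epsilon>, of "snd z"] w False by (intro *) auto
    also have "\<dots> \<le> majorant \<epsilon> (d * (112 * (A + 1) ^ 6)) (d * (112 * (1/10) ^ 6)) (snd z)"
      by (rule majorant_ge(1)[OF \<epsilon>]) (use A d0 in auto)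
    finally show ?thesis .
  qed
qed

text \<open>Contraction for the cut-off Duhamel integral \<open>K\<close> on functions bounded by
  1/10 that vanish where the shell cannot be felt. Building this vanishing into the space encodes
  finite speed of propagation. Smoothness is then bootstrapped from \<open>w = K w\<close>.\<close>

lemma correction_exists:
  assumes A: "A \<ge> 0" and \<epsilon>: "\<epsilon> > 0" "\<epsilon> * (A + 1) ^ 7 \<le> 1/100000"
  obtains w where "Cinf w" "\<And>z. \<bar>w z\<bar> \<le> 1/10"
    "\<And>p q. p \<le> 7/2 - \<epsilon> \<Longrightarrow> q \<le> 7/2 - \<epsilon> \<Longrightarrow> w (p,q) = 0"
    "\<And>p q. p \<ge> 7/2 + \<epsilon> \<Longrightarrow> q \<ge> 7/2 + \<epsilon> \<Longrightarrow> w (p,q) = 0"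
    "\<And>p q. p \<in> {-2..10} \<Longrightarrow> q \<in> {-2..10} \<Longrightarrow> w (p,q) = Duhamel (source A \<epsilon> w) (p,q)"
proof -
  define outer where "outer z \<longleftrightarrow> (fst z \<le> 7/2 - \<epsilon> \<and> snd z \<le> 7/2 - \<epsilon>) \<or> (fst z \<ge> 7/2 + \<epsilon> \<and> snd z \<ge> 7/2 + \<epsilon>)"
    for z :: "real \<times> real"
  define X where "X z = (if outer z then {0} else {-1/10..1/10 :: real})" for z
  define S where "S = PiC UNIV X"
  have S: "w \<in> S \<longleftrightarrow> (\<forall>z. \<bar>apply_bcontfun w z\<bar> \<le> 1/10 \<and> (outer z \<longrightarrow> apply_bcontfun w z = 0))" for w
  proof -
    have "v \<in> X z \<longleftrightarrow> \<bar>v\<bar> \<le> 1/10 \<and> (outer z \<longrightarrow> v = 0)" for v z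
      by (auto simp: X_def)
    then show ?thesis unfolding S_def mem_PiC_iff Pi_iff by simp
  qed
  define K where "K w z = cutoff (fst z) * cutoff (snd z) * Duhamel (source A \<epsilon> w) z" for w z
  \<comment> \<open>Both coordinates lie in (-3, 11), an interval of length 14.\<close>
  have cutoff_support: "\<bar>p - q\<bar> \<le> 14" if "cutoff p \<noteq> 0" "cutoff q \<noteq> 0" for p q
    using that cutoff_0[of p] cutoff_0[of q] by linarith
  have K_le: "\<bar>K w (p,q)\<bar> \<le> c" if "c \<ge> 0" "\<bar>p - q\<bar> \<le> 14 \<Longrightarrow> \<bar>Duhamel (source A \<epsilon> w) (p,q)\<bar> \<le> c" for w p q c
  proof (cases "cutoff p = 0 \<or> cutoff q = 0")
    case False
    have "\<bar>K w (p,q)\<bar> = cutoff p * cutoff q * \<bar>Duhamel (source A \<epsilon> w) (p,q)\<bar>"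
      using cutoff_range by (simp add: K_def abs_mult)
    also have "\<dots> \<le> 1 * c"
      using cutoff_range that cutoff_support[of p q] False by (intro mult_mono mult_le_one) auto
    finally show ?thesis by simp
  qed (use that in \<open>auto simp: K_def\<close>)
  have contw: "continuous_on UNIV (source A \<epsilon> (apply_bcontfun w))" for w
    using Ck_source[of 0 "apply_bcontfun w"] by simp
  have D_le: "\<bar>Duhamel (source A \<epsilon> (apply_bcontfun w)) (p,q)\<bar> \<le> 1/10" if "w \<in> S" "\<bar>p - q\<bar> \<le> 14" for w p q
  proof -
    have "\<bar>Duhamel (source A \<epsilon> (apply_bcontfun w)) (p,q)\<bar> \<le> (8 * (16 * (A + 1) ^ 7) * \<epsilon> + 14 * (16 * (1/10) ^ 7)) * \<bar>p - q\<bar>"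
    proof (rule Duhamel_bound[OF contw])
      show "\<bar>source A \<epsilon> (apply_bcontfun w) (s, y)\<bar> \<le> majorant \<epsilon> (16 * (A + 1) ^ 7) (16 * (1/10) ^ 7) y" for s y
        using source_bound[OF A \<epsilon>(1), of "apply_bcontfun w" "(s,y)"] that S by auto
      show "(majorant_prim \<epsilon> (16 * (A + 1) ^ 7) (16 * (1/10) ^ 7) has_real_derivative
          majorant \<epsilon> (16 * (A + 1) ^ 7) (16 * (1/10) ^ 7) y) (at y)" for y
        by (rule majorant_prim_DERIV[OF \<epsilon>(1)])
      show "\<bar>majorant_prim \<epsilon> (16 * (A + 1) ^ 7) (16 * (1/10) ^ 7) a - majorant_prim \<epsilon> (16 * (A + 1) ^ 7) (16 * (1/10) ^ 7) b\<bar>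
          \<le> 8 * (16 * (A + 1) ^ 7) * \<epsilon> + 14 * (16 * (1/10) ^ 7)"
        if "a \<in> {min p q..max p q}" "b \<in> {min p q..max p q}" for a b
        using that \<open>\<bar>p - q\<bar> \<le> 14\<close> A by (intro majorant_prim_bound \<epsilon>(1)) auto
    qed
    also have "\<dots> \<le> (8 * (16 * (A + 1) ^ 7) * \<epsilon> + 14 * (16 * (1/10) ^ 7)) * 14"
      using that A \<epsilon> by (intro mult_left_mono) auto
    also have "\<dots> = 1792 * (\<epsilon> * (A + 1) ^ 7) + 14 * 14 * 16 * (1/10) ^ 7" by simp
    \<comment> \<open>The threshold 1/100000 leaves room: this sum is below 0.02, and the
      contraction factor computed later is below 0.15.\<close>
    also have "\<dots> \<le> 1792 * (1/100000) + 14 * 14 * 16 * (1/10) ^ 7"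
      using \<epsilon>(2) by (intro add_mono mult_left_mono) auto
    also have "\<dots> \<le> 1/10" by (simp add: eval_nat_numeral)
    finally show ?thesis .
  qed
  have contK: "continuous_on UNIV (K (apply_bcontfun w))" for w
  proof -
    have "Ck 0 (K (apply_bcontfun w))" unfolding K_def[abs_def]
      by (intro Ck_mult Ck_compose_real[OF Ck_cutoff] Ck_fst Ck_snd Ck_Suc_imp[OF Ck_Duhamel] Ck_source) simp
    then show ?thesis by simp
  qed
  have K_bound: "\<bar>K (apply_bcontfun w) z\<bar> \<le> 1/10" if "w \<in> S" for w z
  proof -
    have "\<bar>K (apply_bcontfun w) (fst z, snd z)\<bar> \<le> 1/10"
      by (intro K_le D_le that) auto
    then show ?thesis by simp
  qed
  have K_outer: "K (apply_bcontfun w) z = 0" if "w \<in> S" "outer z" for w z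
  proof -
    obtain p q where z: "z = (p,q)" by (cases z)
    have "\<bar>Duhamel (source A \<epsilon> (apply_bcontfun w)) (p,q)\<bar> \<le> 0 * \<bar>p - q\<bar>"
    proof (rule Duhamel_bound[OF contw])
      show "\<bar>source A \<epsilon> (apply_bcontfun w) (s, y)\<bar> \<le> 0" if "s \<in> {min p q..max p q}" "y \<in> {min p q..max p q}" for s y
      proof -
        \<comment> \<open>The square spanned by \<open>p\<close> and \<open>q\<close> stays in the
          same outer region as \<open>(p,q)\<close>, so the source vanishes on all of it.\<close>
        have "outer (s,y)" "\<bar>y - 7/2\<bar> \<ge> \<epsilon>"
          using that \<open>outer z\<close> by (auto simp: z outer_def)
        then show ?thesis using \<open>w \<in> S\<close> S shell_zero[OF \<epsilon>(1)] by (simp add: source_def)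
      qed
      show "((\<lambda>y. 0) has_real_derivative 0) (at y)" for y by simp
    qed auto
    then show ?thesis by (simp add: K_def z)
  qed
  define T where "T w = Bcontfun (K (apply_bcontfun w))" for w
  have T: "apply_bcontfun (T w) = K (apply_bcontfun w)" if "w \<in> S" for w
    unfolding T_def by (rule Bcontfun_inverse, rule bcontfun_normI[OF contK, where b = "1/10"]) (use K_bound[OF that] in simp)
  have "\<exists>!w\<in>S. T w = w"
  proof (rule Banach_fix[where c = "1/2"])
    show "complete S" unfolding S_def
      by (intro complete_eq_closed[THEN iffD2] closed_PiC) (auto simp: X_def)
    have "0 \<in> S" by (simp add: S)
    then show "S \<noteq> {}" by blast
    show "T ` S \<subseteq> S" using K_bound K_outer T by (auto simp: S)
    fix w w' assume w: "w \<in> S" "w' \<in> S"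
    define d where "d = dist w w'"
    have d: "\<bar>apply_bcontfun w z - apply_bcontfun w' z\<bar> \<le> d" for z
      using dist_bounded[of w z w'] by (simp add: d_def dist_real_def)
    have d0: "d \<ge> 0" by (simp add: d_def)
    have "dist (apply_bcontfun (T w) z) (apply_bcontfun (T w') z) \<le> 1/2 * d" for z
    proof -
      obtain p q where z: "z = (p,q)" by (cases z)
      let ?D = "Duhamel (source A \<epsilon> (apply_bcontfun w)) (p,q) - Duhamel (source A \<epsilon> (apply_bcontfun w')) (p,q)"
      let ?c = "d * (112 * (A + 1) ^ 6)" and ?e = "d * (112 * (1/10) ^ 6)"
      have D: "\<bar>?D\<bar> \<le> 1/2 * d" if "\<bar>p - q\<bar> \<le> 14"
      proof -
        have "\<bar>?D\<bar> \<le> (8 * ?c * \<epsilon> + 14 * ?e) * \<bar>p - q\<bar>"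
        proof (rule Duhamel_diff_bound[OF contw contw])
          show "\<bar>source A \<epsilon> (apply_bcontfun w) (s, y) - source A \<epsilon> (apply_bcontfun w') (s, y)\<bar> \<le> majorant \<epsilon> ?c ?e y" for s y
            using source_diff_bound[OF A \<epsilon>(1), of "apply_bcontfun w" "(s,y)" "apply_bcontfun w'" d] w S d by auto
          show "(majorant_prim \<epsilon> ?c ?e has_real_derivative majorant \<epsilon> ?c ?e y) (at y)" for y
            by (rule majorant_prim_DERIV[OF \<epsilon>(1)])
          show "\<bar>majorant_prim \<epsilon> ?c ?e a - majorant_prim \<epsilon> ?c ?e b\<bar> \<le> 8 * ?c * \<epsilon> + 14 * ?e"
            if "a \<in> {min p q..max p q}" "b \<in> {min p q..max p q}" for a b
            using that \<open>\<bar>p - q\<bar> \<le> 14\<close> A d0 by (intro majorant_prim_bound \<epsilon>(1)) auto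
        qed
        also have "\<dots> \<le> (8 * ?c * \<epsilon> + 14 * ?e) * 14"
          using that A d0 \<epsilon> by (intro mult_left_mono add_nonneg_nonneg mult_nonneg_nonneg) auto
        also have "\<dots> = d * (12544 * (\<epsilon> * (A + 1) ^ 6) + 14 * 14 * 112 * (1/10) ^ 6)" by (simp add: algebra_simps)
        also have "\<dots> \<le> d * (1/2)"
        proof (intro mult_left_mono d0)
          have "(A + 1) ^ 6 \<le> (A + 1) ^ 7" using A by (intro power_increasing) auto
          then have "\<epsilon> * (A + 1) ^ 6 \<le> \<epsilon> * (A + 1) ^ 7"
            using \<epsilon>(1) by (intro mult_left_mono) auto
          then have "\<epsilon> * (A + 1) ^ 6 \<le> 1/100000" using \<epsilon>(2) by linarith
          then have "12544 * (\<epsilon> * (A + 1) ^ 6) + 14 * 14 * 112 * (1/10) ^ 6 \<le> 12544 * (1/100000) + 14 * 14 * 112 * (1/10::real) ^ 6"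
            by (intro add_mono mult_left_mono) auto
          also have "\<dots> \<le> 1/2" by (simp add: eval_nat_numeral)
          finally show "12544 * (\<epsilon> * (A + 1) ^ 6) + 14 * 14 * 112 * (1/10) ^ 6 \<le> 1/2" .
        qed
        finally show ?thesis by simp
      qed
      have "dist (apply_bcontfun (T w) z) (apply_bcontfun (T w') z) = cutoff p * cutoff q * \<bar>?D\<bar>"
        using cutoff_range by (simp add: T w K_def z dist_real_def abs_mult flip: right_diff_distrib)
      also have "\<dots> \<le> 1/2 * d"
      proof (cases "cutoff p = 0 \<or> cutoff q = 0")
        case False
        then have "cutoff p * cutoff q * \<bar>?D\<bar> \<le> 1 * (1/2 * d)"
          using cutoff_range D cutoff_support[of p q] by (intro mult_mono mult_le_one) auto
        then show ?thesis by simp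
      qed (use d0 in auto)
      finally show ?thesis .
    qed
    then show "dist (T w) (T w') \<le> 1/2 * dist w w'"
      unfolding d_def by (rule dist_bound)
  qed auto
  then obtain wb where wb: "wb \<in> S" "T wb = wb" by blast
  define w where "w = apply_bcontfun wb"
  have wK: "w = K w" using T[OF wb(1)] wb(2) by (simp add: w_def)
  have "Ck n w" for n
  proof (induction n)
    case 0
    show ?case by (simp add: w_def)
  next
    case (Suc n)
    then have "Ck (Suc n) (K w)" unfolding K_def[abs_def]
      by (intro Ck_mult Ck_compose_real[OF Ck_cutoff] Ck_fst Ck_snd Ck_Duhamel Ck_source)
    then show ?case using wK by simp
  qed
  then have "Cinf w" by (simp add: Cinf_def)
  moreover have "\<bar>w z\<bar> \<le> 1/10" "outer z \<Longrightarrow> w z = 0" for z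
    using S[THEN iffD1, OF wb(1), rule_format, of z] unfolding w_def by blast+
  moreover have "w (p,q) = Duhamel (source A \<epsilon> w) (p,q)" if "p \<in> {-2..10}" "q \<in> {-2..10}" for p q
    using that by (subst wK) (simp add: K_def cutoff_1)
  ultimately show ?thesis
    by (intro that[of w]) (auto simp: outer_def)
qed

subsection \<open>The radial solution\<close>

lemma Cinf_real_derivative:
  fixes f :: "real \<Rightarrow> real"
  assumes "Cinf f"
  obtains f' where "Cinf f'" "\<And>x. (f has_field_derivative f' x) (at x)"
proof (rule that)
  show "Cinf (\<lambda>x. frechet_derivative f (at x) 1)" by (rule Cinf_derivative[OF assms])
  show "(f has_field_derivative frechet_derivative f (at x) 1) (at x)" for x
  proof -
    have d: "(f has_derivative frechet_derivative f (at x)) (at x)" by (rule Cinf_has_derivative[OF assms])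
    interpret bounded_linear "frechet_derivative f (at x)" using d by (rule has_derivative_bounded_linear)
    have "frechet_derivative f (at x) = (*) (frechet_derivative f (at x) 1)"
    proof
      show "frechet_derivative f (at x) v = frechet_derivative f (at x) 1 * v" for v
        using scaleR[of v 1] by simp
    qed
    with d show ?thesis by (simp add: has_field_derivative_def)
  qed
qed

definition pd1 :: "(real \<times> real \<Rightarrow> real) \<Rightarrow> real \<times> real \<Rightarrow> real" where
  "pd1 f z = frechet_derivative f (at z) (1, 0)"

definition pd2 :: "(real \<times> real \<Rightarrow> real) \<Rightarrow> real \<times> real \<Rightarrow> real" where
  "pd2 f z = frechet_derivative f (at z) (0, 1)"

lemma Cinf_pd: "Cinf f \<Longrightarrow> Cinf (pd1 f)" "Cinf f \<Longrightarrow> Cinf (pd2 f)"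
  unfolding pd1_def[abs_def] pd2_def[abs_def] by (auto intro: Cinf_derivative)

lemma has_derivative_pd:
  assumes "Cinf f"
  shows "(f has_derivative (\<lambda>v. pd1 f z * fst v + pd2 f z * snd v)) (at z)"
proof -
  have d: "(f has_derivative frechet_derivative f (at z)) (at z)" by (rule Cinf_has_derivative[OF assms])
  interpret bounded_linear "frechet_derivative f (at z)" using d by (rule has_derivative_bounded_linear)
  have "frechet_derivative f (at z) = (\<lambda>v. pd1 f z * fst v + pd2 f z * snd v)"
  proof
    fix v :: "real \<times> real"
    have "v = fst v *\<^sub>R (1, 0) + snd v *\<^sub>R (0, 1)" by (cases v) simp
    then have "frechet_derivative f (at z) v = frechet_derivative f (at z) (fst v *\<^sub>R (1, 0) + snd v *\<^sub>R (0, 1))" by simp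
    also have "\<dots> = fst v * pd1 f z + snd v * pd2 f z"
      unfolding add scaleR by (simp add: pd1_def pd2_def)
    finally show "frechet_derivative f (at z) v = pd1 f z * fst v + pd2 f z * snd v" by (simp add: mult.commute)
  qed
  with d show ?thesis by simp
qed

lemma pd_chain:
  assumes "Cinf f" "(g has_field_derivative g') (at s)" "(h has_field_derivative h') (at s)"
  shows "((\<lambda>s. f (g s, h s)) has_field_derivative (pd1 f (g s, h s) * g' + pd2 f (g s, h s) * h')) (at s)"
proof -
  have "((\<lambda>s. (g s, h s)) has_derivative (\<lambda>v. (g' * v, h' * v))) (at s)"
    using assms(2,3) by (intro has_derivative_Pair) (auto simp: has_field_derivative_def)
  from has_derivative_compose[OF this has_derivative_pd[OF assms(1)]]
  have "((\<lambda>s. f (g s, h s)) has_derivative (\<lambda>v. pd1 f (g s, h s) * (g' * v) + pd2 f (g s, h s) * (h' * v))) (at s)"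
    by simp
  moreover have "(\<lambda>v. pd1 f (g s, h s) * (g' * v) + pd2 f (g s, h s) * (h' * v)) = (*) (pd1 f (g s, h s) * g' + pd2 f (g s, h s) * h')"
    by (auto simp: algebra_simps)
  ultimately show ?thesis by (simp only: has_field_derivative_def)
qed

lemma pd_eq:
  assumes "Cinf f"
  shows "((\<lambda>p. f (p,q)) has_field_derivative c) (at p) \<Longrightarrow> pd1 f (p,q) = c"
    and "((\<lambda>q. f (p,q)) has_field_derivative c) (at q) \<Longrightarrow> pd2 f (p,q) = c"
  using pd_chain[OF assms DERIV_ident DERIV_const, of q p] pd_chain[OF assms DERIV_const DERIV_ident, of p q]
  by (auto dest: DERIV_unique)

lemma pd_zero:
  assumes "Cinf f" "open W" "\<And>z. z \<in> W \<Longrightarrow> f z = 0" "z \<in> W"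
  shows "pd1 f z = 0" "pd2 f z = 0"
proof -
  have "((\<lambda>z. 0) has_derivative (\<lambda>v. pd1 f z * fst v + pd2 f z * snd v)) (at z)"
    by (rule has_derivative_transform_within_open[OF has_derivative_pd[OF assms(1)] assms(2,4)]) (use assms(3) in auto)
  then have "(\<lambda>v. pd1 f z * fst v + pd2 f z * snd v) = (\<lambda>v. 0)"
    by (rule has_derivative_unique) (rule has_derivative_const)
  from fun_cong[OF this, of "(1,0)"] fun_cong[OF this, of "(0,1)"]
  show "pd1 f z = 0" "pd2 f z = 0" by auto
qed

text \<open>Agreement on an open set passes to first derivatives there and then to the second. It
  allows one function to be differentiated twice in two representations: through \<open>Y\<close>
  and through characteristic coordinates.\<close>

lemma second_derivative_unique:
  fixes f g :: "real \<Rightarrow> real"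
  assumes T: "open T" "x \<in> T" and eq: "\<And>y. y \<in> T \<Longrightarrow> f y = g y"
    and f: "\<And>y. (f has_field_derivative f' y) (at y)" "(f' has_field_derivative f'') (at x)"
    and g: "\<And>y. (g has_field_derivative g' y) (at y)" "(g' has_field_derivative g'') (at x)"
  shows "f'' = g''"
proof -
  have "f' y = g' y" if "y \<in> T" for y
  proof -
    have "(g has_field_derivative f' y) (at y)"
      by (rule has_field_derivative_transform_within_open[OF f(1) T(1) that]) (rule eq)
    then show ?thesis using g(1) DERIV_unique by blast
  qed
  then have "(g' has_field_derivative f'') (at x)"
    by (intro has_field_derivative_transform_within_open[OF f(2) T]) auto
  then show ?thesis using g(2) DERIV_unique by blast
qed

section \<open>Radial functions as smooth functions of t and |x|^2\<close>

lemma Ck_inner_self: "Ck n (\<lambda>x :: 'a::euclidean_space. x \<bullet> x)"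
proof -
  have "Ck n (\<lambda>x :: 'a. \<Sum>b\<in>Basis. (x \<bullet> b) ^ 2)"
    by (intro Ck_sum Ck_power Ck_linear bounded_linear_inner_left)
  then show ?thesis by (simp add: norm_Basis_sum[symmetric] power2_norm_eq_inner)
qed

lemma Cinf_radial:
  fixes Y :: "real \<times> real \<Rightarrow> real"
  assumes "Cinf Y" shows "Cinf (\<lambda>z :: real \<times> 'a::euclidean_space. Y (fst z, snd z \<bullet> snd z))"
proof (rule CinfI)
  fix n
  have "Ck n (\<lambda>z :: real \<times> 'a. snd z \<bullet> snd z)"
    by (rule Ck_compose[OF Ck_inner_self])
      (intro Ck_linear bounded_linear_compose[OF bounded_linear_inner_left bounded_linear_snd])
  then show "Ck n (\<lambda>z :: real \<times> 'a. Y (fst z, snd z \<bullet> snd z))"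
    by (rule Ck_compose_pair[OF CinfD[OF assms] Ck_linear[OF bounded_linear_fst]])
qed

lemma Cinf_radial_slice:
  fixes Y :: "real \<times> real \<Rightarrow> real"
  assumes "Cinf Y" shows "Cinf (\<lambda>x :: 'a::euclidean_space. Y (t, x \<bullet> x))"
  by (rule CinfI) (rule Ck_compose_pair[OF CinfD[OF assms] Ck_const Ck_inner_self])

lemma radial_has_derivative:
  assumes "Cinf Y"
  shows "((\<lambda>z :: real \<times> 'a::euclidean_space. Y (fst z, snd z \<bullet> snd z)) has_derivative
    (\<lambda>v. pd1 Y (fst z, snd z \<bullet> snd z) * fst v + pd2 Y (fst z, snd z \<bullet> snd z) * (2 * (snd z \<bullet> snd v)))) (at z)"
proof -
  have "((\<lambda>z :: real \<times> 'a. (fst z, snd z \<bullet> snd z)) has_derivative (\<lambda>v. (fst v, 2 * (snd z \<bullet> snd v)))) (at z)"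
    by (auto intro!: derivative_eq_intros simp: inner_commute)
  from has_derivative_compose[OF this has_derivative_pd[OF assms]]
  show ?thesis by simp
qed

lemma dd_radial:
  fixes e :: "'a::euclidean_space"
  assumes Y: "Cinf Y"
  defines "U \<equiv> \<lambda>z :: real \<times> 'a. Y (fst z, snd z \<bullet> snd z)"
  shows "dd UNIV [(1, 0)] U (t, x) = pd1 Y (t, x \<bullet> x)"
    and "dd UNIV [(1, 0), (1, 0)] U (t, x) = pd1 (pd1 Y) (t, x \<bullet> x)"
    and "dd UNIV [(0, e), (0, e)] U (t, x)
      = 2 * (e \<bullet> e) * pd2 Y (t, x \<bullet> x) + 4 * (x \<bullet> e)\<^sup>2 * pd2 (pd2 Y) (t, x \<bullet> x)"
proof -
  have U': "frechet_derivative U (at z) = (\<lambda>v. pd1 Y (fst z, snd z \<bullet> snd z) * fst v + pd2 Y (fst z, snd z \<bullet> snd z) * (2 * (snd z \<bullet> snd v)))" for z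
    unfolding U_def by (rule frechet_derivative_at[symmetric]) (rule radial_has_derivative[OF Y])
  have 1: "dd UNIV [(1, 0)] U = (\<lambda>z. pd1 Y (fst z, snd z \<bullet> snd z))"
    by (simp add: U')
  then show "dd UNIV [(1, 0)] U (t, x) = pd1 Y (t, x \<bullet> x)" by simp
  have "frechet_derivative (\<lambda>z :: real \<times> 'a. pd1 Y (fst z, snd z \<bullet> snd z)) (at (t, x)) (1, 0) = pd1 (pd1 Y) (t, x \<bullet> x)"
    using frechet_derivative_at[OF radial_has_derivative[OF Cinf_pd(1)[OF Y]], of "(t,x)", symmetric] by simp
  then show "dd UNIV [(1, 0), (1, 0)] U (t, x) = pd1 (pd1 Y) (t, x \<bullet> x)"
    using 1 by simp
  have 2: "dd UNIV [(0, e)] U = (\<lambda>z. 2 * (snd z \<bullet> e) * pd2 Y (fst z, snd z \<bullet> snd z))"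
    by (simp add: U' mult_ac)
  have "((\<lambda>z :: real \<times> 'a. 2 * (snd z \<bullet> e) * pd2 Y (fst z, snd z \<bullet> snd z)) has_derivative
     (\<lambda>v. 2 * (snd (t,x) \<bullet> e) * (pd1 (pd2 Y) (fst (t,x), snd (t,x) \<bullet> snd (t,x)) * fst v + pd2 (pd2 Y) (fst (t,x), snd (t,x) \<bullet> snd (t,x)) * (2 * (snd (t,x) \<bullet> snd v)))
       + 2 * (snd v \<bullet> e) * pd2 Y (fst (t,x), snd (t,x) \<bullet> snd (t,x)))) (at (t,x))"
    by (rule has_derivative_mult[OF _ radial_has_derivative[OF Cinf_pd(2)[OF Y]]])
      (auto intro!: derivative_eq_intros)
  from frechet_derivative_at[OF this, symmetric]
  have "frechet_derivative (\<lambda>z :: real \<times> 'a. 2 * (snd z \<bullet> e) * pd2 Y (fst z, snd z \<bullet> snd z)) (at (t, x)) (0, e)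
     = 2 * (e \<bullet> e) * pd2 Y (t, x \<bullet> x) + 4 * (x \<bullet> e)\<^sup>2 * pd2 (pd2 Y) (t, x \<bullet> x)"
    by (simp add: power2_eq_square)
  then show "dd UNIV [(0, e), (0, e)] U (t, x)
      = 2 * (e \<bullet> e) * pd2 Y (t, x \<bullet> x) + 4 * (x \<bullet> e)\<^sup>2 * pd2 (pd2 Y) (t, x \<bullet> x)"
    using 2 by simp
qed

text \<open>In the time direction the step must point into the slab: forward from the first half,
  backward from the second. Hence the step size is at most T / 2.\<close>

lemma slab_accessible:
  fixes x i :: "real \<times> 'a::euclidean_space"
  assumes "T > 0" "x \<in> {0..T} \<times> UNIV" "i \<in> Basis" "e > 0"
  shows "\<exists>d. 0 < \<bar>d\<bar> \<and> \<bar>d\<bar> < e \<and> x + d *\<^sub>R i \<in> {0..T} \<times> UNIV"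
proof -
  define m where "m = min (e / 2) (T / 2)"
  define d where "d = (if fst x \<le> T / 2 then m else - m)"
  have m: "0 < m" "m < e" "m \<le> T / 2" using assms by (auto simp: m_def)
  have "fst i = 0 \<or> fst i = 1" using assms(3) by (auto simp: Basis_prod_def)
  then have "x + d *\<^sub>R i \<in> {0..T} \<times> UNIV"
    using m assms(2) by (cases x; cases i) (auto simp: d_def)
  moreover have "0 < \<bar>d\<bar>" "\<bar>d\<bar> < e" using m by (auto simp: d_def)
  ultimately show ?thesis by (intro exI[of _ d] conjI)
qed

text \<open>For u(t,x) = Y(t, |x|^2) in three dimensions the Laplacian is 6 Y_rho + 4 rho Y_rhorho,
  each coordinate contributing 2 to the 6. The variable rho = |x|^2 is smooth at the origin, where
  |x| is not.\<close>

lemma nlw_solution_radial: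
  assumes Y: "Cinf Y" and T: "T > 0"
    and eq: "\<And>t \<rho>. 0 \<le> t \<Longrightarrow> t \<le> T \<Longrightarrow> \<rho> \<ge> 0 \<Longrightarrow>
      pd1 (pd1 Y) (t,\<rho>) - (6 * pd2 Y (t,\<rho>) + 4 * \<rho> * pd2 (pd2 Y) (t,\<rho>)) + Y (t,\<rho>) ^ 7 = 0"
  shows "nlw_solution T (\<lambda>x. Y (0, x \<bullet> x)) (\<lambda>x. pd1 Y (0, x \<bullet> x)) (\<lambda>t x. Y (t, x \<bullet> x))"
proof -
  let ?S = "{0..T} \<times> (UNIV :: (real^3) set)" and ?U = "\<lambda>(t, x :: real^3). Y (t, x \<bullet> x)"
  have U: "?U = (\<lambda>z. Y (fst z, snd z \<bullet> snd z))" by auto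
  have CU: "Cinf ?U" unfolding U by (rule Cinf_radial[OF Y])
  have dd: "dd ?S vs ?U z = dd UNIV vs ?U z" if "z \<in> ?S" for vs z
    using dd_within(1)[OF CU slab_accessible[OF T]] that by blast
  have "smooth_on ?S ?U" by (rule smooth_onI[OF CU slab_accessible[OF T]])
  moreover have "dd ?S [(1, 0), (1, 0)] ?U (t, x) - (\<Sum>i\<in>UNIV. dd ?S [(0, axis i 1), (0, axis i 1)] ?U (t, x)) + Y (t, x \<bullet> x) ^ 7 = 0"
    if "0 \<le> t" "t \<le> T" for t x
  proof -
    have S: "(t, x) \<in> ?S" using that by auto
    have "dd ?S [(0, axis i 1), (0, axis i 1)] ?U (t, x) = 2 * pd2 Y (t, x \<bullet> x) + 4 * (x $ i)\<^sup>2 * pd2 (pd2 Y) (t, x \<bullet> x)" for i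
    proof -
      have "dd ?S [(0, axis i 1), (0, axis i 1)] ?U (t, x) = dd UNIV [(0, axis i 1), (0, axis i 1)] ?U (t, x)"
        by (rule dd[OF S])
      also have "\<dots> = 2 * ((axis i 1 :: real^3) \<bullet> axis i 1) * pd2 Y (t, x \<bullet> x) + 4 * (x \<bullet> axis i 1)\<^sup>2 * pd2 (pd2 Y) (t, x \<bullet> x)"
        unfolding U by (rule dd_radial(3)[OF Y])
      finally show ?thesis by (simp add: inner_axis_axis inner_axis)
    qed
    then have "(\<Sum>i\<in>UNIV. dd ?S [(0, axis i 1), (0, axis i 1)] ?U (t, x))
       = (\<Sum>i\<in>UNIV. 2 * pd2 Y (t, x \<bullet> x) + 4 * (x $ i)\<^sup>2 * pd2 (pd2 Y) (t, x \<bullet> x))"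
      by (simp only:)
    also have "\<dots> = 6 * pd2 Y (t, x \<bullet> x) + 4 * (x \<bullet> x) * pd2 (pd2 Y) (t, x \<bullet> x)"
      by (simp add: sum.distrib inner_vec_def power2_eq_square flip: sum_distrib_left sum_distrib_right)
    finally have lap: "(\<Sum>i\<in>UNIV. dd ?S [(0, axis i 1), (0, axis i 1)] ?U (t, x))
       = 6 * pd2 Y (t, x \<bullet> x) + 4 * (x \<bullet> x) * pd2 (pd2 Y) (t, x \<bullet> x)" .
    have "dd ?S [(1, 0), (1, 0)] ?U (t, x) = dd UNIV [(1, 0), (1, 0)] ?U (t, x)"
      by (rule dd[OF S])
    also have "\<dots> = pd1 (pd1 Y) (t, x \<bullet> x)"
      unfolding U by (rule dd_radial(2)[OF Y])
    finally have "dd ?S [(1, 0), (1, 0)] ?U (t, x) = pd1 (pd1 Y) (t, x \<bullet> x)" .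
    then show ?thesis unfolding lap using eq[OF that, of "x \<bullet> x"] by simp
  qed
  moreover have "dd ?S [(1, 0)] ?U (0, x) = pd1 Y (0, x \<bullet> x)" for x
  proof -
    have S: "(0, x) \<in> ?S" using T by auto
    have "dd ?S [(1, 0)] ?U (0, x) = dd UNIV [(1, 0)] ?U (0, x)" by (rule dd[OF S])
    also have "\<dots> = pd1 Y (0, x \<bullet> x)" unfolding U by (rule dd_radial(1)[OF Y])
    finally show ?thesis .
  qed
  ultimately show ?thesis unfolding nlw_solution_def Let_def by blast
qed

section \<open>The shell solution and its equation\<close>

locale thin_shell =
  fixes A \<epsilon> :: real and w :: "real \<times> real \<Rightarrow> real"
  assumes A: "A \<ge> 10" and \<epsilon>: "\<epsilon> > 0" "\<epsilon> \<le> 1/100"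
    and Cinf_w: "Cinf w" and w_le: "\<And>z. \<bar>w z\<bar> \<le> 1/10"
    and w_left: "\<And>p q. p \<le> 7/2 - \<epsilon> \<Longrightarrow> q \<le> 7/2 - \<epsilon> \<Longrightarrow> w (p,q) = 0"
    and w_right: "\<And>p q. p \<ge> 7/2 + \<epsilon> \<Longrightarrow> q \<ge> 7/2 + \<epsilon> \<Longrightarrow> w (p,q) = 0"
    and w_eq: "\<And>p q. p \<in> {-2..10} \<Longrightarrow> q \<in> {-2..10} \<Longrightarrow> w (p,q) = Duhamel (source A \<epsilon> w) (p,q)"
begin

definition V :: "real \<Rightarrow> real \<Rightarrow> real" where
  "V t r = shell A \<epsilon> (r - t) + w (r + t, r - t)"

text \<open>This is V / r in the variable rho = |x|^2. The radius \<open>sqrt (sigma rho)\<close> is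
  |x| as soon as |x| is at least 1; closer to the origin V vanishes during the times considered, so
  the altered radius does no harm.\<close>

definition Y :: "real \<times> real \<Rightarrow> real" where
  "Y z = V (fst z) (sqrt (sigma (snd z))) * inverse (sqrt (sigma (snd z)))"

lemma sqrt_sigma_pos: "sqrt (sigma \<rho>) > 0"
  using sigma_ge[of \<rho>] by simp

lemma Cinf_Y: "Cinf Y"
proof (rule CinfI)
  fix n
  have s: "Ck n (\<lambda>z :: real \<times> real. sqrt (sigma (snd z)))"
    by (rule Ck_sqrt[OF Ck_compose_real[OF Ck_sigma Ck_snd]]) (rule less_le_trans[OF _ sigma_ge], simp)
  have n0: "sqrt (sigma \<rho>) \<noteq> 0" for \<rho> using sqrt_sigma_pos[of \<rho>] by linarith
  show "Ck n Y" unfolding Y_def[abs_def] V_def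
    by (intro Ck_mult Ck_inverse s n0 Ck_add Ck_compose_real[OF Ck_shell] Ck_diff Ck_fst Ck_compose_pair[OF CinfD[OF Cinf_w]])
qed

lemma Y_outer: "r \<ge> 1 \<Longrightarrow> Y (t, r\<^sup>2) = V t r / r"
  by (simp add: Y_def sigma_eq divide_inverse)

text \<open>Both characteristic coordinates r + t and r - t fall on the same side of the shell,
  where \<open>shell\<close> and \<open>w\<close> vanish.\<close>

lemma V_zero:
  "r \<le> 7/2 - \<epsilon> - \<bar>t\<bar> \<Longrightarrow> V t r = 0" "r \<ge> 7/2 + \<epsilon> + \<bar>t\<bar> \<Longrightarrow> V t r = 0"
proof -
  assume "r \<le> 7/2 - \<epsilon> - \<bar>t\<bar>"
  then have "r - t \<le> 7/2 - \<epsilon>" "r + t \<le> 7/2 - \<epsilon>" by auto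
  then show "V t r = 0" using w_left shell_zero[OF \<epsilon>(1), of "r - t"] by (simp add: V_def)
next
  assume "r \<ge> 7/2 + \<epsilon> + \<bar>t\<bar>"
  then have "r - t \<ge> 7/2 + \<epsilon>" "r + t \<ge> 7/2 + \<epsilon>" by auto
  then show "V t r = 0" using w_right shell_zero[OF \<epsilon>(1), of "r - t"] by (simp add: V_def)
qed

text \<open>Numerically, sqrt 2 < 1.43 < 7/2 - 1/100 - 41/20. The time bound 41/20 exceeds 2, so the
  vanishing holds on open sets around the times in [0, 2] and passes to derivatives.\<close>

lemma Y_zero:
  "\<rho> < 2 \<Longrightarrow> \<bar>t\<bar> < 41/20 \<Longrightarrow> Y (t,\<rho>) = 0"
  "\<rho> \<ge> r\<^sup>2 \<Longrightarrow> r \<ge> 1 \<Longrightarrow> r \<ge> 7/2 + \<epsilon> + \<bar>t\<bar> \<Longrightarrow> Y (t,\<rho>) = 0"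
proof -
  assume "\<rho> < 2" "\<bar>t\<bar> < 41/20"
  have "sigma \<rho> \<le> 2" using \<open>\<rho> < 2\<close> sigma_le[of \<rho>] sigma_eq[of \<rho>] by linarith
  then have "sqrt (sigma \<rho>) \<le> sqrt ((143/100)\<^sup>2)" by (intro real_sqrt_le_mono) (simp add: power2_eq_square)
  then have "sqrt (sigma \<rho>) \<le> 143/100" by simp
  then have "V t (sqrt (sigma \<rho>)) = 0" using \<open>\<bar>t\<bar> < 41/20\<close> \<epsilon> by (intro V_zero(1)) linarith
  then show "Y (t,\<rho>) = 0" by (simp add: Y_def)
next
  assume r: "\<rho> \<ge> r\<^sup>2" "r \<ge> 1" "r \<ge> 7/2 + \<epsilon> + \<bar>t\<bar>"
  then have "\<rho> \<ge> 1" using one_le_power[of r 2] by linarith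
  then have "sqrt (sigma \<rho>) \<ge> r" using r by (simp add: sigma_eq real_le_rsqrt)
  then have "V t (sqrt (sigma \<rho>)) = 0" using r by (intro V_zero(2)) linarith
  then show "Y (t,\<rho>) = 0" by (simp add: Y_def)
qed

lemma pd_Y_zero:
  assumes "open W" "\<And>z. z \<in> W \<Longrightarrow> Y z = 0" "z \<in> W"
  shows "pd1 Y z = 0" "pd2 Y z = 0" "pd1 (pd1 Y) z = 0" "pd2 (pd2 Y) z = 0"
proof -
  have 1: "pd1 Y z = 0" "pd2 Y z = 0" if "z \<in> W" for z
    using pd_zero[OF Cinf_Y assms(1,2) that] by auto
  then show "pd1 Y z = 0" "pd2 Y z = 0" using assms(3) by auto
  show "pd1 (pd1 Y) z = 0" by (rule pd_zero(1)[OF Cinf_pd(1)[OF Cinf_Y] assms(1) _ assms(3)]) (rule 1)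
  show "pd2 (pd2 Y) z = 0" by (rule pd_zero(2)[OF Cinf_pd(2)[OF Cinf_Y] assms(1) _ assms(3)]) (rule 1)
qed

text \<open>Near the given point r Y(t, r^2) equals F(r - t) + W(r + t, r - t), with F the shell
  profile and W the Duhamel integral. Differentiating twice in t and twice in r, everything cancels
  in the difference except -4 W_pq, and W_pq is the source.\<close>

lemma V_wave:
  assumes r: "1 < r" "r < 7" and t: "0 \<le> t" "t \<le> 2"
  shows "r * (pd1 (pd1 Y) (t,r\<^sup>2) - (6 * pd2 Y (t,r\<^sup>2) + 4 * r\<^sup>2 * pd2 (pd2 Y) (t,r\<^sup>2)))
    = - 4 * source A \<epsilon> w (r + t, r - t)"
proof -
  define N where "N = source A \<epsilon> w"
  define W where "W = Duhamel N"
  define Wp where "Wp z = prim N z - prim N (fst z, fst z)" for z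
  define Wq where "Wq z = primB N z - primB N (snd z, snd z)" for z
  have CN: "Ck n N" for n unfolding N_def by (rule Ck_source[OF CinfD[OF Cinf_w]])
  have contN: "continuous_on UNIV N" using CN[of 0] by simp
  have CW: "Cinf W" by (rule CinfI) (use Ck_Suc_imp[OF Ck_Duhamel[OF CN]] in \<open>simp add: W_def\<close>)
  have CWp: "Cinf Wp" unfolding Wp_def[abs_def]
    by (intro CinfI Ck_diff Ck_prim CN Ck_compose_pair[OF Ck_prim[OF CN]] Ck_fst)
  have CWq: "Cinf Wq" unfolding Wq_def[abs_def]
    by (intro CinfI Ck_diff Ck_primB CN Ck_compose_pair[OF Ck_primB[OF CN]] Ck_snd)
  have pdW: "pd1 W z = Wp z" "pd2 W z = Wq z" for z
    using pd_eq(1)[OF CW, of "snd z" _ "fst z"] pd_eq(2)[OF CW, of "fst z" _ "snd z"]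
      Duhamel_fst[OF contN, of "snd z" "fst z"] Duhamel_snd[OF contN, of "fst z" "snd z"]
    by (auto simp: W_def Wp_def Wq_def)
  have mixed: "pd2 Wp z = N z" "pd1 Wq z = N z" for z
  proof -
    have "((\<lambda>q. Wp (fst z,q)) has_field_derivative N (fst z, snd z) - 0) (at (snd z))"
      unfolding Wp_def fst_conv by (intro DERIV_diff prim_snd contN DERIV_const)
    then show "pd2 Wp z = N z" using pd_eq(2)[OF CWp, of "fst z" _ "snd z"] by simp
    have "((\<lambda>p. Wq (p,snd z)) has_field_derivative N (fst z, snd z) - 0) (at (fst z))"
      unfolding Wq_def snd_conv by (intro DERIV_diff primB_fst contN DERIV_const)
    then show "pd1 Wq z = N z" using pd_eq(1)[OF CWq, of "snd z" _ "fst z"] by simp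
  qed
  have "Cinf (shell A \<epsilon>)" by (rule CinfI) (rule Ck_shell)
  then obtain F' where F': "Cinf F'" "\<And>x. (shell A \<epsilon> has_field_derivative F' x) (at x)"
    by (rule Cinf_real_derivative) (rule that)
  obtain F'' where F'': "\<And>x. (F' has_field_derivative F'' x) (at x)"
    using F'(1) by (rule Cinf_real_derivative) (rule that)
  define G where "G t r = shell A \<epsilon> (r - t) + W (r + t, r - t)" for t r
  \<comment> \<open>The ranges are open and keep both characteristic coordinates in [-2, 10], where
    \<open>w\<close> is the Duhamel integral of its own source.\<close>
  have eq: "r * Y (t, r\<^sup>2) = G t r" if "1 < r" "r < 7" "- 1/2 < t" "t < 5/2" for t r
    using that Y_outer[of r t] w_eq[of "r + t" "r - t"] by (simp add: V_def G_def W_def N_def)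
  let ?p = "r + t" and ?q = "r - t"
  have "r * pd1 (pd1 Y) (t, r\<^sup>2) = F'' ?q + pd1 Wp (?p,?q) + pd2 Wq (?p,?q) - 2 * N (?p,?q)"
  proof (rule second_derivative_unique[where T = "{-1/2<..<5/2}" and x = t])
    show "r * Y (t, r\<^sup>2) = G t r" if "t \<in> {-1/2<..<5/2}" for t using that r eq by auto
    show "((\<lambda>t. r * Y (t, r\<^sup>2)) has_field_derivative r * pd1 Y (t, r\<^sup>2)) (at t)" for t
      using DERIV_cmult[OF pd_chain[OF Cinf_Y DERIV_ident DERIV_const]] by simp
    show "((\<lambda>t. r * pd1 Y (t, r\<^sup>2)) has_field_derivative r * pd1 (pd1 Y) (t, r\<^sup>2)) (at t)"
      using DERIV_cmult[OF pd_chain[OF Cinf_pd(1)[OF Cinf_Y] DERIV_ident DERIV_const]] by simp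
    have l: "((\<lambda>t. r + t) has_field_derivative 1) (at t)" "((\<lambda>t. r - t) has_field_derivative - 1) (at t)" for t
      by (auto intro!: derivative_eq_intros)
    show "((\<lambda>t. G t r) has_field_derivative - F' (r - t) + Wp (r + t, r - t) - Wq (r + t, r - t)) (at t)" for t
      using DERIV_add[OF DERIV_chain2[OF F'(2) l(2)] pd_chain[OF CW l(1) l(2)], of t] pdW
      unfolding G_def by (simp add: algebra_simps)
    show "((\<lambda>t. - F' (r - t) + Wp (r + t, r - t) - Wq (r + t, r - t)) has_field_derivative
       F'' ?q + pd1 Wp (?p,?q) + pd2 Wq (?p,?q) - 2 * N (?p,?q)) (at t)"
      using DERIV_diff[OF DERIV_add[OF DERIV_minus[OF DERIV_chain2[OF F'' l(2)]] pd_chain[OF CWp l(1) l(2)]] pd_chain[OF CWq l(1) l(2)], of t] mixed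
      by (simp add: algebra_simps)
  qed (use t in auto)
  moreover have "6 * r * pd2 Y (t, r\<^sup>2) + 4 * r ^ 3 * pd2 (pd2 Y) (t, r\<^sup>2) = F'' ?q + pd1 Wp (?p,?q) + pd2 Wq (?p,?q) + 2 * N (?p,?q)"
  proof (rule second_derivative_unique[where T = "{1<..<7}" and x = r])
    show "r * Y (t, r\<^sup>2) = G t r" if "r \<in> {1<..<7}" for r using that t eq by auto
    have sq: "((\<lambda>r. r\<^sup>2) has_field_derivative 2 * r) (at r)" for r :: real
      by (auto intro!: derivative_eq_intros)
    show "((\<lambda>r. r * Y (t, r\<^sup>2)) has_field_derivative (Y (t, r\<^sup>2) + 2 * r\<^sup>2 * pd2 Y (t, r\<^sup>2))) (at r)" for r
      using DERIV_mult[OF DERIV_ident pd_chain[OF Cinf_Y DERIV_const sq], of t r]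
      by (simp add: power2_eq_square algebra_simps)
    show "((\<lambda>r. Y (t, r\<^sup>2) + 2 * r\<^sup>2 * pd2 Y (t, r\<^sup>2)) has_field_derivative
        6 * r * pd2 Y (t, r\<^sup>2) + 4 * r ^ 3 * pd2 (pd2 Y) (t, r\<^sup>2)) (at r)"
      using DERIV_add[OF pd_chain[OF Cinf_Y DERIV_const sq] DERIV_mult[OF DERIV_cmult[OF sq] pd_chain[OF Cinf_pd(2)[OF Cinf_Y] DERIV_const sq]], of t 2 t r]
      by (simp add: power2_eq_square power3_eq_cube algebra_simps)
    have l: "((\<lambda>r. r + t) has_field_derivative 1) (at r)" "((\<lambda>r. r - t) has_field_derivative 1) (at r)" for r
      by (auto intro!: derivative_eq_intros)
    show "((\<lambda>r. G t r) has_field_derivative F' (r - t) + Wp (r + t, r - t) + Wq (r + t, r - t)) (at r)" for r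
      using DERIV_add[OF DERIV_chain2[OF F'(2) l(2)] pd_chain[OF CW l(1) l(2)], of r] pdW
      unfolding G_def by (simp add: algebra_simps)
    show "((\<lambda>r. F' (r - t) + Wp (r + t, r - t) + Wq (r + t, r - t)) has_field_derivative
       F'' ?q + pd1 Wp (?p,?q) + pd2 Wq (?p,?q) + 2 * N (?p,?q)) (at r)"
      using DERIV_add[OF DERIV_add[OF DERIV_chain2[OF F'' l(2)] pd_chain[OF CWp l(1) l(2)]] pd_chain[OF CWq l(1) l(2)], of r] mixed
      by (simp add: algebra_simps)
  qed (use r in auto)
  ultimately show ?thesis by (simp add: N_def algebra_simps power2_eq_square power3_eq_cube)
qed

text \<open>Three overlapping ranges of rho: near the origin and beyond 36 the solution vanishes on
  an open set, and in between 1 < r < 7, so \<open>V_wave\<close> applies.\<close>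

lemma Y_equation:
  assumes t: "0 \<le> t" "t \<le> 2" and \<rho>: "\<rho> \<ge> 0"
  shows "pd1 (pd1 Y) (t,\<rho>) - (6 * pd2 Y (t,\<rho>) + 4 * \<rho> * pd2 (pd2 Y) (t,\<rho>)) + Y (t,\<rho>) ^ 7 = 0"
proof -
  consider "\<rho> < 2" | "1 < \<rho>" "\<rho> < 49" | "\<rho> > 36" by linarith
  then show ?thesis
  proof cases
    case 1
    let ?W = "{-41/20<..<41/20} \<times> {..<2} :: (real \<times> real) set"
    have W: "open ?W" "\<And>z. z \<in> ?W \<Longrightarrow> Y z = 0" "(t,\<rho>) \<in> ?W"
      using 1 t Y_zero(1) by (auto intro!: open_Times)
    show ?thesis using pd_Y_zero[OF W] W(2)[OF W(3)] by simp
  next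
    case 2
    define r where "r = sqrt \<rho>"
    have "r < sqrt 49" using 2 unfolding r_def by (intro real_sqrt_less_mono) auto
    moreover have "sqrt 49 = (7::real)" by (rule real_sqrt_unique) auto
    ultimately have r: "1 < r" "r < 7" "r\<^sup>2 = \<rho>" using 2 by (auto simp: r_def)
    have "source A \<epsilon> w (r + t, r - t) = 1/4 * inverse r ^ 6 * V t r ^ 7"
      using r by (simp add: source_def coeff_def V_def sigma_eq)
    moreover have "r * (V t r / r) ^ 7 = (r * inverse r) * (inverse r ^ 6 * V t r ^ 7)"
      by (simp only: divide_inverse power_mult_distrib) (simp add: eval_nat_numeral)
    moreover have "Y (t,\<rho>) = V t r / r"
      using Y_outer[of r t] r by simp
    ultimately have "r * Y (t,\<rho>) ^ 7 = 4 * source A \<epsilon> w (r + t, r - t)"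
      using r(1) by simp
    then have "r * (pd1 (pd1 Y) (t,\<rho>) - (6 * pd2 Y (t,\<rho>) + 4 * \<rho> * pd2 (pd2 Y) (t,\<rho>)) + Y (t,\<rho>) ^ 7) = 0"
      using V_wave[OF r(1,2) t] r(3) by (simp add: distrib_left)
    then show ?thesis using r by simp
  next
    case 3
    let ?W = "{-41/20<..<41/20} \<times> {36<..} :: (real \<times> real) set"
    have "Y (t,\<rho>) = 0" if "\<bar>t\<bar> < 41/20" "\<rho> > 36" for t \<rho>
      by (rule Y_zero(2)[where r = 6]) (use that \<epsilon> in auto)
    then have W: "open ?W" "\<And>z. z \<in> ?W \<Longrightarrow> Y z = 0" "(t,\<rho>) \<in> ?W"
      using 3 t by (auto intro!: open_Times)
    show ?thesis using pd_Y_zero[OF W] W(2)[OF W(3)] by simp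
  qed
qed

text \<open>Y vanishes beyond radius 18/5 for all |t| < 1/20, an open time interval, so the time
  derivative vanishes there too.\<close>

lemma data_support:
  fixes x :: "real^3"
  assumes "norm x > 18/5" shows "Y (0, x \<bullet> x) = 0" "pd1 Y (0, x \<bullet> x) = 0"
proof -
  let ?W = "{-1/20<..<1/20} \<times> {(18/5)\<^sup>2<..} :: (real \<times> real) set"
  have *: "Y (t,\<rho>) = 0" if "\<bar>t\<bar> < 1/20" "\<rho> > (18/5)\<^sup>2" for t \<rho>
    by (rule Y_zero(2)[where r = "18/5"]) (use that \<epsilon> in auto)
  have "(18/5)\<^sup>2 < (norm x)\<^sup>2" using assms by (intro power_strict_mono) auto
  then have x: "x \<bullet> x > (18/5)\<^sup>2" by (simp add: power2_norm_eq_inner)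
  then have W: "open ?W" "\<And>z. z \<in> ?W \<Longrightarrow> Y z = 0" "(0,x \<bullet> x) \<in> ?W"
    using * by (auto intro!: open_Times)
  show "Y (0, x \<bullet> x) = 0" by (rule W(2)[OF W(3)])
  show "pd1 Y (0, x \<bullet> x) = 0" using pd_Y_zero(1)[OF W] .
qed

lemma Cc_Y:
  assumes "0 \<le> t" "t \<le> 2" shows "Cc (\<lambda>x. Y (t, x \<bullet> x))"
  unfolding Cc_def
proof (intro conjI exI allI impI)
  show "Cinf (\<lambda>x :: real^3. Y (t, x \<bullet> x))" by (rule Cinf_radial_slice[OF Cinf_Y])
  fix x :: "real^3" assume "norm x > 6"
  then have "6\<^sup>2 \<le> (norm x)\<^sup>2" by (intro power_mono) auto
  then show "Y (t, x \<bullet> x) = 0"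
    by (intro Y_zero(2)[where r = 6]) (use assms \<epsilon> in \<open>auto simp: power2_norm_eq_inner\<close>)
qed

text \<open>The profile is at least 4/5 of its height here, the correction costs at most 1/10, and
  the radius is at most 6.\<close>

lemma Y_core:
  fixes x :: "real^3"
  assumes "0 \<le> t" "t \<le> 2" "\<bar>norm x - t - 7/2\<bar> \<le> \<epsilon> / 4"
  shows "Y (t, x \<bullet> x) \<ge> (4/5 * A - 1/10) / 6"
proof -
  have r: "1 \<le> norm x" "norm x \<le> 6" using assms \<epsilon> by linarith+
  have "4/5 * A - 1/10 \<le> V t (norm x)"
    using shell_ge[of A \<epsilon> "norm x - t"] w_le[of "(norm x + t, norm x - t)"] A \<epsilon> assms(3) by (auto simp: V_def abs_le_iff)
  then have "(4/5 * A - 1/10) / 6 \<le> V t (norm x) / norm x"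
    using r A by (intro frac_le) auto
  then show ?thesis using Y_outer[OF r(1), of t] by (simp add: power2_norm_eq_inner)
qed

lemma Y_off_shell:
  fixes x :: "real^3"
  assumes "norm x \<ge> 1" "\<bar>norm x - t - 7/2\<bar> \<ge> \<epsilon>"
  shows "\<bar>Y (t, x \<bullet> x)\<bar> \<le> 1/10"
proof -
  have "\<bar>V t (norm x)\<bar> \<le> 1/10"
    using shell_zero[OF \<epsilon>(1), of "norm x - t"] assms(2) w_le by (simp add: V_def)
  then have "\<bar>V t (norm x)\<bar> / norm x \<le> (1/10) / 1" using assms by (intro frac_le) auto
  then show ?thesis using Y_outer[OF assms(1), of t] assms(1) by (simp add: power2_norm_eq_inner abs_divide)
qed

end

subsection \<open>Spherical shells inside a cone\<close>

definition e1 :: "real^3" where "e1 = axis 1 1"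

lemma e1_inner: "e1 \<bullet> e1 = 1" and norm_e1: "norm e1 = 1"
  by (simp_all add: e1_def inner_axis_axis)

text \<open>A cone of half-angle 60 degrees about \<open>e1\<close>. Inside it a shift along
  \<open>e1\<close> changes |x| at a definite rate, and its dilation invariance gives volumes by
  scaling.\<close>

definition cone_ball :: "real \<Rightarrow> (real^3) set" where
  "cone_ball \<rho> = {x. norm x / 2 \<le> x \<bullet> e1 \<and> norm x < \<rho>}"

definition cone_vol :: real where
  "cone_vol = measure lborel (cone_ball 1)"

lemma cone_ball_borel [measurable]: "cone_ball \<rho> \<in> sets borel"
  unfolding cone_ball_def by measurable

lemma cone_ball_finite: "emeasure lborel (cone_ball \<rho>) < \<infinity>"
  by (rule emeasure_bounded_finite, rule bounded_subset[of "ball 0 \<rho>"]) (auto simp: cone_ball_def)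

lemma cone_vol_pos: "cone_vol > 0"
proof -
  let ?B = "ball ((1/2) *\<^sub>R e1) (1/8)"
  have "?B \<subseteq> cone_ball 1"
  proof
    fix x assume "x \<in> ?B"
    then have d: "norm (x - (1/2) *\<^sub>R e1) < 1/8" by (simp add: dist_norm norm_minus_commute)
    have "\<bar>(x - (1/2) *\<^sub>R e1) \<bullet> e1\<bar> \<le> norm (x - (1/2) *\<^sub>R e1)"
      using Cauchy_Schwarz_ineq2[of "x - (1/2) *\<^sub>R e1" e1] norm_e1 by simp
    then have "x \<bullet> e1 \<ge> 3/8" using d by (simp add: inner_diff_left e1_inner)
    moreover have "norm x \<le> 5/8"
      using norm_triangle_ineq[of "x - (1/2) *\<^sub>R e1" "(1/2) *\<^sub>R e1"] d norm_e1 by simp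
    ultimately show "x \<in> cone_ball 1" by (simp add: cone_ball_def)
  qed
  then have "emeasure lborel ?B \<le> emeasure lborel (cone_ball 1)"
    by (intro emeasure_mono) auto
  moreover have "emeasure lborel ?B > 0"
    by (simp add: emeasure_ball unit_ball_vol_pos)
  ultimately show ?thesis
    using cone_ball_finite[of 1] by (auto simp: cone_vol_def measure_def enn2real_positive_iff)
qed

lemma emeasure_cone_ball:
  assumes "\<rho> > 0" shows "emeasure lborel (cone_ball \<rho>) = ennreal (cone_vol * \<rho> ^ 3)"
proof -
  have "emeasure lborel (cone_ball \<rho>) = emeasure (density (distr lborel borel (\<lambda>x. 0 + \<rho> *\<^sub>R x)) (\<lambda>_. ennreal (\<bar>\<rho>\<bar> ^ DIM(real^3)))) (cone_ball \<rho>)"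
    using lborel_affine[of \<rho> "0 :: real^3"] assms by simp
  also have "\<dots> = ennreal (\<rho> ^ 3) * emeasure lborel ((\<lambda>x. \<rho> *\<^sub>R x) -` cone_ball \<rho>)"
    using assms by (subst emeasure_density_const) (auto simp: emeasure_distr card_Basis3)
  also have "(\<lambda>x. \<rho> *\<^sub>R x) -` cone_ball \<rho> = cone_ball 1"
    using assms by (auto simp: cone_ball_def field_simps)
  also have "emeasure lborel (cone_ball 1) = ennreal cone_vol"
    unfolding cone_vol_def using cone_ball_finite[of 1] by (intro emeasure_eq_ennreal_measure) auto
  finally show ?thesis using assms cone_vol_pos by (simp add: ennreal_mult[symmetric] mult.commute)
qed

text \<open>The volume is proportional to b^3 - a^3, which dominates b - a for radii at least
  1.\<close>

lemma emeasure_cone_shell: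
  assumes "1 \<le> a" "a \<le> b"
  shows "ennreal (cone_vol * (b - a)) \<le> emeasure lborel (cone_ball b - cone_ball a)"
proof -
  have "emeasure lborel (cone_ball b - cone_ball a) = emeasure lborel (cone_ball b) - emeasure lborel (cone_ball a)"
    using assms cone_ball_finite[of a] by (intro emeasure_Diff) (auto simp: cone_ball_def)
  also have "\<dots> = ennreal (cone_vol * (b ^ 3 - a ^ 3))"
    using assms cone_vol_pos by (simp add: emeasure_cone_ball ennreal_minus right_diff_distrib)
  also have "\<dots> \<ge> ennreal (cone_vol * (b - a))"
  proof (intro ennreal_leI mult_left_mono)
    have "1 * 1 \<le> b * b" using assms by (intro mult_mono) auto
    then have "(b - a) * 1 \<le> (b - a) * (b * b + a * b + a * a)"
      using assms by (intro mult_left_mono) (auto intro!: add_increasing2)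
    also have "\<dots> = b ^ 3 - a ^ 3" by (simp add: power3_eq_cube algebra_simps)
    finally show "b - a \<le> b ^ 3 - a ^ 3" by simp
  qed (use cone_vol_pos in auto)
  finally show ?thesis .
qed

subsection \<open>Lower bounds for the norms\<close>

lemma ennpowr_ge:
  assumes "ennreal a \<le> X" "0 \<le> a" "0 \<le> r"
  shows "ennreal (a powr r) \<le> ennpowr X r"
proof (cases X)
  case (real x)
  then show ?thesis using assms by (auto simp: ennpowr_def intro!: ennreal_leI powr_mono2)
qed (simp add: ennpowr_def)

text \<open>The denominator bounds \<open>8 / \<alpha> + 8 \<pi> / (2 - \<alpha>)\<close> on \<open>1/6 < \<alpha> < 7/6\<close>.\<close>

definition strichartz_const :: real where
  "strichartz_const = exp (- pi) / (48 + 48 * pi / 5)"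

lemma strichartz_const_pos: "strichartz_const > 0"
  by (auto simp: strichartz_const_def intro!: divide_pos_pos add_pos_pos)

context thin_shell
begin

abbreviation sol :: "real \<Rightarrow> real^3 \<Rightarrow> real" where
  "sol t x \<equiv> Y (t, x \<bullet> x)"

text \<open>The part of the shell where \<open>Y_core\<close> applies, cut down to the cone so that
  translation by \<open>shift\<close> in either direction leaves the shell.\<close>

definition core :: "real \<Rightarrow> (real^3) set" where
  "core t = cone_ball (7/2 + t + \<epsilon> / 4) - cone_ball (7/2 + t - \<epsilon> / 4)"

definition shift :: "real^3" where
  "shift = (8 * \<epsilon>) *\<^sub>R e1"

lemma norm_shift: "norm shift = 8 * \<epsilon>"
  using \<epsilon> by (simp add: shift_def norm_e1)

lemma core_iff: "x \<in> core t \<longleftrightarrow> norm x / 2 \<le> x \<bullet> e1 \<and> 7/2 + t - \<epsilon> / 4 \<le> norm x \<and> norm x < 7/2 + t + \<epsilon> / 4"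
  by (auto simp: core_def cone_ball_def)

lemma core_borel [measurable]: "core t \<in> sets borel"
  by (simp add: core_def)

lemma emeasure_core:
  assumes "0 \<le> t" shows "ennreal (cone_vol * (\<epsilon> / 2)) \<le> emeasure lborel (core t)"
proof -
  have "ennreal (cone_vol * ((7/2 + t + \<epsilon> / 4) - (7/2 + t - \<epsilon> / 4))) \<le> emeasure lborel (core t)"
    unfolding core_def using assms \<epsilon> by (intro emeasure_cone_shell) auto
  moreover have "(7/2 + t + \<epsilon> / 4) - (7/2 + t - \<epsilon> / 4) = \<epsilon> / 2" by simp
  ultimately show ?thesis by (simp only:)
qed

text \<open>To first order the norm moves by 8 \<epsilon> times a cosine that is at least 1/2.
  Outwards the quadratic term helps; inwards it costs 64 \<epsilon>^2, which
  \<open>norm x \<ge> 15 * \<epsilon>\<close> absorbs when only 2 \<epsilon> is claimed. Both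
  displacements exceed the 5/4 \<epsilon> needed to get from the core out of the shell.\<close>

lemma norm_shift_bounds:
  assumes "norm x / 2 \<le> x \<bullet> e1" "norm x \<ge> 3"
  shows "norm x + 4 * \<epsilon> \<le> norm (shift + x)" "norm (- shift + x) \<le> norm x - 2 * \<epsilon>"
proof -
  have xe: "\<epsilon> * norm x \<le> 2 * (\<epsilon> * (x \<bullet> e1))"
    using mult_left_mono[OF assms(1), of "2 * \<epsilon>"] \<epsilon> by simp
  have xe2: "\<epsilon> * (15 * \<epsilon>) \<le> \<epsilon> * norm x"
    using \<epsilon> assms(2) by (intro mult_left_mono) auto
  have e2: "0 \<le> \<epsilon> * \<epsilon>" by simp
  have n: "norm x * norm x = x \<bullet> x" by (simp add: power2_norm_eq_inner flip: power2_eq_square)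
  have p: "(norm (shift + x))\<^sup>2 = x \<bullet> x + 16 * (\<epsilon> * (x \<bullet> e1)) + 64 * (\<epsilon> * \<epsilon>)"
    unfolding power2_norm_eq_inner shift_def by (simp add: inner_simps inner_commute e1_inner algebra_simps)
  have m: "(norm (- shift + x))\<^sup>2 = x \<bullet> x - 16 * (\<epsilon> * (x \<bullet> e1)) + 64 * (\<epsilon> * \<epsilon>)"
    unfolding power2_norm_eq_inner shift_def by (simp add: inner_simps inner_commute e1_inner algebra_simps)
  show "norm x + 4 * \<epsilon> \<le> norm (shift + x)"
  proof (rule power2_le_imp_le)
    have "(norm x + 4 * \<epsilon>)\<^sup>2 = x \<bullet> x + 8 * (\<epsilon> * norm x) + 16 * (\<epsilon> * \<epsilon>)"
      by (simp add: power2_eq_square n algebra_simps)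
    then show "(norm x + 4 * \<epsilon>)\<^sup>2 \<le> (norm (shift + x))\<^sup>2" unfolding p using xe e2 by linarith
  qed simp
  show "norm (- shift + x) \<le> norm x - 2 * \<epsilon>"
  proof (rule power2_le_imp_le)
    have "(norm x - 2 * \<epsilon>)\<^sup>2 = x \<bullet> x - 4 * (\<epsilon> * norm x) + 4 * (\<epsilon> * \<epsilon>)"
      by (simp add: power2_eq_square n algebra_simps)
    then show "(norm (- shift + x))\<^sup>2 \<le> (norm x - 2 * \<epsilon>)\<^sup>2" unfolding m using xe xe2 by linarith
  qed (use assms \<epsilon> in auto)
qed

text \<open>The central value is at least 3/5 because \<open>A \<ge> 10\<close>, the translates are
  at most 1/10, and 2 * 3/5 - 2 * 1/10 = 1.\<close>

lemma sdiff_core: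
  assumes t: "0 \<le> t" "t \<le> 2" and x: "x \<in> core t"
  shows "sdiff shift (sol t) x \<ge> 1"
proof -
  have x': "norm x / 2 \<le> x \<bullet> e1" "7/2 + t - \<epsilon> / 4 \<le> norm x" "norm x < 7/2 + t + \<epsilon> / 4"
    using x by (auto simp: core_iff)
  have n3: "norm x \<ge> 3" using x'(2) t \<epsilon> by linarith
  note b = norm_shift_bounds[OF x'(1) n3]
  have "norm (- shift + x) \<ge> norm x - 8 * \<epsilon>"
    using norm_triangle_ineq2[of x shift] by (simp add: norm_shift algebra_simps)
  then have "norm (- shift + x) \<ge> 1" using n3 \<epsilon> by linarith
  then have m: "\<bar>sol t (- shift + x)\<bar> \<le> 1/10"
    using b(2) x' \<epsilon> by (intro Y_off_shell) auto
  have p: "\<bar>sol t (shift + x)\<bar> \<le> 1/10"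
    using b(1) x' \<epsilon> n3 by (intro Y_off_shell) auto
  have "sol t x \<ge> (4/5 * A - 1/10) / 6"
  proof (rule Y_core[OF t])
    show "\<bar>norm x - t - 7/2\<bar> \<le> \<epsilon> / 4" unfolding abs_le_iff using x' by linarith
  qed
  then have "sol t x \<ge> 3/5" using A by auto
  then show ?thesis using p m by (simp add: sdiff_def abs_le_iff)
qed

text \<open>Split |h|^(-\<alpha> q) into |h|^(-q/6) and |h|^(-2). The first factor beats the q-th
  power of the constant for every q at once when
  \<open>8 * \<epsilon> \<le> strichartz_const ^ 6\<close>. The second is 1 / (64 \<epsilon>^2), and
  multiplied by the core volume \<open>cone_vol * (\<epsilon> / 2)\<close> it is at least 1 when
  \<open>\<epsilon> \<le> cone_vol / 128\<close>.\<close>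

lemma Strichartz_slice:
  assumes t: "0 \<le> t" "t \<le> 2" and q: "q > 2" and small: "8 * \<epsilon> \<le> strichartz_const ^ 6" "\<epsilon> \<le> cone_vol / 128"
  shows "(\<integral>\<^sup>+x. ennreal (cmod (fracD (2 / q + 1 / 6) (sol t) x) powr q) \<partial>lborel) \<ge> 1"
proof -
  define \<alpha> where "\<alpha> = 2 / q + 1 / 6"
  have \<alpha>: "1/6 < \<alpha>" "\<alpha> < 7/6" using q by (auto simp: \<alpha>_def field_simps)
  define H where "H = 8 * \<epsilon>"
  have H: "H > 0" using \<epsilon> by (simp add: H_def)
  define l where "l = riesz_const \<alpha> / ((8 / \<alpha> + 8 * pi / (2 - \<alpha>)) * norm shift powr \<alpha>)"
  have "strichartz_const * H powr (- \<alpha>) \<le> l"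
  proof -
    have "8 / \<alpha> \<le> 8 / (1/6)" using \<alpha> by (intro divide_left_mono) auto
    moreover have "8 * pi / (2 - \<alpha>) \<le> 8 * pi / (5/6)" using \<alpha> by (intro divide_left_mono) auto
    ultimately have "8 / \<alpha> + 8 * pi / (2 - \<alpha>) \<le> 48 + 48 * pi / 5" by simp
    moreover have "0 < 8 / \<alpha> + 8 * pi / (2 - \<alpha>)" using \<alpha> by (intro add_pos_pos divide_pos_pos) auto
    moreover have "exp (- pi) \<le> riesz_const \<alpha>" using \<alpha> by (intro riesz_const_ge) auto
    ultimately have "strichartz_const \<le> riesz_const \<alpha> / (8 / \<alpha> + 8 * pi / (2 - \<alpha>))"
      unfolding strichartz_const_def by (intro frac_le) (auto intro: order_trans[of 0 "exp (- pi)"])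
    then have "strichartz_const * H powr (- \<alpha>) \<le> riesz_const \<alpha> / (8 / \<alpha> + 8 * pi / (2 - \<alpha>)) * H powr (- \<alpha>)"
      by (intro mult_right_mono) auto
    also have "\<dots> = l" unfolding l_def norm_shift H_def[symmetric] by (simp add: powr_minus divide_simps)
    finally show ?thesis .
  qed
  then have "(strichartz_const * H powr (- \<alpha>)) powr q \<le> l powr q"
    using q strichartz_const_pos by (intro powr_mono2) auto
  moreover have "(strichartz_const * H powr (- \<alpha>)) powr q = (strichartz_const * H powr (- (1/6))) powr q * H powr (- 2)"
  proof -
    have "- \<alpha> = - (1/6) + - (2 / q)" by (simp add: \<alpha>_def)
    then have "H powr (- \<alpha>) = H powr (- (1/6)) * H powr (- (2 / q))" by (simp only: powr_add)
    then have "(strichartz_const * H powr (- \<alpha>)) powr q = (strichartz_const * H powr (- (1/6))) powr q * (H powr (- (2 / q))) powr q"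
      by (simp only: mult.assoc[symmetric] powr_mult)
    also have "(H powr (- (2 / q))) powr q = H powr (- 2)" using q by (simp add: powr_powr)
    finally show ?thesis .
  qed
  moreover have "1 * H powr (- 2) \<le> (strichartz_const * H powr (- (1/6))) powr q * H powr (- 2)"
  proof (intro mult_right_mono ge_one_powr_ge_zero)
    have "H powr (1/6) \<le> (strichartz_const ^ 6) powr (1/6)" using small H by (intro powr_mono2) (auto simp: H_def)
    also have "\<dots> = strichartz_const" using strichartz_const_pos by (simp add: powr_powr flip: powr_numeral)
    finally show "1 \<le> strichartz_const * H powr (- (1/6))" using H by (simp add: powr_minus divide_simps)
  qed (use q in auto)
  moreover have "H powr (- 2) = 1 / (64 * \<epsilon>\<^sup>2)"
    using H by (simp add: powr_minus_divide H_def power_mult_distrib)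
  ultimately have lq: "1 / (64 * \<epsilon>\<^sup>2) \<le> l powr q" by linarith
  have "1 \<le> 1 / (64 * \<epsilon>\<^sup>2) * (cone_vol * (\<epsilon> / 2))"
    using small(2) \<epsilon> by (simp add: power2_eq_square field_simps)
  also have "\<dots> \<le> l powr q * (cone_vol * (\<epsilon> / 2))"
    using lq cone_vol_pos \<epsilon> by (intro mult_right_mono) auto
  finally have "1 \<le> ennreal (l powr q) * ennreal (cone_vol * (\<epsilon> / 2))"
    using cone_vol_pos \<epsilon> by (simp add: ennreal_mult[symmetric])
  also have "\<dots> \<le> ennreal (l powr q) * emeasure lborel (core t)"
    by (intro mult_left_mono emeasure_core t) auto
  also have "\<dots> \<le> (\<integral>\<^sup>+x. ennreal (cmod (fracD \<alpha> (sol t) x) powr q) \<partial>lborel)"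
    unfolding l_def
  proof (rule fracD_lower_bound)
    show "Cc (sol t)" by (rule Cc_Y[OF t])
    show "shift \<noteq> 0" using norm_shift \<epsilon> by auto
    show "1 \<le> sdiff shift (sol t) x" if "x \<in> core t" for x by (rule sdiff_core[OF t that])
  qed (use \<alpha> q in auto)
  finally show ?thesis by (simp add: \<alpha>_def)
qed

text \<open>Every time slice has inner integral at least 1, so the exponents \<open>p / q\<close>
  and \<open>1 / p\<close> preserve the bound, and the time interval has length 2.\<close>

lemma Strichartz_ge:
  assumes "p > 2" "1 / p + 1 / q = 1 / 2" and small: "8 * \<epsilon> \<le> strichartz_const ^ 6" "\<epsilon> \<le> cone_vol / 128"
  shows "strichartz p q (2 / q + 1 / 6) 2 sol \<ge> 1"
proof -
  have "1 / q = 1/2 - 1/p" using assms by simp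
  moreover have "0 < 1/2 - 1/p" "1/2 - 1/p < 1/2" using assms(1) by (auto simp: field_simps)
  ultimately have "0 < 1 / q" "1 / q < 1/2" by auto
  then have q: "q > 2" by (auto simp: field_simps zero_less_divide_iff split: if_splits)
  let ?I = "\<lambda>t. \<integral>\<^sup>+x. ennreal (cmod (fracD (2 / q + 1 / 6) (sol t) x) powr q) \<partial>lborel"
  have one: "1 \<le> ennpowr X r" if "1 \<le> X" "r \<ge> 0" for X r
    using ennpowr_ge[of 1 X r] that by simp
  have "1 \<le> emeasure lborel {0..2::real}" by simp
  also have "\<dots> = (\<integral>\<^sup>+t. indicator {0..2::real} t \<partial>lborel)" by simp
  also have "\<dots> \<le> (\<integral>\<^sup>+t. indicator {0..2} t * ennpowr (?I t) (p / q) \<partial>lborel)"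
  proof (intro nn_integral_mono)
    fix t :: real
    show "indicator {0..2} t \<le> indicator {0..2} t * ennpowr (?I t) (p / q)"
      using one[OF Strichartz_slice[OF _ _ q small], of t "p / q"] assms(1) q by (auto simp: indicator_def)
  qed
  finally show ?thesis unfolding strichartz_def using assms(1) by (intro one) auto
qed

text \<open>The squared second difference has integral at least of order \<epsilon>, while
  \<open>sdiff_le_hdot\<close> charges a factor of order \<epsilon>^(7/3), here weakened to
  \<epsilon>^2. The first component of the data already reaches \<open>M + 1\<close>, which makes
  the inequality strict.\<close>

lemma data_norm_ge:
  assumes M: "M > 0" and small: "8 * pi * \<epsilon> \<le> 1" "\<epsilon> \<le> cone_vol / (2048 * pi\<^sup>2 * (M + 1)\<^sup>2)"
  shows "data_norm (sol 0) g > ennreal M"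
proof -
  let ?I = "\<integral>\<^sup>+\<xi>. ennreal (norm \<xi> powr (2 * (7/6)) * (cmod (ft (\<lambda>x. complex_of_real (sol 0 x)) \<xi>))\<^sup>2) \<partial>lborel"
  define J where "J = 16 * (pi * norm shift) powr (7/3)"
  have J: "J > 0" using \<epsilon> by (simp add: J_def norm_shift)
  have "J \<le> 16 * (8 * pi * \<epsilon>)\<^sup>2"
  proof -
    have "(8 * pi * \<epsilon>) powr (7/3) \<le> (8 * pi * \<epsilon>) powr 2"
      using small \<epsilon> by (intro powr_mono') auto
    then show ?thesis using \<epsilon> by (simp add: J_def norm_shift mult_ac)
  qed
  then have "(M + 1)\<^sup>2 * J \<le> (M + 1)\<^sup>2 * (16 * (8 * pi * \<epsilon>)\<^sup>2)"
    by (intro mult_left_mono) auto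
  also have "\<dots> = (\<epsilon> * (2048 * pi\<^sup>2 * (M + 1)\<^sup>2)) * (\<epsilon> / 2)"
    by (simp add: power2_eq_square algebra_simps)
  also have "\<dots> \<le> cone_vol * (\<epsilon> / 2)"
    using small(2) M \<epsilon> by (intro mult_right_mono) (auto simp: pos_le_divide_eq)
  finally have "ennreal ((M + 1)\<^sup>2 * J) \<le> ennreal (cone_vol * (\<epsilon> / 2))" by (rule ennreal_leI)
  also have "\<dots> \<le> emeasure lborel (core 0)" by (rule emeasure_core) simp
  also have "\<dots> = (\<integral>\<^sup>+x. indicator (core 0) x \<partial>lborel)" by simp
  also have "\<dots> \<le> (\<integral>\<^sup>+x. ennreal ((sdiff shift (sol 0) x)\<^sup>2) \<partial>lborel)"
  proof (intro nn_integral_mono)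
    fix x :: "real^3"
    show "indicator (core 0) x \<le> ennreal ((sdiff shift (sol 0) x)\<^sup>2)"
      using sdiff_core[of 0 x] one_le_power[of "sdiff shift (sol 0) x" 2] by (auto simp: indicator_def)
  qed
  also have "\<dots> \<le> ennreal J * ?I"
    unfolding J_def by (rule sdiff_le_hdot) (rule Cc_Y, auto)
  finally have "ennreal J * ennreal ((M + 1)\<^sup>2) \<le> ennreal J * ?I"
    using J by (simp add: ennreal_mult[symmetric] mult.commute)
  then have I: "ennreal ((M + 1)\<^sup>2) \<le> ?I"
    using J by (subst (asm) ennreal_mult_le_mult_iff) auto
  have sqrt: "((M + 1)\<^sup>2) powr (1/2) = M + 1" using M by (simp add: powr_half_sqrt)
  have "ennreal (M + 1) \<le> hdot_norm (7/6) (sol 0)"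
    using ennpowr_ge[OF I, of "1/2"] sqrt by (simp add: hdot_norm_def)
  then have "(ennreal (M + 1))\<^sup>2 \<le> (hdot_norm (7/6) (sol 0))\<^sup>2"
    by (intro power_mono) auto
  also have "(ennreal (M + 1))\<^sup>2 = ennreal ((M + 1)\<^sup>2)" using M by (intro ennreal_power) auto
  also have "(hdot_norm (7/6) (sol 0))\<^sup>2 \<le> (hdot_norm (7/6) (sol 0))\<^sup>2 + (hdot_norm (1/6) g)\<^sup>2"
    by simp
  finally have "ennreal (M + 1) \<le> data_norm (sol 0) g"
    using ennpowr_ge[of "(M + 1)\<^sup>2" _ "1/2"] sqrt by (simp add: data_norm_def)
  moreover have "ennreal M < ennreal (M + 1)" using M by (intro ennreal_lessI) auto
  ultimately show ?thesis by order
qed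

text \<open>An essential supremum sees only sets of positive measure. The core at time 0 is such a
  set inside |x| >= 1, and there the data are at least (4/5 A - 1/10) / 6, which exceeds M.\<close>

lemma esssup_ge:
  assumes "A \<ge> 8 * M + 10" "M > 0"
  shows "esssup (restrict_space lborel {x :: real^3. norm x \<ge> 1}) (\<lambda>x. ennreal \<bar>sol 0 x\<bar>) > ennreal M"
proof (rule ccontr)
  let ?R = "restrict_space lborel {x :: real^3. norm x \<ge> 1}"
  assume "\<not> esssup ?R (\<lambda>x. ennreal \<bar>sol 0 x\<bar>) > ennreal M"
  then have le: "esssup ?R (\<lambda>x. ennreal \<bar>sol 0 x\<bar>) \<le> ennreal M" by simp
  have "AE x in ?R. ennreal \<bar>sol 0 x\<bar> \<le> ennreal M"
    using esssup_AE[of "\<lambda>x. ennreal \<bar>sol 0 x\<bar>" ?R] by eventually_elim (use le in order)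
  then have "AE x in lborel. norm x \<ge> 1 \<longrightarrow> \<bar>sol 0 x\<bar> \<le> M"
    using assms(2) by (subst (asm) AE_restrict_space_iff) auto
  then have "AE x in lborel. x \<notin> core 0"
  proof eventually_elim
    case (elim x)
    show ?case
    proof
      assume "x \<in> core 0"
      then have x: "7/2 - \<epsilon> / 4 \<le> norm x" "norm x < 7/2 + \<epsilon> / 4" by (auto simp: core_iff)
      then have "sol 0 x \<ge> (4/5 * A - 1/10) / 6"
      proof (intro Y_core)
        show "\<bar>norm x - 0 - 7/2\<bar> \<le> \<epsilon> / 4" unfolding abs_le_iff using x by linarith
      qed auto
      moreover have "norm x \<ge> 1" using x \<epsilon> by linarith
      ultimately show False using elim assms by (auto simp: abs_le_iff)
    qed
  qed
  then have "emeasure lborel (core 0) = 0"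
    by (subst (asm) AE_iff_measurable[OF _ refl]) auto
  then show False using emeasure_core[of 0] mult_pos_pos[OF cone_vol_pos \<epsilon>(1)] by (simp add: ennreal_eq_0_iff)
qed

lemma data_supp:
  "closure {x. sol 0 x \<noteq> 0} \<subseteq> ball 0 4" "closure {x :: real^3. pd1 Y (0, x \<bullet> x) \<noteq> 0} \<subseteq> ball 0 4"
proof -
  have *: "closure S \<subseteq> ball 0 4" if "\<And>x. x \<in> S \<Longrightarrow> norm x \<le> 18/5" for S :: "(real^3) set"
  proof -
    have "closure S \<subseteq> cball 0 (18/5)" using that by (intro closure_minimal) auto
    also have "\<dots> \<subseteq> ball 0 4" by auto
    finally show ?thesis .
  qed
  show "closure {x. sol 0 x \<noteq> 0} \<subseteq> ball 0 4" "closure {x :: real^3. pd1 Y (0, x \<bullet> x) \<noteq> 0} \<subseteq> ball 0 4"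
    using data_support by (intro *; force simp: not_le[symmetric])+
qed

end

section \<open>Choice of the parameters and conclusion\<close>

theorem theorem1p4:
  fixes M1 M2 :: real
  assumes "M1 > 0" and "M2 > 0"
  shows "\<exists>(K::real) (f::real^3 \<Rightarrow> real) (g::real^3 \<Rightarrow> real) (u::real \<Rightarrow> real^3 \<Rightarrow> real).
           K \<ge> 1 \<and>
           smooth_on UNIV f \<and> smooth_on UNIV g \<and> radial f \<and> radial g \<and>
           closure {x. f x \<noteq> 0} \<subseteq> ball 0 K \<and> closure {x. g x \<noteq> 0} \<subseteq> ball 0 K \<and>
           data_norm f g > ennreal M1 \<and>
           nlw_solution (K / 2) f g u \<and>
           (INF pq\<in>{(p, q). 1 / p + 1 / q = 1 / 2 \<and> p > 2}.
               strichartz (fst pq) (snd pq) (2 / snd pq + 1 / 6) (K / 2) u) \<ge> 1 \<and>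
           esssup (restrict_space lborel {x. norm x \<ge> 1}) (\<lambda>x. ennreal \<bar>f x\<bar>) > ennreal M2"
proof -
  define A where "A = 8 * M2 + 10"
  have A: "A \<ge> 10" using assms by (simp add: A_def)
  \<comment> \<open>In this order: the bound required by \<open>thin_shell\<close>, the contraction
    threshold, two conditions for the Strichartz norms, two for the Sobolev norm.\<close>
  define B where "B = {1/100, 1 / (100000 * (A + 1) ^ 7), strichartz_const ^ 6 / 8, cone_vol / 128, 1 / (8 * pi),
    cone_vol / (2048 * pi\<^sup>2 * (M1 + 1)\<^sup>2)}"
  define \<epsilon> where "\<epsilon> = Min B"
  have B: "finite B" "B \<noteq> {}" by (auto simp: B_def)
  have "\<epsilon> > 0" unfolding \<epsilon>_def
    using cone_vol_pos A assms strichartz_const_pos by (subst Min_gr_iff[OF B]) (auto simp: B_def)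
  have le: "\<epsilon> \<le> b" if "b \<in> B" for b unfolding \<epsilon>_def by (rule Min_le[OF B(1) that])
  have "\<epsilon> \<le> 1 / (100000 * (A + 1) ^ 7)" by (rule le) (simp add: B_def)
  moreover have "100000 * (A + 1) ^ 7 > 0" using A by simp
  ultimately have "\<epsilon> * (100000 * (A + 1) ^ 7) \<le> 1" by (simp only: pos_le_divide_eq)
  then have \<epsilon>A: "\<epsilon> * (A + 1) ^ 7 \<le> 1/100000" by simp
  have small: "\<epsilon> \<le> 1/100" "8 * \<epsilon> \<le> strichartz_const ^ 6" "\<epsilon> \<le> cone_vol / 128" "\<epsilon> \<le> cone_vol / (2048 * pi\<^sup>2 * (M1 + 1)\<^sup>2)"
    using le[of "1/100"] le[of "strichartz_const ^ 6 / 8"] le[of "cone_vol / 128"] le[of "cone_vol / (2048 * pi\<^sup>2 * (M1 + 1)\<^sup>2)"]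
    by (auto simp: B_def)
  have "\<epsilon> \<le> 1 / (8 * pi)" by (rule le) (simp add: B_def)
  then have \<epsilon>pi: "8 * pi * \<epsilon> \<le> 1" by (simp add: pos_le_divide_eq mult.commute)
  obtain w where "Cinf w" "\<And>z. \<bar>w z\<bar> \<le> 1/10"
    "\<And>p q. p \<le> 7/2 - \<epsilon> \<Longrightarrow> q \<le> 7/2 - \<epsilon> \<Longrightarrow> w (p,q) = 0"
    "\<And>p q. p \<ge> 7/2 + \<epsilon> \<Longrightarrow> q \<ge> 7/2 + \<epsilon> \<Longrightarrow> w (p,q) = 0"
    "\<And>p q. p \<in> {-2..10} \<Longrightarrow> q \<in> {-2..10} \<Longrightarrow> w (p,q) = Duhamel (source A \<epsilon> w) (p,q)"
    by (rule correction_exists[of A \<epsilon>]) (use A \<open>\<epsilon> > 0\<close> \<epsilon>A in auto)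
  then interpret thin_shell A \<epsilon> w
    using A \<open>\<epsilon> > 0\<close> small(1) by unfold_locales
  let ?g = "\<lambda>x :: real^3. pd1 Y (0, x \<bullet> x)"
  have "smooth_on UNIV (sol 0)" "smooth_on UNIV ?g"
    using Cinf_radial_slice[OF Cinf_Y] Cinf_radial_slice[OF Cinf_pd(1)[OF Cinf_Y]]
    by (auto intro: smooth_on_UNIV)
  moreover have "radial (sol 0)" "radial ?g"
    by (auto simp: radial_def simp flip: power2_norm_eq_inner)
  moreover have "data_norm (sol 0) ?g > ennreal M1"
    using data_norm_ge[OF assms(1) \<epsilon>pi small(4)] .
  moreover have "nlw_solution 2 (sol 0) ?g sol"
    by (rule nlw_solution_radial[OF Cinf_Y _ Y_equation]) auto
  moreover have "(INF pq\<in>{(p, q). 1 / p + 1 / q = 1 / 2 \<and> p > 2}.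
               strichartz (fst pq) (snd pq) (2 / snd pq + 1 / 6) 2 sol) \<ge> 1"
    by (rule INF_greatest) (use Strichartz_ge small in auto)
  moreover have "esssup (restrict_space lborel {x :: real^3. norm x \<ge> 1}) (\<lambda>x. ennreal \<bar>sol 0 x\<bar>) > ennreal M2"
    by (rule esssup_ge) (use assms in \<open>auto simp: A_def\<close>)
  ultimately show ?thesis
    using data_supp by (intro exI[of _ 4] exI[of _ "sol 0"] exI[of _ ?g] exI[of _ sol]) simp
qed

end
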